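(* Let $n\geq 1$. The column presentation $\Sigma^{\mathrm{acol}(n)}=(\Gamma_1,\Omega_2)$ is a finite convergent presentation of the plactic monoid $\mathbf{P}_n(C)$ of type C. That is: the sets $\Gamma_1$ and $\Omega_2$ are finite; the rewriting system $\Omega_2$ on the free monoid $\Gamma_1^{*}$ is terminating and confluent; and the quotient of $\Gamma_1^{*}$ by the congruence generated by $\Omega_2$ is isomorphic to $\mathbf{P}_n(C)$.
   Context: **Words and crystal operators.** Let $\mathcal{C}_n=\{1<2<\dots<n<\overline{n}<\dots<\overline{2}<\overline{1}\}$, a totally ordered alphabet, and $\mathcal{C}_n^{*}$ the free monoid on it; $l(w)$ is the length of a word $w$. The letters $1,\dots,n$ are called unbarred. For $i\in\{1,\dots,n\}$ and a word $w$, the operators $\widetilde e_i,\widetilde f_i:\mathcal{C}_n^{*}\to\mathcal{C}_n^{*}\cup\{0\}$ are defined as follows. Keep only the letters $i,i+1,\overline{i+1},\overline{i}$ of $w$ (only $n,\overline n$ if $i=n$); mark $i$ and $\overline{i+1}$ by $+$, and $i+1$ and $\overline{i}$ by $-$ (for $i=n$: $n$ by $+$, $\overline n$ by $-$). Repeatedly delete adjacent pairs marked $+-$ (in this order) until none is left; the remaining letters are marked $-^r+^s$. If $r>0$, $\widetilde e_i(w)$ is obtained from $w$ by changing the letter of the rightmost remaining $-$ ($i+1\mapsto i$, $\overline i\mapsto\overline{i+1}$, and for $i=n$: $\overline n\mapsto n$); if $r=0$, $\widetilde e_i(w)=0$. If $s>0$, $\widetilde f_i(w)$ is obtained from $w$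 by changing the letter of the leftmost remaining $+$ ($i\mapsto i+1$, $\overline{i+1}\mapsto\overline i$, and for $i=n$: $n\mapsto\overline n$); if $s=0$, $\widetilde f_i(w)=0$. The crystal graph $G_n$ has vertex set $\mathcal{C}_n^{*}$ and an arrow $a\xrightarrow{i}b$ whenever $\widetilde f_i(a)=b$. Let $B(w)$ be the connected component of $w$; it contains a unique vertex $w^0$ with $\widetilde e_i(w^0)=0$ for all $i$ (the highest weight vertex). The weight of a word is determined by $(d_1,\dots,d_n)$, where $d_i$ is its number of letters $i$ minus its number of letters $\overline i$. **Plactic monoid.** For $u,v\in\mathcal{C}_n^{*}$, $u\sim v$ means that $B(u)$ and $B(v)$ are isomorphic by a weight-preserving isomorphism of labelled directed graphs and that $u$ and $v$ correspond under it, i.e. $u^0$ and $v^0$ have the same weight and there are $i_1,\dots,i_r$ with $u=\widetilde f_{i_1}\cdots\widetilde f_{i_r}(u^0)$ and $v=\widetilde f_{i_1}\cdots\widetilde f_{i_r}(v^0)$. The plactic monoid of type C is $\mathbf{P}_n(C)=\mathcal{C}_n^{*}/\sim$. **Admissible columns.** A column $U$ is a one-column Young diagram filled with letters of $\mathcal{C}_n$ strictly increasing from top to bottom; its reading $\mathrm{w}(U)$ is the word read from top to bottom, $h(U)$ is its number of letters, and column words are readings of columns. $U$ is admissible if for every $m\in\{1,\dots,n\}$ the number $N(m)$ of letters $x$ of $U$ with $x\leq m$ or $x\geq\overline m$ satisfies $N(m)\leq m$; its reading is then called an admissible column word. For an admissible column $U$ let $I=\{x_1>\dots>x_r\}$ be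 the set of unbarred $x$ with $x,\overline x\in U$. There is then (known fact) a set $J=\{y_1>\dots>y_r\}$ of unbarred letters such that $y_1$ is the greatest letter with $y_1<x_1$, $y_1,\overline{y_1}\notin U$, and for $i\geq2$, $y_i$ is the greatest letter with $y_i<\min(y_{i-1},x_i)$, $y_i,\overline{y_i}\notin U$. The column $rU$ is obtained from $U$ by replacing each $\overline{x_i}$ by $\overline{y_i}$ and reordering; $lU$ is obtained by replacing each $x_i$ by $y_i$ and reordering. **Symplectic tableaux.** For columns $U_1,U_2$, write $U_1\leq U_2$ if $h(U_1)\geq h(U_2)$ and, placing $U_1$ to the left of $U_2$ with tops aligned, rows are weakly increasing from left to right. For admissible columns, $U_1\preceq U_2$ means $rU_1\leq lU_2$; $U\succeq V$ means $V\preceq U$, and $U\not\succeq V$ is its negation. A symplectic tableau is $T=U_1\dots U_r$ (columns listed from left to right) with all $U_i$ admissible and $U_i\preceq U_{i+1}$ for all $i$; its reading is $\mathrm{w}(T)=\mathrm{w}(U_r)\mathrm{w}(U_{r-1})\cdots\mathrm{w}(U_1)$. It is known (Lecouvey) that for every word $w$ there is a unique symplectic tableau $P(w)$ with $w\sim\mathrm{w}(P(w))$ (possibly the empty tableau, with zero columns). It is also known that if $u,v$ are readings of admissible columns then $P(uv)$ has at most two columns. **Column presentation.** $\Gamma_1=\{c_u \mid u \text{ a nonempty admissible column word of } \mathcal{C}_n^{*}\}$, where $c_u$ represents the class of $u$ in $\mathbf{P}_n(C)$. For $u,v$ the readings of nonempty admissible columns $U,V$ with $U\not\succeq V$, $\Omega_2$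 contains exactly one rule $\alpha_{u,v}$ with source $c_uc_v$, namely: $c_uc_v\Rightarrow c_wc_{w'}$ if $P(uv)$ has two columns, where $w$ and $w'$ are the readings of its right and left columns respectively; $c_uc_v\Rightarrow c_w$ if $P(uv)$ has a single column, with reading $w$; and $c_uc_v\Rightarrow c_\epsilon$, where $c_\epsilon$ denotes the empty word of $\Gamma_1^{*}$, if $P(uv)$ has zero columns. **Rewriting.** A rewriting step replaces $p\,s\,q$ by $p\,t\,q$ for a rule $s\Rightarrow t$ and words $p,q$. The system terminates if there is no infinite sequence of rewriting steps; it is confluent if whenever a word rewrites (in finitely many steps) into $h'$ and $h''$, there is a word into which both $h'$ and $h''$ rewrite (in possibly zero steps); it is convergent if it terminates and is confluent. *)

theory Defs
  imports "HOL-Library.Confluence" "HOL-Algebra.Group"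
begin

section \<open>Words over the alphabet of type C\<close>

datatype letter = Unbarred nat | Bar nat

instantiation letter :: linorder
begin

fun less_eq_letter :: "letter \<Rightarrow> letter \<Rightarrow> bool" where
  "Unbarred i \<le> Unbarred j \<longleftrightarrow> i \<le> j"
| "Unbarred i \<le> Bar j \<longleftrightarrow> True"
| "Bar i \<le> Unbarred j \<longleftrightarrow> False"
| "Bar i \<le> Bar j \<longleftrightarrow> j \<le> i"

definition less_letter :: "letter \<Rightarrow> letter \<Rightarrow> bool" where
  "x < y \<longleftrightarrow> x \<le> y \<and> \<not> y \<le> (x :: letter)"

instance
proof
  fix x y z :: letter
  show "x < y \<longleftrightarrow> x \<le> y \<and> \<not> y \<le> x"
    by (rule less_letter_def)
  show "x \<le> x"
    by (cases x) auto
  show "x \<le> z" if "x \<le> y" "y \<le> z"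
    using that by (cases x; cases y; cases z) auto
  show "x = y" if "x \<le> y" "y \<le> x"
    using that by (cases x; cases y) auto
  show "x \<le> y \<or> y \<le> x"
    by (cases x; cases y) auto
qed

end

definition alphabet :: "nat \<Rightarrow> letter set" where
  "alphabet n = Unbarred ` {1..n} \<union> Bar ` {1..n}"

section \<open>Crystal operators\<close>

datatype sign = Plus | Minus

definition letter_sign :: "nat \<Rightarrow> nat \<Rightarrow> letter \<Rightarrow> sign option" where
  "letter_sign n i x =
     (if x = Unbarred i \<or> (i < n \<and> x = Bar (Suc i)) then Some Plus
      else if x = Bar i \<or> (i < n \<and> x = Unbarred (Suc i)) then Some Minus
      else None)"

text \<open>The marked letters of a word, each given by its position in the word and its mark.\<close>

definition signature :: "nat \<Rightarrow> nat \<Rightarrow> letter list \<Rightarrow> (nat \<times> sign) list" where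
  "signature n i w =
     map (\<lambda>p. (p, the (letter_sign n i (w ! p))))
       (filter (\<lambda>p. letter_sign n i (w ! p) \<noteq> None) [0..<length w])"

text \<open>
  The result of repeatedly deleting adjacent pairs marked plus, minus (in this order).
  The lemmas below confirm that \<open>reduce\<close> computes the normal form for these deletions.
\<close>

fun reduce :: "(nat \<times> sign) list \<Rightarrow> (nat \<times> sign) list" where
  "reduce [] = []"
| "reduce (x # xs) =
     (case reduce xs of
        [] \<Rightarrow> [x]
      | y # ys \<Rightarrow> if snd x = Plus \<and> snd y = Minus then ys else x # y # ys)"

inductive delete_pair :: "(nat \<times> sign) list \<Rightarrow> (nat \<times> sign) list \<Rightarrow> bool" where
  "delete_pair (xs @ (p, Plus) # (q, Minus) # ys) (xs @ ys)"

lemma delete_pair_Cons: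
  assumes "delete_pair xs ys"
  shows "delete_pair (x # xs) (x # ys)"
  using assms
proof cases
  case (1 as p q bs)
  then show ?thesis
    using delete_pair.intros[of "x # as" p q bs] by simp
qed

lemma delete_pairs_reduce: "delete_pair\<^sup>*\<^sup>* xs (reduce xs)"
proof (induction xs)
  case Nil
  show ?case by simp
next
  case (Cons x xs)
  have "delete_pair\<^sup>*\<^sup>* (x # xs) (x # zs)" if "delete_pair\<^sup>*\<^sup>* xs zs" for zs
    using that by induction (auto intro: rtranclp.rtrancl_into_rtrancl delete_pair_Cons)
  then have *: "delete_pair\<^sup>*\<^sup>* (x # xs) (x # reduce xs)"
    using Cons.IH by blast
  show ?case
  proof (cases "reduce xs")
    case Nil
    with * show ?thesis by simp
  next
    case (Cons y ys)
    have "delete_pair (x # y # ys) ys" if "snd x = Plus" "snd y = Minus"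
      using that delete_pair.intros[of "[]" "fst x" "fst y" ys] by (cases x; cases y) simp
    with * Cons show ?thesis
      by (auto intro: rtranclp.rtrancl_into_rtrancl)
  qed
qed

lemma reduce_normal: "\<exists>r s. map snd (reduce xs) = replicate r Minus @ replicate s Plus"
proof (induction xs)
  case Nil
  show ?case by simp
next
  case (Cons x xs)
  then obtain r s where rs: "map snd (reduce xs) = replicate r Minus @ replicate s Plus"
    by blast
  show ?case
  proof (cases "snd x")
    case Minus
    then have "map snd (reduce (x # xs)) = replicate (Suc r) Minus @ replicate s Plus"
      using rs by (auto split: list.splits)
    then show ?thesis by blast
  next
    case Plus
    show ?thesis
    proof (cases r)
      case 0
      then have "map snd (reduce (x # xs)) = replicate 0 Minus @ replicate (Suc s) Plus"
        using rs Plus by (cases s) (auto split: list.splits)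
      then show ?thesis by blast
    next
      case (Suc r')
      then have "map snd (reduce (x # xs)) = replicate r' Minus @ replicate s Plus"
        using rs Plus by (auto split: list.splits)
      then show ?thesis by blast
    qed
  qed
qed

definition remaining :: "sign \<Rightarrow> nat \<Rightarrow> nat \<Rightarrow> letter list \<Rightarrow> nat list" where
  "remaining \<sigma> n i w = map fst (filter (\<lambda>x. snd x = \<sigma>) (reduce (signature n i w)))"

definition raise_letter :: "nat \<Rightarrow> nat \<Rightarrow> letter \<Rightarrow> letter" where
  "raise_letter n i x =
     (if i = n then Unbarred n
      else if x = Unbarred (Suc i) then Unbarred i
      else Bar (Suc i))"

definition lower_letter :: "nat \<Rightarrow> nat \<Rightarrow> letter \<Rightarrow> letter" where
  "lower_letter n i x =
     (if i = n then Bar n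
      else if x = Unbarred i then Unbarred (Suc i)
      else Bar i)"

text \<open>The value \<open>None\<close> plays the role of the additional element 0.\<close>

definition crystal_e :: "nat \<Rightarrow> nat \<Rightarrow> letter list \<Rightarrow> letter list option" where
  "crystal_e n i w =
     (let ps = remaining Minus n i w in
      if ps = [] then None
      else Some (w[last ps := raise_letter n i (w ! last ps)]))"

definition crystal_f :: "nat \<Rightarrow> nat \<Rightarrow> letter list \<Rightarrow> letter list option" where
  "crystal_f n i w =
     (let ps = remaining Plus n i w in
      if ps = [] then None
      else Some (w[hd ps := lower_letter n i (w ! hd ps)]))"

definition crystal_arrow :: "nat \<Rightarrow> nat \<Rightarrow> letter list \<Rightarrow> letter list \<Rightarrow> bool" where
  "crystal_arrow n i a b \<longleftrightarrow>
     i \<in> {1..n} \<and> a \<in> lists (alphabet n) \<and> b \<in> lists (alphabet n) \<and> crystal_f n i a = Some b"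

definition component :: "nat \<Rightarrow> letter list \<Rightarrow> letter list set" where
  "component n w = {v. equivclp (\<lambda>a b. \<exists>i. crystal_arrow n i a b) w v}"

definition weight :: "nat \<Rightarrow> letter list \<Rightarrow> int list" where
  "weight n w =
     map (\<lambda>i. int (count_list w (Unbarred i)) - int (count_list w (Bar i))) [1..<Suc n]"

section \<open>The plactic monoid\<close>

definition component_iso ::
  "nat \<Rightarrow> (letter list \<Rightarrow> letter list) \<Rightarrow> letter list \<Rightarrow> letter list \<Rightarrow> bool" where
  "component_iso n \<phi> u v \<longleftrightarrow>
     bij_betw \<phi> (component n u) (component n v) \<and>
     (\<forall>a \<in> component n u. \<forall>b \<in> component n u. \<forall>i.
        crystal_arrow n i a b \<longleftrightarrow> crystal_arrow n i (\<phi> a) (\<phi> b)) \<and>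
     (\<forall>a \<in> component n u. weight n (\<phi> a) = weight n a)"

definition plactic_rel :: "nat \<Rightarrow> (letter list \<times> letter list) set" where
  "plactic_rel n =
     {(u, v). u \<in> lists (alphabet n) \<and> v \<in> lists (alphabet n) \<and>
        (\<exists>\<phi>. component_iso n \<phi> u v \<and> \<phi> u = v)}"

text \<open>
  The quotient of the free monoid on \<open>A\<close> by a congruence \<open>r\<close>: when \<open>r\<close> is a congruence,
  the union below is the class of \<open>u @ v\<close> for any representatives \<open>u\<close> and \<open>v\<close>.
\<close>

definition quotient_monoid :: "'a set \<Rightarrow> ('a list \<times> 'a list) set \<Rightarrow> 'a list set monoid" where
  "quotient_monoid A r =
     \<lparr>carrier = lists A // r,
      mult = (\<lambda>X Y. \<Union>u\<in>X. \<Union>v\<in>Y. r `` {u @ v}),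
      one = r `` {[]}\<rparr>"

definition plactic_monoid :: "nat \<Rightarrow> letter list set monoid" where
  "plactic_monoid n = quotient_monoid (alphabet n) (plactic_rel n)"

section \<open>Admissible columns and symplectic tableaux\<close>

text \<open>A column is identified with its reading, a strictly increasing word.\<close>

definition is_column :: "nat \<Rightarrow> letter list \<Rightarrow> bool" where
  "is_column n U \<longleftrightarrow> U \<in> lists (alphabet n) \<and> sorted_wrt (<) U"

definition admissible :: "nat \<Rightarrow> letter list \<Rightarrow> bool" where
  "admissible n U \<longleftrightarrow>
     is_column n U \<and>
     (\<forall>m \<in> {1..n}. length (filter (\<lambda>x. x \<le> Unbarred m \<or> Bar m \<le> x) U) \<le> m)"

text \<open>The set \<open>I\<close>, listed as \<open>x\<^sub>1 > \<dots> > x\<^sub>r\<close>.\<close>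

definition paired :: "letter list \<Rightarrow> nat list" where
  "paired U = rev (sorted_list_of_set {i. Unbarred i \<in> set U \<and> Bar i \<in> set U})"

text \<open>
  In \<open>partners U b xs\<close>, the number \<open>b\<close> is the previously chosen \<open>y\<close>. There is none for
  \<open>x\<^sub>1\<close>, and starting with \<open>b = x\<^sub>1\<close> imposes no additional bound. The set under \<open>Max\<close>
  is nonempty whenever \<open>U\<close> is admissible.
\<close>

fun partners :: "letter list \<Rightarrow> nat \<Rightarrow> nat list \<Rightarrow> nat list" where
  "partners U b [] = []"
| "partners U b (x # xs) =
     (let y = Max {y. 1 \<le> y \<and> y < min b x \<and> Unbarred y \<notin> set U \<and> Bar y \<notin> set U}
      in y # partners U y xs)"

definition replacement :: "letter list \<Rightarrow> nat \<Rightarrow> nat" where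
  "replacement U i =
     (case map_of (zip (paired U) (partners U (hd (paired U)) (paired U))) i of
        None \<Rightarrow> i
      | Some y \<Rightarrow> y)"

definition right_col :: "letter list \<Rightarrow> letter list" where
  "right_col U =
     sort (map (\<lambda>a. case a of Unbarred i \<Rightarrow> Unbarred i | Bar i \<Rightarrow> Bar (replacement U i)) U)"

definition left_col :: "letter list \<Rightarrow> letter list" where
  "left_col U =
     sort (map (\<lambda>a. case a of Unbarred i \<Rightarrow> Unbarred (replacement U i) | Bar i \<Rightarrow> Bar i) U)"

definition col_le :: "letter list \<Rightarrow> letter list \<Rightarrow> bool" where
  "col_le U V \<longleftrightarrow> length V \<le> length U \<and> (\<forall>k < length V. U ! k \<le> V ! k)"

definition col_prec :: "letter list \<Rightarrow> letter list \<Rightarrow> bool" where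
  "col_prec U V \<longleftrightarrow> col_le (right_col U) (left_col V)"

definition admissible_columns :: "nat \<Rightarrow> letter list set" where
  "admissible_columns n = {U. admissible n U \<and> U \<noteq> []}"

text \<open>
  A tableau is the list of its columns from left to right. Its columns are nonempty;
  otherwise empty columns could be appended without changing the reading.
\<close>

definition symplectic_tableau :: "nat \<Rightarrow> letter list list \<Rightarrow> bool" where
  "symplectic_tableau n T \<longleftrightarrow>
     T \<in> lists (admissible_columns n) \<and>
     (\<forall>k. Suc k < length T \<longrightarrow> col_prec (T ! k) (T ! Suc k))"

definition tableau_reading :: "letter list list \<Rightarrow> letter list" where
  "tableau_reading T = concat (rev T)"

definition P_tableau :: "nat \<Rightarrow> letter list \<Rightarrow> letter list list" where
  "P_tableau n w = (THE T. symplectic_tableau n T \<and> (w, tableau_reading T) \<in> plactic_rel n)"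

section \<open>Rewriting systems on free monoids\<close>

text \<open>A rewriting system on the free monoid \<open>lists A\<close> is a set of pairs (source, target).\<close>

inductive rewrite_step :: "'a set \<Rightarrow> ('a list \<times> 'a list) set \<Rightarrow> 'a list \<Rightarrow> 'a list \<Rightarrow> bool"
  for A R where
  "(s, t) \<in> R \<Longrightarrow> p \<in> lists A \<Longrightarrow> q \<in> lists A \<Longrightarrow> rewrite_step A R (p @ s @ q) (p @ t @ q)"

definition terminating :: "('a \<Rightarrow> 'a \<Rightarrow> bool) \<Rightarrow> bool" where
  "terminating r \<longleftrightarrow> \<not> (\<exists>h :: nat \<Rightarrow> 'a. \<forall>k. r (h k) (h (Suc k)))"

definition convergent_system :: "'a set \<Rightarrow> ('a list \<times> 'a list) set \<Rightarrow> bool" where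
  "convergent_system A R \<longleftrightarrow> terminating (rewrite_step A R) \<and> confluentp (rewrite_step A R)"

inductive_set generated_congruence ::
  "'a set \<Rightarrow> ('a list \<times> 'a list) set \<Rightarrow> ('a list \<times> 'a list) set"
  for A R where
  base: "(s, t) \<in> R \<Longrightarrow> (s, t) \<in> generated_congruence A R"
| refl: "u \<in> lists A \<Longrightarrow> (u, u) \<in> generated_congruence A R"
| sym: "(u, v) \<in> generated_congruence A R \<Longrightarrow> (v, u) \<in> generated_congruence A R"
| trans: "(u, v) \<in> generated_congruence A R \<Longrightarrow> (v, w) \<in> generated_congruence A R \<Longrightarrow>
    (u, w) \<in> generated_congruence A R"
| mult: "(u, v) \<in> generated_congruence A R \<Longrightarrow> (u', v') \<in> generated_congruence A R \<Longrightarrow>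
    (u @ u', v @ v') \<in> generated_congruence A R"

definition presented_monoid :: "'a set \<Rightarrow> ('a list \<times> 'a list) set \<Rightarrow> 'a list set monoid" where
  "presented_monoid A R = quotient_monoid A (generated_congruence A R)"

section \<open>The column presentation\<close>

datatype generator = Gen "letter list"

definition col_generators :: "nat \<Rightarrow> generator set" where
  "col_generators n = Gen ` admissible_columns n"

text \<open>
  The premise \<open>\<not> col_prec v u\<close> is the negation of \<open>u \<succeq> v\<close>. Tableaux are listed from left to
  right, but read from right to left, which is why the two columns are swapped in the target.
\<close>

inductive_set col_rules :: "nat \<Rightarrow> (generator list \<times> generator list) set" for n where
  two: "u \<in> admissible_columns n \<Longrightarrow> v \<in> admissible_columns n \<Longrightarrow> \<not> col_prec v u \<Longrightarrow>
    P_tableau n (u @ v) = [w', w] \<Longrightarrow> ([Gen u, Gen v], [Gen w, Gen w']) \<in> col_rules n"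
| one: "u \<in> admissible_columns n \<Longrightarrow> v \<in> admissible_columns n \<Longrightarrow> \<not> col_prec v u \<Longrightarrow>
    P_tableau n (u @ v) = [w] \<Longrightarrow> ([Gen u, Gen v], [Gen w]) \<in> col_rules n"
| zero: "u \<in> admissible_columns n \<Longrightarrow> v \<in> admissible_columns n \<Longrightarrow> \<not> col_prec v u \<Longrightarrow>
    P_tableau n (u @ v) = [] \<Longrightarrow> ([Gen u, Gen v], []) \<in> col_rules n"

end

theory Submission
  imports Defs "HOL-Library.Multiset"
begin

text \<open>
  The readings of symplectic tableaux are normal forms for the plactic relation. Tableau readings are
  stable under the crystal operators, with the column heights preserved: an operator with index \<open>i\<close>
  changes \<open>lU\<close> and \<open>rU\<close> only at the indices \<open>i\<close> and \<open>i + 1\<close>, and \<open>U \<le> V\<close> is a comparison of counting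
  functions. The columns of a highest weight tableau are of the form \<open>1, \<dots>, k\<close>, so that it is
  determined by its weight; raising two equivalent tableau readings in parallel shows that they are equal.

  Conversely, every highest weight word is equivalent to such a tableau reading. Reading it letter by
  letter, a new letter \<open>j\<close> slides to the left through the columns containing \<open>j\<close> by Knuth relations, and
  a new letter \<open>Bar k\<close> is contracted with the preceding column. Both relations come from explicit
  maps that commute with the crystal operators. Lowering again yields a tableau for every word.

  The tableau of a product of two columns has at most two columns, and unless the product is already
  a tableau, it has fewer letters, or fewer columns, or a shorter first column. This gives
  termination, and confluence follows because every irreducible word is a tableau.
\<close>

section \<open>Recursive form of the crystal operators\<close>

text \<open>The facts usually quoted from the literature (existence and uniqueness of the tableau,
  at most two columns for a product of two) are proved here, starting from the definition of the
  relation by crystal isomorphisms. In place of an insertion algorithm there is one device: to prove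
  a relation, take a set of words stable under all operators whose highest weight words are told
  apart by their weights, and a map on it that commutes with every f_i. Nothing has to be known
  about the image. This is why contraction is proved backwards, from admissible columns to longer
  words, and why the Knuth relations start from tableau readings: these are the sets whose stability
  and highest weight words are known.

  The row by row order of columns refers to positions, on which a change at i and i + 1 acts
  awkwardly. Counts of letters up to a threshold behave better: moving a letter to its successor
  changes exactly one of them, by one.

  No critical pairs are inspected: rules preserve plactic classes, and each class contains a single
  irreducible word.\<close>

primrec eps :: "nat \<Rightarrow> nat \<Rightarrow> letter list \<Rightarrow> nat" where
  "eps n i [] = 0"
| "eps n i (x # w) =
     (case letter_sign n i x of
        None \<Rightarrow> eps n i w
      | Some s \<Rightarrow> (case s of Minus \<Rightarrow> Suc (eps n i w) | Plus \<Rightarrow> eps n i w - 1))"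

text \<open>The tail reduces to -^r +^s with r given by \<open>eps\<close>. A + put in front cancels
  the leftmost - of the tail, so it survives exactly when r = 0; the truncated subtraction in
  \<open>eps\<close> covers that case.\<close>

primrec phi :: "nat \<Rightarrow> nat \<Rightarrow> letter list \<Rightarrow> nat" where
  "phi n i [] = 0"
| "phi n i (x # w) =
     (if letter_sign n i x = Some Plus \<and> eps n i w = 0 then Suc (phi n i w) else phi n i w)"

primrec fop :: "nat \<Rightarrow> nat \<Rightarrow> letter list \<Rightarrow> letter list option" where
  "fop n i [] = None"
| "fop n i (x # w) =
     (if letter_sign n i x = Some Plus \<and> eps n i w = 0 then Some (lower_letter n i x # w)
      else map_option ((#) x) (fop n i w))"

text \<open>The letter to be changed is the rightmost surviving -, so a + in front matters only when
  it cancels the last - left in the tail, that is when \<open>eps n i w = 1\<close>.\<close>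

primrec eop :: "nat \<Rightarrow> nat \<Rightarrow> letter list \<Rightarrow> letter list option" where
  "eop n i [] = None"
| "eop n i (x # w) =
     (if letter_sign n i x = Some Minus \<and> eps n i w = 0 then Some (raise_letter n i x # w)
      else if letter_sign n i x = Some Plus \<and> eps n i w = 1 then None
      else map_option ((#) x) (eop n i w))"

text \<open>Reduced signatures are minuses followed by pluses, so the two lists of positions
  determine them. The recursion for \<open>remaining\<close> is then read off from these
  lists.\<close>

lemma reduce_split:
  "reduce xs = map (\<lambda>p. (p, Minus)) (map fst (filter (\<lambda>x. snd x = Minus) (reduce xs))) @
     map (\<lambda>p. (p, Plus)) (map fst (filter (\<lambda>x. snd x = Plus) (reduce xs)))"
proof -
  have *: "ys = map (\<lambda>p. (p, Minus)) (map fst (filter (\<lambda>x. snd x = Minus) ys)) @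
     map (\<lambda>p. (p, Plus)) (map fst (filter (\<lambda>x. snd x = Plus) ys))"
    if "map snd ys = replicate r Minus @ replicate s Plus" for ys :: "(nat \<times> sign) list" and r s
    using that
  proof (induction ys arbitrary: r)
    case (Cons y ys)
    show ?case
    proof (cases r)
      case 0
      with Cons.prems have "map snd (y # ys) = replicate s Plus"
        by simp
      then have "\<forall>x \<in> set (y # ys). snd x = Plus"
        by (metis in_set_replicate image_eqI list.set_map)
      moreover from this have "map ((\<lambda>p. (p, Plus)) \<circ> fst) (y # ys) = y # ys"
        by (intro map_idI) (auto intro: prod_eqI)
      ultimately have "filter (\<lambda>x. snd x = Minus) (y # ys) = []"
        and "filter (\<lambda>x. snd x = Plus) (y # ys) = y # ys"
        and "map (\<lambda>p. (p, Plus)) (map fst (y # ys)) = y # ys"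
        by (auto simp: filter_empty_conv)
      then show ?thesis by simp
    next
      case (Suc r')
      with Cons.prems have "snd y = Minus" "map snd ys = replicate r' Minus @ replicate s Plus"
        by auto
      with Cons.IH[of r'] show ?thesis
        by (cases y) simp
    qed
  qed simp
  from reduce_normal[of xs] show ?thesis
    using * by blast
qed

lemma reduce_map_Suc:
  "reduce (map (map_prod Suc id) xs) = map (map_prod Suc id) (reduce xs)"
  by (induction xs) (auto split: list.splits)

lemma signature_Cons:
  "signature n i (x # w) =
     (case letter_sign n i x of None \<Rightarrow> [] | Some s \<Rightarrow> [(0, s)]) @
     map (map_prod Suc id) (signature n i w)"
proof -
  have "[0..<length (x # w)] = 0 # map Suc [0..<length w]"
    by (simp add: upt_conv_Cons map_Suc_upt del: upt_Suc)
  then show ?thesis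
    unfolding signature_def by (auto simp: filter_map o_def)
qed

lemma remaining_Minus_Cons:
  "remaining Minus n i (x # w) =
     (case letter_sign n i x of
        None \<Rightarrow> map Suc (remaining Minus n i w)
      | Some s \<Rightarrow> (case s of
          Minus \<Rightarrow> 0 # map Suc (remaining Minus n i w)
        | Plus \<Rightarrow> map Suc (tl (remaining Minus n i w))))"
  and remaining_Plus_Cons:
  "remaining Plus n i (x # w) =
     (if letter_sign n i x = Some Plus \<and> remaining Minus n i w = []
      then 0 # map Suc (remaining Plus n i w) else map Suc (remaining Plus n i w))"
proof -
  let ?r = "reduce (signature n i w)"
  let ?S = "map (map_prod Suc id)"
  define ms ps where "ms = remaining Minus n i w" and "ps = remaining Plus n i w"
  have r: "?r = map (\<lambda>p. (p, Minus)) ms @ map (\<lambda>p. (p, Plus)) ps"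
    unfolding ms_def ps_def remaining_def by (rule reduce_split)
  have f: "filter (\<lambda>x. snd x = Minus) (map (\<lambda>p. (g p, Plus)) xs) = []"
    "filter (\<lambda>x. snd x = Plus) (map (\<lambda>p. (g p, Minus)) xs) = []"
    "filter (\<lambda>x. snd x = Plus) (map (\<lambda>p. (g p, Plus)) xs) = map (\<lambda>p. (g p, Plus)) xs"
    "filter (\<lambda>x. snd x = Minus) (map (\<lambda>p. (g p, Minus)) xs) = map (\<lambda>p. (g p, Minus)) xs"
    for xs :: "nat list" and g :: "nat \<Rightarrow> nat"
    by (auto simp: filter_map o_def)
  have S: "?S ?r = map (\<lambda>p. (Suc p, Minus)) ms @ map (\<lambda>p. (Suc p, Plus)) ps"
    by (simp add: r)
  have "remaining Minus n i (x # w) =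
     (case letter_sign n i x of
        None \<Rightarrow> map Suc ms
      | Some s \<Rightarrow> (case s of Minus \<Rightarrow> 0 # map Suc ms | Plus \<Rightarrow> map Suc (tl ms)))
     \<and> remaining Plus n i (x # w) =
     (if letter_sign n i x = Some Plus \<and> ms = [] then 0 # map Suc ps else map Suc ps)"
  proof (cases "letter_sign n i x")
    case None
    then show ?thesis
      by (simp add: remaining_def signature_Cons reduce_map_Suc S f o_def)
  next
    case (Some s)
    then show ?thesis
      by (cases s; cases ms; cases ps)
        (simp_all add: remaining_def signature_Cons reduce_map_Suc S f o_def)
  qed
  then show "remaining Minus n i (x # w) =
     (case letter_sign n i x of
        None \<Rightarrow> map Suc (remaining Minus n i w)
      | Some s \<Rightarrow> (case s of
          Minus \<Rightarrow> 0 # map Suc (remaining Minus n i w)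
        | Plus \<Rightarrow> map Suc (tl (remaining Minus n i w))))"
    and "remaining Plus n i (x # w) =
     (if letter_sign n i x = Some Plus \<and> remaining Minus n i w = []
      then 0 # map Suc (remaining Plus n i w) else map Suc (remaining Plus n i w))"
    by (simp_all only: ms_def ps_def)
qed

lemma remaining_Nil: "remaining \<sigma> n i [] = []"
  by (simp add: remaining_def signature_def)

lemma length_remaining_Minus: "length (remaining Minus n i w) = eps n i w"
  by (induction w) (auto simp: remaining_Nil remaining_Minus_Cons split: option.split sign.split)

text \<open>Arrows are defined through \<open>crystal_f\<close>, so this carries components and the
  plactic relation over to the recursion. Raising enters through \<open>eop\<close>, the partial
  inverse of \<open>fop\<close>.\<close>

lemma crystal_f_eq: "crystal_f n i w = fop n i w"
proof (induction w)
  case Nil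
  then show ?case by (simp add: crystal_f_def remaining_Nil)
next
  case (Cons x w)
  have *: "remaining Minus n i w = [] \<longleftrightarrow> eps n i w = 0"
    by (metis length_0_conv length_remaining_Minus)
  show ?case
    by (auto simp: Cons[symmetric] crystal_f_def remaining_Plus_Cons * Let_def hd_map)
qed

section \<open>Concatenation and weights\<close>

text \<open>Tensor product rule. Reducing both factors separately leaves a middle block +^p -^q with
  \<open>p = phi n i u\<close> and \<open>q = eps n i v\<close>; the larger of the two decides which
  marks survive and, below, on which factor an operator acts.\<close>

lemma eps_append: "eps n i (u @ v) = eps n i u + (eps n i v - phi n i u)"
  by (induction u) (auto split: option.split sign.split)

lemma phi_append: "phi n i (u @ v) = phi n i v + (phi n i u - eps n i v)"
  by (induction u) (auto simp: eps_append)

lemma fop_None_iff: "fop n i w = None \<longleftrightarrow> phi n i w = 0"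
  by (induction w) auto

lemma eop_None_iff: "eop n i w = None \<longleftrightarrow> eps n i w = 0"
  by (induction w) (auto split: option.split sign.split elim: sign.exhaust)

lemma fop_append:
  "fop n i (u @ v) =
     (if phi n i u > eps n i v then map_option (\<lambda>x. x @ v) (fop n i u)
      else map_option ((@) u) (fop n i v))"
proof (induction u)
  case Nil
  then show ?case by (cases "fop n i v") auto
next
  case (Cons x u)
  then show ?case
    by (auto simp: eps_append option.map_comp o_def fop_None_iff)
qed

lemma eop_append:
  "eop n i (u @ v) =
     (if eps n i v > phi n i u then map_option ((@) u) (eop n i v)
      else map_option (\<lambda>x. x @ v) (eop n i u))"
proof (induction u)
  case Nil
  then show ?case by (auto simp: eop_None_iff option.map_id[unfolded id_def])
next
  case (Cons x u)
  then show ?case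
    by (cases "letter_sign n i x")
     (auto simp: eps_append option.map_comp o_def eop_None_iff split: sign.split)
qed

section \<open>Lowering and raising as mutually inverse partial maps\<close>

lemma sign_lower:
  assumes "letter_sign n i x = Some Plus" "i \<le> n"
  shows "letter_sign n i (lower_letter n i x) = Some Minus" "raise_letter n i (lower_letter n i x) = x"
  using assms by (auto simp: letter_sign_def lower_letter_def raise_letter_def split: if_splits)

lemma sign_raise:
  assumes "letter_sign n i x = Some Minus" "i \<le> n"
  shows "letter_sign n i (raise_letter n i x) = Some Plus" "lower_letter n i (raise_letter n i x) = x"
  using assms by (auto simp: letter_sign_def lower_letter_def raise_letter_def split: if_splits)

lemma fop_Some:
  assumes "fop n i w = Some w'" "i \<le> n"
  shows "eop n i w' = Some w" "eps n i w' = Suc (eps n i w)" "phi n i w = Suc (phi n i w')"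
proof -
  have "eop n i w' = Some w \<and> eps n i w' = Suc (eps n i w) \<and> phi n i w = Suc (phi n i w')"
    using assms(1)
  proof (induction w arbitrary: w')
    case (Cons x w)
    show ?case
    proof (cases "letter_sign n i x = Some Plus \<and> eps n i w = 0")
      case True
      with Cons.prems show ?thesis
        using sign_lower[OF _ assms(2), of x] by auto
    next
      case False
      with Cons.prems obtain y where "fop n i w = Some y" "w' = x # y"
        by auto
      with Cons.IH[of y] False show ?thesis
        by (auto split: option.splits sign.splits)
    qed
  qed simp
  then show "eop n i w' = Some w" "eps n i w' = Suc (eps n i w)" "phi n i w = Suc (phi n i w')"
    by auto
qed

lemma eop_Some:
  assumes "eop n i w = Some w'" "i \<le> n"
  shows "fop n i w' = Some w"
  using assms(1)
proof (induction w arbitrary: w')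
  case (Cons x w)
  show ?case
  proof (cases "letter_sign n i x = Some Minus \<and> eps n i w = 0")
    case True
    with Cons.prems show ?thesis
      using sign_raise[OF _ assms(2), of x] by auto
  next
    case False
    with Cons.prems obtain y where y: "eop n i w = Some y" "w' = x # y"
      and 1: "\<not> (letter_sign n i x = Some Plus \<and> eps n i w = 1)"
      by (auto split: if_splits)
    with Cons.IH[of y] fop_Some[of n i y w] assms(2) have "eps n i w = Suc (eps n i y)" "fop n i y = Some w"
      by auto
    with y 1 show ?thesis
      by auto
  qed
qed simp

lemma fop_length: "fop n i w = Some w' \<Longrightarrow> length w' = length w"
  by (induction w arbitrary: w') (auto split: if_splits)

section \<open>Closure under the operators, grading by rank, and weights\<close>

lemma lower_alphabet:
  "letter_sign n i x = Some Plus \<Longrightarrow> i \<in> {1..n} \<Longrightarrow> lower_letter n i x \<in> alphabet n"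
  by (auto simp: letter_sign_def lower_letter_def alphabet_def split: if_splits)

lemma raise_alphabet:
  "letter_sign n i x = Some Minus \<Longrightarrow> i \<in> {1..n} \<Longrightarrow> raise_letter n i x \<in> alphabet n"
  by (auto simp: letter_sign_def raise_letter_def alphabet_def split: if_splits)

lemma fop_alphabet:
  "fop n i w = Some w' \<Longrightarrow> i \<in> {1..n} \<Longrightarrow> w \<in> lists (alphabet n) \<Longrightarrow> w' \<in> lists (alphabet n)"
  by (induction w arbitrary: w') (auto simp: lower_alphabet split: if_splits)

lemma eop_alphabet:
  "eop n i w = Some w' \<Longrightarrow> i \<in> {1..n} \<Longrightarrow> w \<in> lists (alphabet n) \<Longrightarrow> w' \<in> lists (alphabet n)"
  by (induction w arbitrary: w') (auto simp: raise_alphabet split: if_splits)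

text \<open>The position of a letter in the ordered alphabet. Lowering moves one letter to its
  immediate successor, so the total rank grades every component; the inductions that raise a word to
  highest weight run on it.\<close>

fun letter_rank :: "nat \<Rightarrow> letter \<Rightarrow> nat" where
  "letter_rank n (Unbarred j) = j"
| "letter_rank n (Bar j) = 2 * n + 1 - j"

definition level :: "nat \<Rightarrow> letter list \<Rightarrow> nat" where
  "level n w = sum_list (map (letter_rank n) w)"

lemma level_fop:
  assumes "fop n i w = Some w'" "i \<in> {1..n}"
  shows "level n w' = Suc (level n w)"
  using assms
  by (induction w arbitrary: w')
    (auto simp: level_def letter_sign_def lower_letter_def split: if_splits)

definition wt :: "nat \<Rightarrow> letter list \<Rightarrow> int" where
  "wt j w = int (count_list w (Unbarred j)) - int (count_list w (Bar j))"

lemma wt_Nil [simp]: "wt j [] = 0"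
  by (simp add: wt_def)

lemma wt_append [simp]: "wt j (u @ v) = wt j u + wt j v"
  by (simp add: wt_def)

lemma wt_Cons: "wt j (x # w) = wt j [x] + wt j w"
  by (simp add: wt_def)

lemma wt_singleton: "wt j [x] = (if x = Unbarred j then 1 else if x = Bar j then -1 else 0)"
  by (simp add: wt_def)

lemma weight_eq_iff: "weight n u = weight n v \<longleftrightarrow> (\<forall>j \<in> {1..n}. wt j u = wt j v)"
  by (auto simp: weight_def wt_def)

text \<open>Deleting a pair +- does not change the number of pluses minus the number of minuses,
  which is the pairing of the weight with the i-th coroot. Once the weight is known, either string
  length determines the other.\<close>

lemma phi_minus_eps:
  assumes "i \<in> {1..n}"
  shows "int (phi n i w) - int (eps n i w) = wt i w - (if i < n then wt (Suc i) w else 0)"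
proof (induction w)
  case (Cons x w)
  have "int (phi n i (x # w)) - int (eps n i (x # w)) =
    (case letter_sign n i x of None \<Rightarrow> 0 | Some s \<Rightarrow> (case s of Plus \<Rightarrow> 1 | Minus \<Rightarrow> -1))
    + (int (phi n i w) - int (eps n i w))"
    by (cases "letter_sign n i x") (auto split: sign.split)
  also have "(case letter_sign n i x of None \<Rightarrow> 0 | Some s \<Rightarrow> (case s of Plus \<Rightarrow> 1 | Minus \<Rightarrow> -1)) =
    wt i [x] - (if i < n then wt (Suc i) [x] else 0)"
    using assms by (auto simp: letter_sign_def wt_singleton)
  finally show ?case
    using Cons by (subst (1 2) wt_Cons) simp
qed simp

section \<open>The plactic relation\<close>

lemma arrow_iff:
  "crystal_arrow n i a b \<longleftrightarrow> i \<in> {1..n} \<and> a \<in> lists (alphabet n) \<and> fop n i a = Some b"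
  unfolding crystal_arrow_def crystal_f_eq using fop_alphabet by blast

lemma component_self: "w \<in> component n w"
  by (simp add: component_def)

lemma component_fop:
  assumes "a \<in> component n w" "a \<in> lists (alphabet n)" "i \<in> {1..n}" "fop n i a = Some b"
  shows "b \<in> component n w"
  using assms unfolding component_def
  by (auto intro!: equivclp_into_equivclp[of _ w a b] exI[of _ i] simp: arrow_iff)

lemma component_eop:
  assumes "a \<in> component n w" "a \<in> lists (alphabet n)" "i \<in> {1..n}" "eop n i a = Some b"
  shows "b \<in> component n w"
proof -
  from assms have "fop n i b = Some a" "b \<in> lists (alphabet n)"
    using eop_Some eop_alphabet by auto
  with assms show ?thesis
    unfolding component_def
    by (auto intro!: equivclp_into_equivclp[of _ w a b] exI[of _ i] simp: arrow_iff)
qed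

text \<open>An undirected path in the crystal graph is a sequence of lowerings and raisings, an
  arrow traversed backwards being a raising.\<close>

lemma component_induct [consumes 2, case_names self fop eop]:
  assumes "a \<in> component n w" "w \<in> lists (alphabet n)"
    and self: "P w"
    and fop: "\<And>a i b. a \<in> component n w \<Longrightarrow> a \<in> lists (alphabet n) \<Longrightarrow> P a \<Longrightarrow>
      i \<in> {1..n} \<Longrightarrow> fop n i a = Some b \<Longrightarrow> P b"
    and eop: "\<And>a i b. a \<in> component n w \<Longrightarrow> a \<in> lists (alphabet n) \<Longrightarrow> P a \<Longrightarrow>
      i \<in> {1..n} \<Longrightarrow> eop n i a = Some b \<Longrightarrow> P b"
  shows "P a"
proof -
  have "equivclp (\<lambda>a b. \<exists>i. crystal_arrow n i a b) w a"
    using assms(1) by (simp add: component_def)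
  then have "P a \<and> a \<in> lists (alphabet n)"
  proof (induction rule: equivclp_induct)
    case base
    then show ?case using self assms(2) by simp
  next
    case (step y z)
    then have y: "y \<in> component n w" "P y" "y \<in> lists (alphabet n)"
      by (simp_all add: component_def)
    from step.hyps(2) obtain i where "crystal_arrow n i y z \<or> crystal_arrow n i z y"
      by blast
    then show ?case
    proof
      assume "crystal_arrow n i y z"
      with y fop[of y i z] show ?thesis
        by (auto simp: arrow_iff dest: fop_alphabet)
    next
      assume "crystal_arrow n i z y"
      with y eop[of y i z] fop_Some(1)[of n i z y] show ?thesis
        by (auto simp: arrow_iff)
    qed
  qed
  then show ?thesis by simp
qed

lemma component_alphabet:
  assumes "a \<in> component n w" "w \<in> lists (alphabet n)"
  shows "a \<in> lists (alphabet n)"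
  using assms
proof (induction rule: component_induct)
  case self
  show ?case by (rule assms(2))
next
  case (fop a i b)
  then show ?case using fop_alphabet by metis
next
  case (eop a i b)
  then show ?case using eop_alphabet by metis
qed

lemma component_length:
  assumes "a \<in> component n w" "w \<in> lists (alphabet n)"
  shows "length a = length w"
  using assms
proof (induction rule: component_induct)
  case (eop a i b)
  then have "fop n i b = Some a"
    using eop_Some by auto
  with eop show ?case
    using fop_length by metis
qed (auto dest: fop_length)

lemma plactic_alphabet:
  assumes "(u, v) \<in> plactic_rel n"
  shows "u \<in> lists (alphabet n)" "v \<in> lists (alphabet n)"
  using assms by (auto simp: plactic_rel_def)

text \<open>The component itself never has to be described: stability makes \<open>S\<close> contain
  it. Surjectivity is obtained by lifting a path in the target step by step, since an operator is
  defined at \<open>h a\<close> only if it is defined at \<open>a\<close>.\<close>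

lemma placticI:
  assumes S: "S \<subseteq> lists (alphabet n)" and u: "u \<in> S"
    and cf: "\<And>a i b. a \<in> S \<Longrightarrow> i \<in> {1..n} \<Longrightarrow> fop n i a = Some b \<Longrightarrow> b \<in> S"
    and ce: "\<And>a i b. a \<in> S \<Longrightarrow> i \<in> {1..n} \<Longrightarrow> eop n i a = Some b \<Longrightarrow> b \<in> S"
    and f: "\<And>a i. a \<in> S \<Longrightarrow> i \<in> {1..n} \<Longrightarrow> fop n i (h a) = map_option h (fop n i a)"
    and e: "\<And>a i. a \<in> S \<Longrightarrow> i \<in> {1..n} \<Longrightarrow> eop n i (h a) = map_option h (eop n i a)"
    and weight: "\<And>a. a \<in> S \<Longrightarrow> weight n (h a) = weight n a"
    and inj: "inj_on h S"
    and hS: "\<And>a. a \<in> S \<Longrightarrow> h a \<in> lists (alphabet n)"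
  shows "(u, h u) \<in> plactic_rel n"
proof -
  have us: "u \<in> lists (alphabet n)" "h u \<in> lists (alphabet n)"
    using u S hS by auto
  have sub: "a \<in> S" if "a \<in> component n u" for a
    using that us(1) by (induction rule: component_induct) (auto simp: u intro: cf ce)
  have to: "h a \<in> component n (h u)" if "a \<in> component n u" for a
    using that us(1)
  proof (induction rule: component_induct)
    case self
    then show ?case by (rule component_self)
  next
    case (fop a i b)
    then have "fop n i (h a) = Some (h b)"
      using f[of a i] sub by simp
    with fop show ?case
      using component_fop[of "h a" n "h u" i "h b"] hS[of a] sub by blast
  next
    case (eop a i b)
    then have "eop n i (h a) = Some (h b)"
      using e[of a i] sub by simp
    with eop show ?case
      using component_eop[of "h a" n "h u" i "h b"] hS[of a] sub by blast
  qed
  have onto: "b \<in> h ` component n u" if "b \<in> component n (h u)" for b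
    using that us(2)
  proof (induction rule: component_induct)
    case self
    then show ?case using component_self by blast
  next
    case (fop b i c)
    then obtain a where a: "a \<in> component n u" "b = h a"
      by blast
    with fop f[of a i] sub obtain a' where "fop n i a = Some a'" "c = h a'"
      by auto
    with a fop show ?case
      using component_fop[of a n u i a'] component_alphabet us(1) by blast
  next
    case (eop b i c)
    then obtain a where a: "a \<in> component n u" "b = h a"
      by blast
    with eop e[of a i] sub obtain a' where "eop n i a = Some a'" "c = h a'"
      by auto
    with a eop show ?case
      using component_eop[of a n u i a'] component_alphabet us(1) by blast
  qed
  have "bij_betw h (component n u) (component n (h u))"
    unfolding bij_betw_def using inj sub to onto by (auto intro: inj_on_subset)
  moreover have "crystal_arrow n i a b \<longleftrightarrow> crystal_arrow n i (h a) (h b)"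
    if "a \<in> component n u" "b \<in> component n u" for a b i
  proof -
    have "a \<in> S" "b \<in> S"
      using that sub by auto
    moreover have "c = b" if "fop n i a = Some c" "h c = h b" "i \<in> {1..n}" for c
      using that cf[of a i c] inj \<open>a \<in> S\<close> \<open>b \<in> S\<close> by (meson inj_onD)
    ultimately show ?thesis
      using f[of a i] S hS[of a] unfolding arrow_iff by (cases "fop n i a") auto
  qed
  ultimately have "component_iso n h u (h u)"
    unfolding component_iso_def using weight sub by blast
  then show ?thesis
    using us by (auto simp: plactic_rel_def)
qed

text \<open>Preserved arrows alone do not show that an operator undefined at \<open>a\<close> is
  undefined at \<open>h a\<close>. For that, the end of the hypothetical arrow is pulled back by
  surjectivity; for raising, injectivity then identifies the lowered preimage with
  \<open>a\<close>.\<close>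

lemma placticE:
  assumes "(u, v) \<in> plactic_rel n"
  obtains h where "h u = v" "bij_betw h (component n u) (component n v)"
    "\<And>a. a \<in> component n u \<Longrightarrow> weight n (h a) = weight n a"
    "\<And>a i. a \<in> component n u \<Longrightarrow> i \<in> {1..n} \<Longrightarrow> fop n i (h a) = map_option h (fop n i a)"
    "\<And>a i. a \<in> component n u \<Longrightarrow> i \<in> {1..n} \<Longrightarrow> eop n i (h a) = map_option h (eop n i a)"
proof -
  from assms obtain h where u: "u \<in> lists (alphabet n)" and v: "v \<in> lists (alphabet n)"
    and iso: "component_iso n h u v" and hu: "h u = v"
    by (auto simp: plactic_rel_def)
  have bij: "bij_betw h (component n u) (component n v)"
    and ar: "\<And>a b i. a \<in> component n u \<Longrightarrow> b \<in> component n u \<Longrightarrow>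
      crystal_arrow n i a b \<longleftrightarrow> crystal_arrow n i (h a) (h b)"
    and w: "\<And>a. a \<in> component n u \<Longrightarrow> weight n (h a) = weight n a"
    using iso by (auto simp: component_iso_def)
  have f: "fop n i (h a) = map_option h (fop n i a)" if a: "a \<in> component n u" and i: "i \<in> {1..n}" for a i
  proof -
    have ha: "h a \<in> component n v"
      using a bij by (auto simp: bij_betw_def)
    have al: "a \<in> lists (alphabet n)" "h a \<in> lists (alphabet n)"
      using component_alphabet a ha u v by auto
    show ?thesis
    proof (cases "fop n i a")
      case (Some b)
      then have "crystal_arrow n i a b" "b \<in> component n u"
        using a i al component_fop by (auto simp: arrow_iff)
      then show ?thesis
        using ar[of a b i] a Some by (auto simp: arrow_iff)
    next
      case None
      have False if "fop n i (h a) = Some c" for c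
      proof -
        have "c \<in> component n v"
          using component_fop[OF ha al(2) i that] .
        then obtain b where "b \<in> component n u" "c = h b"
          using bij by (auto simp: bij_betw_def)
        with ar[of a b i] a None that al i show False
          by (auto simp: arrow_iff)
      qed
      with None show ?thesis
        by (cases "fop n i (h a)") auto
    qed
  qed
  have e: "eop n i (h a) = map_option h (eop n i a)" if a: "a \<in> component n u" and i: "i \<in> {1..n}" for a i
  proof -
    have ha: "h a \<in> component n v"
      using a bij by (auto simp: bij_betw_def)
    have al: "a \<in> lists (alphabet n)" "h a \<in> lists (alphabet n)"
      using component_alphabet a ha u v by auto
    have i': "i \<le> n" using i by simp
    show ?thesis
    proof (cases "eop n i a")
      case (Some b)
      then have "b \<in> component n u" "fop n i b = Some a"
        using a i al component_eop eop_Some by auto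
      then have "fop n i (h b) = Some (h a)"
        using f[of b i] i by simp
      then show ?thesis
        using Some fop_Some(1) i' by auto
    next
      case None
      have False if "eop n i (h a) = Some c" for c
      proof -
        have c: "c \<in> component n v"
          using component_eop[OF ha al(2) i that] .
        then obtain b where b: "b \<in> component n u" "c = h b"
          using bij by (auto simp: bij_betw_def)
        have "fop n i (h b) = Some (h a)"
          using that b eop_Some i' by auto
      then have "map_option h (fop n i b) = Some (h a)"
        using f[OF b(1) i] by simp
      then obtain a' where a': "fop n i b = Some a'" "h a' = h a"
        by (auto simp: map_option_eq_Some)
        have "a' \<in> component n u"
          using component_fop[OF b(1) _ i a'(1)] component_alphabet[OF b(1) u] by simp
        with a' a bij have "a' = a"
          by (auto simp: bij_betw_def inj_on_def)
        with a' None show False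
          using fop_Some(1)[OF a'(1) i'] by simp
      qed
      with None show ?thesis
        by (cases "eop n i (h a)") auto
    qed
  qed
  show thesis
    using that[OF hu bij w f e] by blast
qed

text \<open>\<open>eps\<close> counts how often e_i can be applied, which \<open>h\<close> respects;
  \<open>phi\<close> follows from \<open>eps\<close> and the weight.\<close>

lemma eps_phi_commute:
  assumes i: "i \<in> {1..n}"
    and ce: "\<And>a b. a \<in> S \<Longrightarrow> eop n i a = Some b \<Longrightarrow> b \<in> S"
    and e: "\<And>a. a \<in> S \<Longrightarrow> eop n i (h a) = map_option h (eop n i a)"
    and weight: "\<And>a. a \<in> S \<Longrightarrow> weight n (h a) = weight n a"
    and a: "a \<in> S"
  shows "eps n i (h a) = eps n i a" "phi n i (h a) = phi n i a"
proof -
  have i': "i \<le> n" using i by simp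
  show *: "eps n i (h a) = eps n i a"
    using a
  proof (induction "eps n i a" arbitrary: a)
    case 0
    then show ?case
      using e[of a] by (metis eop_None_iff option.map_disc_iff)
  next
    case (Suc k)
    then obtain b where b: "eop n i a = Some b"
      using eop_None_iff[of n i a] by fastforce
    with Suc e[of a] have hb: "eop n i (h a) = Some (h b)"
      by simp
    from b hb i' have "eps n i a = Suc (eps n i b)" "eps n i (h a) = Suc (eps n i (h b))"
      using eop_Some fop_Some(2) by auto
    with Suc.hyps Suc.prems ce[OF _ b] show ?case by auto
  qed
  have "wt j (h a) = wt j a" if "j \<in> {1..n}" for j
    using weight[OF a] that by (simp add: weight_eq_iff)
  then show "phi n i (h a) = phi n i a"
    using phi_minus_eps[OF i, of a] phi_minus_eps[OF i, of "h a"] * i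
    by (auto split: if_splits)
qed

section \<open>The plactic relation is a congruence\<close>

lemma plactic_refl:
  assumes "u \<in> lists (alphabet n)"
  shows "(u, u) \<in> plactic_rel n"
proof (rule placticI[where S = "lists (alphabet n)" and h = "\<lambda>x. x", OF subset_refl assms])
  show "b \<in> lists (alphabet n)" if "a \<in> lists (alphabet n)" "i \<in> {1..n}" "fop n i a = Some b" for a i b
    using that fop_alphabet by blast
  show "b \<in> lists (alphabet n)" if "a \<in> lists (alphabet n)" "i \<in> {1..n}" "eop n i a = Some b" for a i b
    using that eop_alphabet by blast
qed (simp_all add: option.map_ident)

lemma plactic_sym:
  assumes "(u, v) \<in> plactic_rel n"
  shows "(v, u) \<in> plactic_rel n"
proof -
  have al: "u \<in> lists (alphabet n)" "v \<in> lists (alphabet n)"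
    using plactic_alphabet assms by auto
  obtain h where h: "h u = v" "bij_betw h (component n u) (component n v)"
    "\<And>a. a \<in> component n u \<Longrightarrow> weight n (h a) = weight n a"
    "\<And>a i. a \<in> component n u \<Longrightarrow> i \<in> {1..n} \<Longrightarrow> fop n i (h a) = map_option h (fop n i a)"
    "\<And>a i. a \<in> component n u \<Longrightarrow> i \<in> {1..n} \<Longrightarrow> eop n i (h a) = map_option h (eop n i a)"
    using placticE[OF assms] by metis
  define g where "g = inv_into (component n u) h"
  have gh: "g (h a) = a" if "a \<in> component n u" for a
    using that h(2) by (simp add: g_def bij_betw_def)
  have vE: "\<exists>a \<in> component n u. b = h a" if "b \<in> component n v" for b
    using that h(2) by (auto simp: bij_betw_def)
  have "(v, g v) \<in> plactic_rel n"
  proof (rule placticI[where S = "component n v"])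
    show "component n v \<subseteq> lists (alphabet n)"
      using component_alphabet al by blast
    show "inj_on g (component n v)"
      by (metis gh vE inj_onI)
    fix b assume b: "b \<in> component n v"
    then obtain a where a: "a \<in> component n u" "b = h a"
      using vE by blast
    show "weight n (g b) = weight n b"
      using a gh h(3) by simp
    show "g b \<in> lists (alphabet n)"
      using a gh component_alphabet[OF _ al(1)] by simp
    fix i assume i: "i \<in> {1..n}"
    have a': "a \<in> lists (alphabet n)"
      using a component_alphabet al by blast
    show "fop n i (g b) = map_option g (fop n i b)"
      using h(4)[OF a(1) i] a gh component_fop[OF a(1) a' i]
      by (cases "fop n i a") auto
    show "eop n i (g b) = map_option g (eop n i b)"
      using h(5)[OF a(1) i] a gh component_eop[OF a(1) a' i]
      by (cases "eop n i a") auto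
    show "c \<in> component n v" if "fop n i b = Some c" for c
      using component_fop[OF b _ i that] component_alphabet[OF b al(2)] by simp
    show "c \<in> component n v" if "eop n i b = Some c" for c
      using component_eop[OF b _ i that] component_alphabet[OF b al(2)] by simp
  qed (rule component_self)
  then show ?thesis
    using gh[of u] component_self h(1) by metis
qed

lemma plactic_trans:
  assumes "(u, v) \<in> plactic_rel n" "(v, w) \<in> plactic_rel n"
  shows "(u, w) \<in> plactic_rel n"
proof -
  from assms obtain h g where "component_iso n h u v" "h u = v" "component_iso n g v w" "g v = w"
    by (auto simp: plactic_rel_def)
  moreover from this have "component_iso n (g \<circ> h) u w"
    unfolding component_iso_def by (auto simp: bij_betw_trans bij_betw_apply)
  ultimately show ?thesis
    using assms by (auto simp: plactic_rel_def intro!: exI[of _ "g \<circ> h"])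
qed

text \<open>The factor on which an operator acts depends only on string lengths, and isomorphisms
  keep these. Hence two isomorphisms can be applied factorwise.\<close>

lemma plactic_append:
  assumes "(u, v) \<in> plactic_rel n" "(u', v') \<in> plactic_rel n"
  shows "(u @ u', v @ v') \<in> plactic_rel n"
proof -
  have al: "u \<in> lists (alphabet n)" "v \<in> lists (alphabet n)"
    "u' \<in> lists (alphabet n)" "v' \<in> lists (alphabet n)"
    using plactic_alphabet assms by auto
  obtain h where h: "h u = v" "bij_betw h (component n u) (component n v)"
    "\<And>a. a \<in> component n u \<Longrightarrow> weight n (h a) = weight n a"
    "\<And>a i. a \<in> component n u \<Longrightarrow> i \<in> {1..n} \<Longrightarrow> fop n i (h a) = map_option h (fop n i a)"
    "\<And>a i. a \<in> component n u \<Longrightarrow> i \<in> {1..n} \<Longrightarrow> eop n i (h a) = map_option h (eop n i a)"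
    using placticE[OF assms(1)] by metis
  obtain g where g: "g u' = v'" "bij_betw g (component n u') (component n v')"
    "\<And>a. a \<in> component n u' \<Longrightarrow> weight n (g a) = weight n a"
    "\<And>a i. a \<in> component n u' \<Longrightarrow> i \<in> {1..n} \<Longrightarrow> fop n i (g a) = map_option g (fop n i a)"
    "\<And>a i. a \<in> component n u' \<Longrightarrow> i \<in> {1..n} \<Longrightarrow> eop n i (g a) = map_option g (eop n i a)"
    using placticE[OF assms(2)] by metis
  \<comment> \<open>The length is constant on a component, so cutting after \<open>length u\<close>
    letters recovers the two factors.\<close>
  define k where "k w = h (take (length u) w) @ g (drop (length u) w)" for w
  define S where "S = {a @ a' | a a'. a \<in> component n u \<and> a' \<in> component n u'}"
  have k: "k (a @ a') = h a @ g a'" if "a \<in> component n u" for a a'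
    using component_length[OF that al(1)] by (simp add: k_def)
  have SE: "\<exists>a a'. w = a @ a' \<and> a \<in> component n u \<and> a' \<in> component n u'" if "w \<in> S" for w
    using that by (auto simp: S_def)
  have hal: "h a \<in> lists (alphabet n)" "h a \<in> component n v" if "a \<in> component n u" for a
    using that h(2) component_alphabet[OF _ al(2)] by (auto simp: bij_betw_def)
  have gal: "g a \<in> lists (alphabet n)" "g a \<in> component n v'" if "a \<in> component n u'" for a
    using that g(2) component_alphabet[OF _ al(4)] by (auto simp: bij_betw_def)
  have eph: "eps n i (h a) = eps n i a" "phi n i (h a) = phi n i a"
    if "a \<in> component n u" "i \<in> {1..n}" for a i
    using eps_phi_commute[of i n "component n u" h a] that h(3,5) component_eop
      component_alphabet[OF _ al(1)] by blast+
  have epg: "eps n i (g a) = eps n i a" "phi n i (g a) = phi n i a"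
    if "a \<in> component n u'" "i \<in> {1..n}" for a i
    using eps_phi_commute[of i n "component n u'" g a] that g(3,5) component_eop
      component_alphabet[OF _ al(3)] by blast+
  have "(u @ u', k (u @ u')) \<in> plactic_rel n"
  proof (rule placticI[where S = S])
    show "S \<subseteq> lists (alphabet n)"
      using component_alphabet al by (auto simp: S_def) blast+
    show "u @ u' \<in> S"
      using component_self by (auto simp: S_def)
    show "inj_on k S"
    proof (rule inj_onI)
      fix x y assume "x \<in> S" "y \<in> S" "k x = k y"
      then obtain a a' b b' where *: "x = a @ a'" "y = b @ b'"
        "a \<in> component n u" "a' \<in> component n u'" "b \<in> component n u" "b' \<in> component n u'"
        using SE by meson
      with \<open>k x = k y\<close> have "h a @ g a' = h b @ g b'"
        by (simp add: k)
      moreover have "length (h a) = length (h b)"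
        using * hal component_length al by metis
      ultimately have "h a = h b" "g a' = g b'"
        by auto
      moreover have "inj_on h (component n u)" "inj_on g (component n u')"
        using h(2) g(2) by (simp_all add: bij_betw_def)
      ultimately show "x = y"
        using * by (simp add: inj_on_eq_iff)
    qed
  next
    fix w assume "w \<in> S"
    then obtain a a' where w: "w = a @ a'" and a: "a \<in> component n u" and a': "a' \<in> component n u'"
      using SE by blast
    have aal: "a \<in> lists (alphabet n)" "a' \<in> lists (alphabet n)"
      using a a' component_alphabet al by auto
    show "k w \<in> lists (alphabet n)"
      using hal[OF a] gal[OF a'] by (simp add: w k a)
    show "weight n (k w) = weight n w"
      using h(3)[OF a] g(3)[OF a'] by (simp add: w k a weight_eq_iff)
    fix i assume i: "i \<in> {1..n}"
    note fa = component_fop[OF a aal(1) i] component_fop[OF a' aal(2) i]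
    note ea = component_eop[OF a aal(1) i] component_eop[OF a' aal(2) i]
    show "fop n i (k w) = map_option k (fop n i w)"
      using h(4)[OF a i] g(4)[OF a' i] fa
      by (cases "fop n i a"; cases "fop n i a'")
        (auto simp: w k a fop_append eph[OF a i] epg[OF a' i])
    show "eop n i (k w) = map_option k (eop n i w)"
      using h(5)[OF a i] g(5)[OF a' i] ea
      by (cases "eop n i a"; cases "eop n i a'")
        (auto simp: w k a eop_append eph[OF a i] epg[OF a' i])
    show "b \<in> S" if "fop n i w = Some b" for b
      using that a a' fa by (auto simp: w fop_append S_def split: if_splits)
    show "b \<in> S" if "eop n i w = Some b" for b
      using that a a' ea by (auto simp: w eop_append S_def split: if_splits)
  qed
  then show ?thesis
    using k[OF component_self, of u'] h(1) g(1) by simp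
qed

lemma plactic_step:
  assumes "(u, v) \<in> plactic_rel n" "i \<in> {1..n}"
  shows "fop n i u = Some u' \<Longrightarrow> \<exists>v'. fop n i v = Some v' \<and> (u', v') \<in> plactic_rel n"
    and "eop n i u = Some u' \<Longrightarrow> \<exists>v'. eop n i v = Some v' \<and> (u', v') \<in> plactic_rel n"
proof -
  have al: "u \<in> lists (alphabet n)" "v \<in> lists (alphabet n)"
    using plactic_alphabet assms by auto
  obtain h where h: "h u = v" "bij_betw h (component n u) (component n v)"
    "\<And>a. a \<in> component n u \<Longrightarrow> weight n (h a) = weight n a"
    "\<And>a i. a \<in> component n u \<Longrightarrow> i \<in> {1..n} \<Longrightarrow> fop n i (h a) = map_option h (fop n i a)"
    "\<And>a i. a \<in> component n u \<Longrightarrow> i \<in> {1..n} \<Longrightarrow> eop n i (h a) = map_option h (eop n i a)"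
    using placticE[OF assms(1)] by metis
  have *: "(a, h a) \<in> plactic_rel n" if "a \<in> component n u" for a
  proof (rule placticI[where S = "component n u"])
    show "h b \<in> lists (alphabet n)" if "b \<in> component n u" for b
      using component_alphabet[OF _ al(2)] h(2) that by (auto simp: bij_betw_def)
    show "component n u \<subseteq> lists (alphabet n)"
      using component_alphabet[OF _ al(1)] by blast
    then show "c \<in> component n u" if "b \<in> component n u" "i \<in> {1..n}" "fop n i b = Some c" for b i c
      using that component_fop by blast
    show "c \<in> component n u" if "b \<in> component n u" "i \<in> {1..n}" "eop n i b = Some c" for b i c
      using that \<open>component n u \<subseteq> lists (alphabet n)\<close> component_eop by blast
    show "inj_on h (component n u)"
      using h(2) by (simp add: bij_betw_def)
  qed (rule that h(3-5); assumption)+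
  show "\<exists>v'. fop n i v = Some v' \<and> (u', v') \<in> plactic_rel n" if "fop n i u = Some u'"
    using h(1) h(4)[OF component_self assms(2)] that *
      component_fop[OF component_self al(1) assms(2) that] by auto
  show "\<exists>v'. eop n i v = Some v' \<and> (u', v') \<in> plactic_rel n" if "eop n i u = Some u'"
    using h(1) h(5)[OF component_self assms(2)] that *
      component_eop[OF component_self al(1) assms(2) that] by auto
qed

lemma plactic_weight: "(u, v) \<in> plactic_rel n \<Longrightarrow> weight n u = weight n v"
  using placticE component_self by metis

section \<open>Highest weight words\<close>

definition highest :: "nat \<Rightarrow> letter list \<Rightarrow> bool" where
  "highest n w \<longleftrightarrow> (\<forall>i \<in> {1..n}. eps n i w = 0)"

lemma highest_eop: "highest n w \<longleftrightarrow> (\<forall>i \<in> {1..n}. eop n i w = None)"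
  by (simp add: highest_def eop_None_iff)

lemma plactic_highest:
  assumes "(u, v) \<in> plactic_rel n" "highest n u"
  shows "highest n v"
proof (rule ccontr)
  assume "\<not> highest n v"
  then obtain i v' where "i \<in> {1..n}" "eop n i v = Some v'"
    by (auto simp: highest_eop)
  with plactic_step(2)[OF plactic_sym[OF assms(1)]] assms(2) show False
    by (fastforce simp: highest_eop)
qed

text \<open>A right factor cannot cancel a minus of \<open>u\<close>. This is what allows highest
  weight words to be analysed by prefixes, letter by letter or column by column.\<close>

lemma highest_append1: "highest n (u @ v) \<Longrightarrow> highest n u"
  by (simp add: highest_def eps_append)

text \<open>With \<open>eps\<close> zero, the coroot pairings equal \<open>phi\<close> and are
  nonnegative: the weight is a partition.\<close>

lemma highest_wt:
  assumes "highest n w"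
  shows "i \<in> {1..n} \<Longrightarrow> i < n \<Longrightarrow> wt (Suc i) w \<le> wt i w" "n \<ge> 1 \<Longrightarrow> 0 \<le> wt n w"
  using phi_minus_eps[of i n w] phi_minus_eps[of n n w] assms by (auto simp: highest_def)

lemma highest_wt_mono:
  assumes "highest n w" "1 \<le> i" "i \<le> j" "j \<le> n"
  shows "wt j w \<le> wt i w"
  using assms(3,4)
proof (induction rule: dec_induct)
  case (step k)
  then show ?case
    using highest_wt(1)[OF assms(1), of k] assms(2) by auto
qed simp

lemma highest_wt_nonneg:
  assumes "highest n w" "j \<in> {1..n}"
  shows "0 \<le> wt j w"
  using highest_wt_mono[OF assms(1), of j n] highest_wt(2)[OF assms(1)] assms(2) by auto

text \<open>
  The map \<open>h\<close> has to commute only with the operators \<open>f\<^sub>i\<close>: the weight recovers \<open>\<epsilon>\<^sub>i\<close> from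
  \<open>\<phi>\<^sub>i\<close>, hence \<open>h\<close> commutes with \<open>e\<^sub>i\<close> as well, and it is injective because two words with the same
  image can be raised in parallel to highest weight words.
\<close>

lemma plactic_by_map:
  assumes S: "S \<subseteq> lists (alphabet n)" and u: "u \<in> S"
    and cf: "\<And>a i b. a \<in> S \<Longrightarrow> i \<in> {1..n} \<Longrightarrow> fop n i a = Some b \<Longrightarrow> b \<in> S"
    and ce: "\<And>a i b. a \<in> S \<Longrightarrow> i \<in> {1..n} \<Longrightarrow> eop n i a = Some b \<Longrightarrow> b \<in> S"
    and f: "\<And>a i. a \<in> S \<Longrightarrow> i \<in> {1..n} \<Longrightarrow> fop n i (h a) = map_option h (fop n i a)"
    and weight: "\<And>a. a \<in> S \<Longrightarrow> weight n (h a) = weight n a"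
    and uniq: "\<And>a b. a \<in> S \<Longrightarrow> b \<in> S \<Longrightarrow> highest n a \<Longrightarrow> highest n b \<Longrightarrow>
      weight n a = weight n b \<Longrightarrow> a = b"
    and hS: "\<And>a. a \<in> S \<Longrightarrow> h a \<in> lists (alphabet n)"
  shows "(u, h u) \<in> plactic_rel n"
proof -
  have ph: "phi n i (h a) = phi n i a" if "a \<in> S" "i \<in> {1..n}" for a i
    using that(1)
  proof (induction "phi n i a" arbitrary: a)
    case 0
    then show ?case
      using f[OF _ that(2), of a] by (metis fop_None_iff option.map_disc_iff)
  next
    case (Suc k)
    then obtain b where b: "fop n i a = Some b"
      using fop_None_iff[of n i a] by fastforce
    with Suc f[OF _ that(2), of a] have hb: "fop n i (h a) = Some (h b)"
      by simp
    from b hb that(2) have "phi n i a = Suc (phi n i b)" "phi n i (h a) = Suc (phi n i (h b))"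
      using fop_Some(3) by auto
    with Suc.hyps Suc.prems cf[OF _ that(2) b] show ?case by auto
  qed
  have ep: "eps n i (h a) = eps n i a" if "a \<in> S" "i \<in> {1..n}" for a i
  proof -
    have "wt j (h a) = wt j a" if "j \<in> {1..n}" for j
      using weight[OF \<open>a \<in> S\<close>] that by (simp add: weight_eq_iff)
    then show ?thesis
      using phi_minus_eps[OF that(2), of a] phi_minus_eps[OF that(2), of "h a"] ph[OF that] that
      by (auto split: if_splits)
  qed
  have e: "eop n i (h a) = map_option h (eop n i a)" if "a \<in> S" "i \<in> {1..n}" for a i
  proof (cases "eop n i a")
    case None
    then show ?thesis
      using ep[OF that] eop_None_iff[of n i a] eop_None_iff[of n i "h a"] by simp
  next
    case (Some b)
    then have "b \<in> S" "fop n i b = Some a"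
      using ce eop_Some that by auto
    then show ?thesis
      using f[of b i] that Some fop_Some(1)[of n i "h b" "h a"] by simp
  qed
  have "inj_on h S"
  proof (rule inj_onI)
    fix a b assume "a \<in> S" "b \<in> S" "h a = h b"
    then show "a = b"
    proof (induction "level n a" arbitrary: a b rule: less_induct)
      case less
      have w: "weight n a = weight n b"
        using less.prems weight by metis
      show ?case
      proof (cases "highest n a")
        case True
        then have "highest n b"
          using less.prems ep[of a] ep[of b] by (simp add: highest_def)
        with True less.prems w uniq show ?thesis by blast
      next
        case False
        then obtain i a' where i: "i \<in> {1..n}" and a': "eop n i a = Some a'"
          by (auto simp: highest_eop)
        then obtain b' where b': "eop n i b = Some b'" "h a' = h b'"
          using less.prems e[of a i] e[of b i] by auto
        have fa: "fop n i a' = Some a" "fop n i b' = Some b"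
          using a' b' i eop_Some by auto
        then have "level n a' < level n a"
          using level_fop[OF _ i] by force
        then have "a' = b'"
          using less.hyps[of a' b'] b' ce[OF less.prems(1) i a'] ce[OF less.prems(2) i b'(1)] by blast
        with fa show ?thesis by simp
      qed
    qed
  qed
  show ?thesis
    by (rule placticI[where S = S, OF S u cf ce f e weight \<open>inj_on h S\<close> hS])
qed

section \<open>Columns and the pending counter\<close>

text \<open>
  The letters \<open>y\<^sub>i\<close> are found by a counter that runs down from \<open>n\<close> to \<open>1\<close> and records how many
  pairs of letters \<open>m\<close>, \<open>Bar m\<close> are still waiting for a partner; a free \<open>m\<close> serves one of them.
  The value of the counter just before \<open>m\<close> is processed is \<open>pend n A m\<close>. A column is admissible
  if and only if no pair is left over at the end.
\<close>

definition paired_at :: "letter set \<Rightarrow> nat \<Rightarrow> bool" where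
  "paired_at A m \<longleftrightarrow> Unbarred m \<in> A \<and> Bar m \<in> A"

definition free_at :: "letter set \<Rightarrow> nat \<Rightarrow> bool" where
  "free_at A m \<longleftrightarrow> Unbarred m \<notin> A \<and> Bar m \<notin> A"

definition pend_step :: "letter set \<Rightarrow> nat \<Rightarrow> nat \<Rightarrow> nat" where
  "pend_step A m c = (if paired_at A m then Suc c else if free_at A m then c - 1 else c)"

definition pend :: "nat \<Rightarrow> letter set \<Rightarrow> nat \<Rightarrow> nat" where
  "pend n A m = foldr (pend_step A) [Suc m..<Suc n] 0"

text \<open>The set J. Because \<open>lU\<close> and \<open>rU\<close> are reordered afterwards, it
  does not matter for them which pair receives which partner, so I and J as sets suffice.\<close>

definition partner_set :: "nat \<Rightarrow> letter set \<Rightarrow> nat set" where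
  "partner_set n A = {y \<in> {1..n}. free_at A y \<and> 0 < pend n A y}"

definition left_set :: "nat \<Rightarrow> letter set \<Rightarrow> letter set" where
  "left_set n A = {x. case x of
     Unbarred m \<Rightarrow> Unbarred m \<in> A \<and> Bar m \<notin> A \<or> m \<in> partner_set n A
   | Bar m \<Rightarrow> Bar m \<in> A}"

definition right_set :: "nat \<Rightarrow> letter set \<Rightarrow> letter set" where
  "right_set n A = {x. case x of
     Unbarred m \<Rightarrow> Unbarred m \<in> A
   | Bar m \<Rightarrow> Bar m \<in> A \<and> Unbarred m \<notin> A \<or> m \<in> partner_set n A}"

lemma pend_top: "n \<le> m \<Longrightarrow> pend n A m = 0"
  by (simp add: pend_def)

lemma pend_rec: "m < n \<Longrightarrow> pend n A m = pend_step A (Suc m) (pend n A (Suc m))"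
  by (simp add: pend_def upt_conv_Cons del: upt_Suc)

text \<open>In the notation of admissible columns, \<open>excess A m\<close> is \<open>N(m) - m\<close>.\<close>

definition excess :: "letter set \<Rightarrow> nat \<Rightarrow> int" where
  "excess A m = (\<Sum>j\<in>{1..m}. of_bool (Unbarred j \<in> A) + of_bool (Bar j \<in> A) - 1)"

lemma excess_Suc:
  "excess A (Suc m) = excess A m + (if paired_at A (Suc m) then 1 else if free_at A (Suc m) then -1 else 0)"
  by (simp add: excess_def paired_at_def free_at_def)

text \<open>Truncation at 0 restarts the walk. Hence its final value is the largest of
  \<open>int c + excess A j\<close> and the numbers \<open>excess A m\<close> with
  \<open>m < j\<close>, and it is 0 exactly when none of these is positive.\<close>

lemma pend_run_eq_0_iff:
  "foldr (pend_step A) [1..<Suc j] c = 0 \<longleftrightarrow>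
     int c + excess A j \<le> 0 \<and> (\<forall>m<j. excess A m \<le> 0)"
proof (induction j arbitrary: c)
  case 0
  then show ?case by (simp add: excess_def)
next
  case (Suc j)
  have "foldr (pend_step A) [1..<Suc (Suc j)] c =
    foldr (pend_step A) [1..<Suc j] (pend_step A (Suc j) c)"
    by simp
  also have "\<dots> = 0 \<longleftrightarrow> int (pend_step A (Suc j) c) + excess A j \<le> 0 \<and> (\<forall>m<j. excess A m \<le> 0)"
    by (rule Suc.IH)
  also have "\<dots> \<longleftrightarrow> int c + excess A (Suc j) \<le> 0 \<and> (excess A j \<le> 0 \<and> (\<forall>m<j. excess A m \<le> 0))"
    by (cases c) (auto simp: excess_Suc pend_step_def paired_at_def free_at_def)
  also have "(excess A j \<le> 0 \<and> (\<forall>m<j. excess A m \<le> 0)) \<longleftrightarrow> (\<forall>m<Suc j. excess A m \<le> 0)"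
    by (metis less_Suc_eq)
  finally show ?case .
qed

lemma pend_0_iff: "pend n A 0 = 0 \<longleftrightarrow> (\<forall>m \<in> {1..n}. excess A m \<le> 0)"
proof -
  have "excess A 0 = 0" by (simp add: excess_def)
  then have "(\<forall>m \<in> {1..n}. excess A m \<le> 0) \<longleftrightarrow> (\<forall>m \<le> n. excess A m \<le> 0)"
    by (metis One_nat_def Suc_leI atLeastAtMost_iff gr0I order_refl)
  also have "\<dots> \<longleftrightarrow> excess A n \<le> 0 \<and> (\<forall>m < n. excess A m \<le> 0)"
    by (metis le_less)
  finally show ?thesis
    using pend_run_eq_0_iff[of A n 0] by (simp add: pend_def del: upt_Suc)
qed

section \<open>Admissibility in terms of the counter\<close>

lemma finite_alphabet [simp]: "finite (alphabet n)"
  by (simp add: alphabet_def)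

lemma alphabet_simps [simp]:
  "Unbarred m \<in> alphabet n \<longleftrightarrow> 1 \<le> m \<and> m \<le> n"
  "Bar m \<in> alphabet n \<longleftrightarrow> 1 \<le> m \<and> m \<le> n"
  by (auto simp: alphabet_def)

lemma less_letter_simps [simp]:
  "Unbarred i < Unbarred j \<longleftrightarrow> i < j" "Unbarred i < Bar j"
  "\<not> Bar i < Unbarred j" "Bar i < Bar j \<longleftrightarrow> j < i"
  by (auto simp: less_letter_def)

lemma excess_eq:
  assumes "is_column n U"
  shows "int (length (filter (\<lambda>x. x \<le> Unbarred m \<or> Bar m \<le> x) U)) = excess (set U) m + int m"
proof -
  let ?A = "set U"
  have dist: "distinct U" and al: "?A \<subseteq> alphabet n"
    using assms by (auto simp: is_column_def strict_sorted_iff)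
  have "length (filter (\<lambda>x. x \<le> Unbarred m \<or> Bar m \<le> x) U) =
    card {x \<in> ?A. x \<le> Unbarred m \<or> Bar m \<le> x}"
    using distinct_card[OF distinct_filter[OF dist]] by (metis set_filter)
  also have "{x \<in> ?A. x \<le> Unbarred m \<or> Bar m \<le> x} =
    Unbarred ` {j \<in> {1..m}. Unbarred j \<in> ?A} \<union> Bar ` {j \<in> {1..m}. Bar j \<in> ?A}" (is "?l = ?r")
  proof
    show "?l \<subseteq> ?r"
    proof
      fix x assume "x \<in> ?l"
      with al show "x \<in> ?r" by (cases x) auto
    qed
  qed auto
  also have "card \<dots> = card {j \<in> {1..m}. Unbarred j \<in> ?A} + card {j \<in> {1..m}. Bar j \<in> ?A}"
    by (subst card_Un_disjoint) (auto simp: card_image inj_on_def)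
  also have "int \<dots> = (\<Sum>j\<in>{1..m}. of_bool (Unbarred j \<in> ?A) + of_bool (Bar j \<in> ?A))"
    unfolding sum.distrib by (simp add: sum_of_bool_eq Int_def)
  finally show ?thesis
    by (simp add: excess_def sum_subtractf)
qed

lemma admissible_iff: "admissible n U \<longleftrightarrow> is_column n U \<and> pend n (set U) 0 = 0"
proof (cases "is_column n U")
  case True
  have "length (filter (\<lambda>x. x \<le> Unbarred m \<or> Bar m \<le> x) U) \<le> m \<longleftrightarrow> excess (set U) m \<le> 0" for m
    using excess_eq[OF True, of m] by linarith
  then show ?thesis
    using True by (simp add: admissible_def pend_0_iff)
qed (simp add: admissible_def)

section \<open>The greedy choice of partners agrees with the counter\<close>

lemma length_partners: "length (partners U b xs) = length xs"
  by (induction U b xs rule: partners.induct) (auto simp: Let_def)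

text \<open>The list \<open>zs\<close> consists of the pairs above \<open>j\<close> that are still waiting for a partner.\<close>

lemma partners_run:
  assumes "foldr (pend_step (set U)) [1..<Suc j] (length zs) = 0"
    and "\<And>z. z \<in> set zs \<Longrightarrow> j < z" "j < b"
    and "\<And>z y. z \<in> set zs \<Longrightarrow> j < y \<Longrightarrow> y < min b z \<Longrightarrow> \<not> free_at (set U) y"
  shows "set (partners U b (zs @ rev (filter (paired_at (set U)) [1..<Suc j]))) =
      {y \<in> {1..j}. free_at (set U) y \<and>
        0 < foldr (pend_step (set U)) [Suc y..<Suc j] (length zs)} \<and>
    sorted_wrt (>) (partners U b (zs @ rev (filter (paired_at (set U)) [1..<Suc j])))"
  using assms
proof (induction j arbitrary: zs b)
  case 0
  then have "zs = []" by simp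
  then show ?case by simp
next
  case (Suc j)
  let ?A = "set U" and ?m = "Suc j"
  let ?xs = "rev (filter (paired_at ?A) [1..<Suc j])"
  let ?J = "\<lambda>j c. {y \<in> {1..j}. free_at ?A y \<and> 0 < foldr (pend_step ?A) [Suc y..<Suc j] c}"
  have run: "foldr (pend_step ?A) [1..<Suc j] (pend_step ?A ?m (length zs)) = 0"
    using Suc.prems(1) by simp
  have J: "?J ?m c = (if free_at ?A ?m \<and> 0 < c then {?m} else {}) \<union> ?J j (pend_step ?A ?m c)" for c
  proof -
    have "foldr (pend_step ?A) [Suc y..<Suc ?m] c =
      foldr (pend_step ?A) [Suc y..<Suc j] (pend_step ?A ?m c)" if "y \<le> j" for y
      using that by simp
    then have *: "{y \<in> {1..j}. free_at ?A y \<and> 0 < foldr (pend_step ?A) [Suc y..<Suc ?m] c} =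
       ?J j (pend_step ?A ?m c)"
      by auto
    have "{1..?m} = insert ?m {1..j}" by auto
    then have "?J ?m c = (if free_at ?A ?m \<and> 0 < c then {?m} else {}) \<union>
      {y \<in> {1..j}. free_at ?A y \<and> 0 < foldr (pend_step ?A) [Suc y..<Suc ?m] c}"
      by auto
    with * show ?thesis by simp
  qed
  consider "paired_at ?A ?m" | "free_at ?A ?m" | "\<not> paired_at ?A ?m" "\<not> free_at ?A ?m"
    by blast
  then show ?case
  proof cases
    case 1
    then have nf: "\<not> free_at ?A ?m"
      by (simp add: paired_at_def free_at_def)
    have list: "zs @ rev (filter (paired_at ?A) [1..<Suc ?m]) = (zs @ [?m]) @ ?xs"
      using 1 by simp
    have nofree: "\<not> free_at ?A y" if "z \<in> set (zs @ [?m])" "j < y" "y < min b z" for z y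
      using that Suc.prems(4)[of z y] nf by (cases "y = ?m") auto
    have st: "pend_step ?A ?m (length zs) = length (zs @ [?m])"
      using 1 by (simp add: pend_step_def)
    have lt: "j < z" if "z \<in> set (zs @ [?m])" for z
      using that Suc.prems(2)[of z] by (auto dest: Suc_lessD)
    have "set (partners U b ((zs @ [?m]) @ ?xs)) = ?J j (length (zs @ [?m])) \<and>
      sorted_wrt (>) (partners U b ((zs @ [?m]) @ ?xs))"
      by (rule Suc.IH[OF run[unfolded st] lt Suc_lessD[OF Suc.prems(3)] nofree])
    with nf show ?thesis
      unfolding list J st by simp
  next
    case 3
    have list: "zs @ rev (filter (paired_at ?A) [1..<Suc ?m]) = zs @ ?xs"
      using 3 by simp
    have nofree: "\<not> free_at ?A y" if "z \<in> set zs" "j < y" "y < min b z" for z y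
      using that Suc.prems(4)[of z y] 3 by (cases "y = ?m") auto
    have st: "pend_step ?A ?m (length zs) = length zs"
      using 3 by (simp add: pend_step_def)
    have lt: "j < z" if "z \<in> set zs" for z
      using that Suc.prems(2)[of z] by (auto dest: Suc_lessD)
    have "set (partners U b (zs @ ?xs)) = ?J j (length zs) \<and>
      sorted_wrt (>) (partners U b (zs @ ?xs))"
      by (rule Suc.IH[OF run[unfolded st] lt Suc_lessD[OF Suc.prems(3)] nofree])
    with 3 show ?thesis
      unfolding list J st by simp
  next
    case 2
    then have np: "\<not> paired_at ?A ?m"
      by (simp add: paired_at_def free_at_def)
    have list: "zs @ rev (filter (paired_at ?A) [1..<Suc ?m]) = zs @ ?xs"
      using np by simp
    show ?thesis
    proof (cases zs)
      case Nil
      have st: "pend_step ?A ?m (length zs) = length zs"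
        using 2 np Nil by (simp add: pend_step_def)
      then have "set (partners U b (zs @ ?xs)) = ?J j (length zs) \<and>
        sorted_wrt (>) (partners U b (zs @ ?xs))"
        using run Suc.prems(3) Nil by (intro Suc.IH) (simp_all add: Suc_lessD)
      with Nil show ?thesis
        unfolding list J st by simp
    next
      case (Cons z zs')
      let ?Y = "{y. 1 \<le> y \<and> y < min b z \<and> Unbarred y \<notin> ?A \<and> Bar y \<notin> ?A}"
      \<comment> \<open>All indices strictly between \<open>?m\<close> and \<open>min b z\<close>
        are occupied, so the first free index met on the way down is the greatest one
        allowed.\<close>
      have "Max ?Y = ?m"
      proof (rule Max_eqI)
        show "finite ?Y"
          by (rule finite_subset[of _ "{..<b}"]) auto
        show "y \<le> ?m" if "y \<in> ?Y" for y
          using that Suc.prems(4)[of z y] Cons by (force simp: free_at_def)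
        show "?m \<in> ?Y"
          using 2 Suc.prems(2)[of z] Suc.prems(3) Cons by (auto simp: free_at_def)
      qed
      then have p: "partners U b (zs @ ?xs) = ?m # partners U ?m (zs' @ ?xs)"
        by (simp add: Cons Let_def)
      \<comment> \<open>The waiting pairs form a queue: a free index serves the oldest one,
        \<open>z\<close>, and the counter drops by one.\<close>
      have st: "pend_step ?A ?m (length zs) = length zs'"
        using 2 np Cons by (simp add: pend_step_def)
      have "j < z'" if "z' \<in> set zs'" for z'
        using that Cons Suc.prems(2)[of z'] by auto
      then have "set (partners U ?m (zs' @ ?xs)) = ?J j (length zs') \<and>
        sorted_wrt (>) (partners U ?m (zs' @ ?xs))"
        using run st by (intro Suc.IH) auto
      then show ?thesis
        unfolding list J p st using 2 Cons by auto
    qed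
  qed
qed

lemma paired_eq:
  assumes "set U \<subseteq> alphabet n"
  shows "paired U = rev (filter (paired_at (set U)) [1..<Suc n])"
proof -
  have "{i. Unbarred i \<in> set U \<and> Bar i \<in> set U} = set (filter (paired_at (set U)) [1..<Suc n])"
    using assms by (auto simp: paired_at_def)
  moreover have "sorted_list_of_set (set (filter (paired_at (set U)) [1..<Suc n])) =
    filter (paired_at (set U)) [1..<Suc n]"
    by (intro sorted_list_of_set.idem_if_sorted_distinct)
      (auto intro!: sorted_wrt_filter simp del: upt_Suc)
  ultimately show ?thesis
    by (simp add: paired_def del: upt_Suc)
qed

lemma replacement_props:
  assumes "admissible n U"
  shows "replacement U ` {i. paired_at (set U) i} = partner_set n (set U)"
    "inj_on (replacement U) {i. paired_at (set U) i}"
    "\<not> paired_at (set U) i \<Longrightarrow> replacement U i = i"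
proof -
  let ?A = "set U"
  let ?xs = "paired U"
  let ?ys = "partners U (hd ?xs) ?xs"
  have al: "?A \<subseteq> alphabet n"
    using assms by (auto simp: admissible_def is_column_def)
  have xs: "?xs = rev (filter (paired_at ?A) [1..<Suc n])"
    by (rule paired_eq[OF al])
  have sxs: "set ?xs = {i. paired_at ?A i}"
    using al by (auto simp: xs paired_at_def)
  have dxs: "distinct ?xs"
    by (simp add: xs del: upt_Suc)
  \<comment> \<open>The initial bound enters only through \<open>min\<close>. Replacing it by
    \<open>Suc n\<close> changes nothing and meets the premise \<open>j < b\<close> of
    \<open>partners_run\<close> for \<open>j = n\<close>.\<close>
  have "?ys = partners U (Suc n) ?xs"
  proof (cases ?xs)
    case (Cons x xs')
    then have "x \<le> n"
      using sxs al by (auto simp: paired_at_def)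
    with Cons show ?thesis by (simp add: min_def)
  qed simp
  moreover have "foldr (pend_step ?A) [1..<Suc n] (length ([] :: nat list)) = 0"
    using assms by (simp add: admissible_iff pend_def del: upt_Suc)
  ultimately have "set ?ys = partner_set n ?A" and sw: "sorted_wrt (>) ?ys"
    using partners_run[of U n "[]" "Suc n"]
    by (auto simp: xs partner_set_def pend_def simp del: upt_Suc)
  moreover have dys: "distinct ?ys"
    using sw by (induction ?ys) (auto simp: sorted_wrt_iff_nth_less distinct_conv_nth nat_neq_iff)
  moreover have len: "length ?ys = length ?xs"
    by (rule length_partners)
  have r: "replacement U (?xs ! k) = ?ys ! k" if "k < length ?xs" for k
    using that dxs len by (simp add: replacement_def map_of_zip_nth)
  then have map: "map (replacement U) ?xs = ?ys"
    by (intro nth_equalityI) (simp_all add: len)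
  ultimately show "replacement U ` {i. paired_at ?A i} = partner_set n ?A"
    by (metis sxs set_map)
  show "inj_on (replacement U) {i. paired_at ?A i}"
    using map dys by (metis sxs distinct_map)
  show "replacement U i = i" if "\<not> paired_at ?A i"
  proof -
    have "map_of (zip ?xs ?ys) i = None"
      using that sxs len by (simp add: map_of_zip_is_None)
    then show ?thesis
      by (simp add: replacement_def)
  qed
qed

section \<open>The columns lU and rU as sets\<close>

lemma partner_free: "m \<in> partner_set n A \<Longrightarrow> Unbarred m \<notin> A \<and> Bar m \<notin> A"
  by (simp add: partner_set_def free_at_def)

text \<open>Unpaired indices are fixed, paired ones go to partners; the two kinds of values cannot
  collide because partners are free in \<open>U\<close>.\<close>

lemma replacement_inj_on:
  assumes "admissible n U"
  shows "inj_on (replacement U) {i. Unbarred i \<in> set U \<or> Bar i \<in> set U}"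
proof (rule inj_onI)
  note r = replacement_props[OF assms]
  have not_both: False
    if "paired_at (set U) i" "\<not> paired_at (set U) j" "Unbarred j \<in> set U \<or> Bar j \<in> set U"
      "replacement U i = replacement U j" for i j
  proof -
    have "replacement U i \<in> partner_set n (set U)"
      using r(1) that(1) by blast
    then show False
      using that r(3)[of j] partner_free[of j n "set U"] by simp
  qed
  fix i j
  assume "i \<in> {i. Unbarred i \<in> set U \<or> Bar i \<in> set U}" "j \<in> {i. Unbarred i \<in> set U \<or> Bar i \<in> set U}"
    and eq: "replacement U i = replacement U j"
  then have ij: "Unbarred i \<in> set U \<or> Bar i \<in> set U" "Unbarred j \<in> set U \<or> Bar j \<in> set U"
    by simp_all
  show "i = j"
  proof (cases "paired_at (set U) i")
    case True
    then have "paired_at (set U) j"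
      using not_both[of i j] ij eq by blast
    with True show ?thesis
      using inj_onD[OF r(2) eq] by simp
  next
    case False
    then have "\<not> paired_at (set U) j"
      using not_both[of j i] ij eq by metis
    with False show ?thesis
      using r(3)[of i] r(3)[of j] eq by metis
  qed
qed

text \<open>One argument for both \<open>lU\<close> and \<open>rU\<close>: \<open>C\<close> is the
  kind of letter that is replaced, \<open>D\<close> the kind that stays.\<close>

lemma replaced_column:
  assumes adm: "admissible n U"
    and CD: "C = Unbarred \<and> D = Bar \<or> C = Bar \<and> D = Unbarred"
    and f: "\<And>i. f (C i) = C (replacement U i)" "\<And>i. f (D i) = D i"
  shows "inj_on f (set U)"
    and "C m \<in> f ` set U \<longleftrightarrow> m \<in> partner_set n (set U) \<or> C m \<in> set U \<and> D m \<notin> set U"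
    and "D m \<in> f ` set U \<longleftrightarrow> D m \<in> set U"
proof -
  note r = replacement_props[OF adm]
  have cases: "(\<exists>i. x = C i) \<or> (\<exists>i. x = D i)" for x
    using CD by (cases x) auto
  have eq: "C i = C j \<longleftrightarrow> i = j" "D i = D j \<longleftrightarrow> i = j" "C i \<noteq> D j" "D j \<noteq> C i" for i j
    using CD by auto
  have paired: "paired_at (set U) i \<longleftrightarrow> C i \<in> set U \<and> D i \<in> set U" for i
    using CD by (auto simp: paired_at_def)
  show "inj_on f (set U)"
  proof (rule inj_onI)
    fix x y assume xy: "x \<in> set U" "y \<in> set U" "f x = f y"
    show "x = y"
      using cases[of x] cases[of y]
    proof (elim disjE exE)
      fix i j assume ij: "x = C i" "y = C j"
      with xy have "i \<in> {i. Unbarred i \<in> set U \<or> Bar i \<in> set U}"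
        "j \<in> {i. Unbarred i \<in> set U \<or> Bar i \<in> set U}" "replacement U i = replacement U j"
        using CD by (auto simp: f eq)
      then have "i = j"
        using inj_onD[OF replacement_inj_on[OF adm]] by blast
      with ij show ?thesis by simp
    qed (use xy in \<open>auto simp: f eq\<close>)
  qed
  have "C m \<in> f ` set U \<longleftrightarrow> (\<exists>i. C i \<in> set U \<and> m = replacement U i)"
  proof -
    have "C m = f y \<longleftrightarrow> (\<exists>i. y = C i \<and> m = replacement U i)" for y
      using cases[of y] by (auto simp: f eq)
    then have "C m \<in> f ` set U \<longleftrightarrow> (\<exists>y \<in> set U. \<exists>i. y = C i \<and> m = replacement U i)"
      by (simp only: image_iff)
    then show ?thesis by blast
  qed
  also have "\<dots> \<longleftrightarrow> (\<exists>i. paired_at (set U) i \<and> m = replacement U i) \<or> C m \<in> set U \<and> D m \<notin> set U"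
  proof -
    have "C i \<in> set U \<and> m = replacement U i \<longleftrightarrow> paired_at (set U) i \<and> m = replacement U i \<or>
      C m \<in> set U \<and> D m \<notin> set U \<and> i = m" for i
      using r(3)[of i] unfolding paired by metis
    then show ?thesis by blast
  qed
  also have "(\<exists>i. paired_at (set U) i \<and> m = replacement U i) \<longleftrightarrow> m \<in> partner_set n (set U)"
    using r(1) by blast
  finally show "C m \<in> f ` set U \<longleftrightarrow> m \<in> partner_set n (set U) \<or> C m \<in> set U \<and> D m \<notin> set U" .
  have "D m = f y \<longleftrightarrow> y = D m" for y
    using cases[of y] by (auto simp: f eq)
  then show "D m \<in> f ` set U \<longleftrightarrow> D m \<in> set U"
    by (simp only: image_iff) blast
qed

lemma left_col_props:
  assumes "admissible n U"
  shows "sorted_wrt (<) (left_col U)" "set (left_col U) = left_set n (set U)"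
proof -
  let ?f = "\<lambda>a. case a of Unbarred i \<Rightarrow> Unbarred (replacement U i) | Bar i \<Rightarrow> Bar i"
  note r = replaced_column[OF assms, of Unbarred Bar ?f, simplified]
  have "distinct (map ?f U)"
    using assms r(1) by (simp add: distinct_map admissible_def is_column_def strict_sorted_iff)
  then show "sorted_wrt (<) (left_col U)"
    by (simp add: left_col_def strict_sorted_iff)
  show "set (left_col U) = left_set n (set U)"
  proof (rule Set.set_eqI)
    show "x \<in> set (left_col U) \<longleftrightarrow> x \<in> left_set n (set U)" for x
      using r(2,3) by (cases x) (auto simp: left_col_def left_set_def)
  qed
qed

lemma right_col_props:
  assumes "admissible n U"
  shows "sorted_wrt (<) (right_col U)" "set (right_col U) = right_set n (set U)"
proof -
  let ?f = "\<lambda>a. case a of Unbarred i \<Rightarrow> Unbarred i | Bar i \<Rightarrow> Bar (replacement U i)"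
  note r = replaced_column[OF assms, of Bar Unbarred ?f, simplified]
  have "distinct (map ?f U)"
    using assms r(1) by (simp add: distinct_map admissible_def is_column_def strict_sorted_iff)
  then show "sorted_wrt (<) (right_col U)"
    by (simp add: right_col_def strict_sorted_iff)
  show "set (right_col U) = right_set n (set U)"
  proof (rule Set.set_eqI)
    show "x \<in> set (right_col U) \<longleftrightarrow> x \<in> right_set n (set U)" for x
      using r(2,3) by (cases x) (auto simp: right_col_def right_set_def)
  qed
qed

section \<open>The column order by counting\<close>

definition dominates :: "nat \<Rightarrow> letter set \<Rightarrow> letter set \<Rightarrow> bool" where
  "dominates n A B \<longleftrightarrow> (\<forall>x \<in> alphabet n. card {b \<in> B. b \<le> x} \<le> card {a \<in> A. a \<le> x})"

text \<open>In an increasing word the letters up to \<open>x\<close> form an initial segment. This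
  converts entries in given rows into counts.\<close>

lemma less_card_below_iff:
  fixes x :: letter
  assumes "sorted_wrt (<) U"
  shows "k < card {u \<in> set U. u \<le> x} \<longleftrightarrow> k < length U \<and> U ! k \<le> x"
  using assms
proof (induction U arbitrary: k)
  case (Cons u us)
  show ?case
  proof (cases "u \<le> x")
    case True
    have "{v \<in> set (u # us). v \<le> x} = insert u {v \<in> set us. v \<le> x}"
      using True by auto
    moreover have "u \<notin> {v \<in> set us. v \<le> x}"
      using Cons.prems by auto
    ultimately have "card {v \<in> set (u # us). v \<le> x} = Suc (card {v \<in> set us. v \<le> x})"
      by simp
    then show ?thesis
      using Cons True by (cases k) auto
  next
    case False
    then have "\<forall>v \<in> set (u # us). \<not> v \<le> x"
      using Cons.prems by auto
    then have "{v \<in> set (u # us). v \<le> x} = {}" "k < length (u # us) \<Longrightarrow> \<not> (u # us) ! k \<le> x"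
      using nth_mem[of k "u # us"] by blast+
    then show ?thesis by (metis card.empty not_less0)
  qed
qed simp

text \<open>An entry in row k of \<open>V\<close>, used as threshold, forces more than k letters of
  \<open>U\<close> up to it. The same inequality therefore yields both the height condition and the
  comparison of entries.\<close>

lemma col_le_iff_dominates:
  assumes "sorted_wrt (<) U" "sorted_wrt (<) V" "set V \<subseteq> alphabet n"
  shows "col_le U V \<longleftrightarrow> dominates n (set U) (set V)"
proof
  assume le: "col_le U V"
  show "dominates n (set U) (set V)"
    unfolding dominates_def
  proof (intro ballI leI notI)
    fix x assume "card {a \<in> set U. a \<le> x} < card {b \<in> set V. b \<le> x}" (is "?k < _")
    then have "?k < length V" "V ! ?k \<le> x"
      using less_card_below_iff[OF assms(2)] by auto
    with le have "?k < length U" "U ! ?k \<le> x"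
      by (auto simp: col_le_def intro: order_trans)
    then show False
      using less_card_below_iff[OF assms(1), of ?k x] by simp
  qed
next
  assume d: "dominates n (set U) (set V)"
  have *: "k < length U \<and> U ! k \<le> V ! k" if "k < length V" for k
  proof -
    have "V ! k \<in> alphabet n"
      using that assms(3) by auto
    then have "card {b \<in> set V. b \<le> V ! k} \<le> card {a \<in> set U. a \<le> V ! k}"
      using d by (simp add: dominates_def)
    moreover have "k < card {b \<in> set V. b \<le> V ! k}"
      using that less_card_below_iff[OF assms(2)] by simp
    ultimately show ?thesis
      using less_card_below_iff[OF assms(1)] by (meson less_le_trans)
  qed
  then have "length V \<le> length U"
    by (metis linorder_not_less order_less_irrefl)
  with * show "col_le U V"
    by (simp add: col_le_def)
qed

lemma left_set_alphabet: "A \<subseteq> alphabet n \<Longrightarrow> left_set n A \<subseteq> alphabet n"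
  and right_set_alphabet: "A \<subseteq> alphabet n \<Longrightarrow> right_set n A \<subseteq> alphabet n"
proof -
  show "left_set n A \<subseteq> alphabet n" if "A \<subseteq> alphabet n"
  proof
    show "x \<in> alphabet n" if "x \<in> left_set n A" for x
      using that \<open>A \<subseteq> alphabet n\<close> by (cases x) (auto simp: left_set_def partner_set_def)
  qed
  show "right_set n A \<subseteq> alphabet n" if "A \<subseteq> alphabet n"
  proof
    show "x \<in> alphabet n" if "x \<in> right_set n A" for x
      using that \<open>A \<subseteq> alphabet n\<close> by (cases x) (auto simp: right_set_def partner_set_def)
  qed
qed

lemma col_prec_iff:
  assumes "admissible n U" "admissible n V"
  shows "col_prec U V \<longleftrightarrow> dominates n (right_set n (set U)) (left_set n (set V))"
proof -
  have "set V \<subseteq> alphabet n"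
    using assms(2) by (auto simp: admissible_def is_column_def)
  then show ?thesis
    unfolding col_prec_def
    using col_le_iff_dominates left_col_props[OF assms(2)] right_col_props[OF assms(1)]
      left_set_alphabet by metis
qed

text \<open>The counts change only for thresholds from \<open>a\<close> up to but excluding
  \<open>b\<close>; if \<open>b\<close> succeeds \<open>a\<close> in the alphabet, only the
  threshold \<open>a\<close> is left.\<close>

lemma card_below_move:
  fixes a b :: letter
  assumes "finite A" "a \<in> A" "b \<notin> A" "a < b"
  shows "card {u \<in> A. u \<le> x} =
    card {u \<in> A - {a} \<union> {b}. u \<le> x} + (if a \<le> x \<and> x < b then 1 else 0)"
proof -
  have fin: "finite {u \<in> A. u \<le> x}"
    using assms(1) by simp
  consider "b \<le> x" | "a \<le> x" "x < b" | "x < a"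
    by fastforce
  then show ?thesis
  proof cases
    case 1
    with assms have eq: "{u \<in> A - {a} \<union> {b}. u \<le> x} = insert b ({u \<in> A. u \<le> x} - {a})"
      and in_out: "a \<in> {u \<in> A. u \<le> x}" "b \<notin> {u \<in> A. u \<le> x} - {a}"
      by auto
    have "card {u \<in> A - {a} \<union> {b}. u \<le> x} = Suc (card ({u \<in> A. u \<le> x} - {a}))"
      unfolding eq using fin in_out(2) by (intro card_insert_disjoint) auto
    with 1 card_Suc_Diff1[OF fin in_out(1)] show ?thesis
      by auto
  next
    case 2
    with assms have eq: "{u \<in> A - {a} \<union> {b}. u \<le> x} = {u \<in> A. u \<le> x} - {a}"
      and a_in: "a \<in> {u \<in> A. u \<le> x}"
      by auto
    show ?thesis
      unfolding eq using 2 card_Suc_Diff1[OF fin a_in] by simp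
  next
    case 3
    with assms have "{u \<in> A - {a} \<union> {b}. u \<le> x} = {u \<in> A. u \<le> x}"
      by auto
    with 3 show ?thesis by auto
  qed
qed

text \<open>Domination compares counts up to and including a letter of the alphabet; the greatest
  letter of \<open>B\<close> below \<open>x\<close> serves as such a threshold.\<close>

lemma dominates_strict:
  assumes "dominates n A B" "finite A" "B \<subseteq> alphabet n"
  shows "card {b \<in> B. b < x} \<le> card {a \<in> A. a < x}"
proof (cases "{b \<in> B. b < x} = {}")
  case False
  let ?m = "Max {b \<in> B. b < x}"
  have fin: "finite {b \<in> B. b < x}"
    using assms(3) finite_subset[OF assms(3)] by simp
  then have m: "?m \<in> {b \<in> B. b < x}"
    using False Max_in by blast
  have "{b \<in> B. b < x} = {b \<in> B. b \<le> ?m}"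
    using m fin by (auto intro: Max_ge)
  also have "card \<dots> \<le> card {a \<in> A. a \<le> ?m}"
    using assms m by (auto simp: dominates_def)
  also have "\<dots> \<le> card {a \<in> A. a < x}"
    using assms(2) m by (intro card_mono) auto
  finally show ?thesis .
next
  case True
  then show ?thesis by (simp only: card.empty le0)
qed

lemma card_below_split:
  fixes x :: letter
  assumes "finite A"
  shows "card {u \<in> A. u \<le> x} = card {u \<in> A. u < x} + (if x \<in> A then 1 else 0)"
proof -
  have "{u \<in> A. u \<le> x} = (if x \<in> A then insert x {u \<in> A. u < x} else {u \<in> A. u < x})"
    by (auto simp: le_less)
  then show ?thesis
    using assms by simp
qed

definition neighbours :: "nat \<Rightarrow> letter \<Rightarrow> letter \<Rightarrow> bool" where
  "neighbours n a b \<longleftrightarrow> a \<in> alphabet n \<and> b \<in> alphabet n \<and> a < b \<and>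
     (\<forall>x \<in> alphabet n. x \<le> a \<or> b \<le> x)"

lemma neighbours_split:
  assumes "neighbours n a b" "A \<subseteq> alphabet n"
  shows "card {u \<in> A. u \<le> b} = card {u \<in> A. u \<le> a} + (if b \<in> A then 1 else 0)"
proof -
  have "{u \<in> A. u < b} = {u \<in> A. u \<le> a}"
    using assms by (auto simp: neighbours_def)
  with card_below_split[of A b] assms(2) show ?thesis
    by (simp add: finite_subset)
qed

text \<open>
  If moving a letter of \<open>A\<close> from \<open>a\<close> to its successor \<open>b\<close> destroyed the domination, equality would hold
  at \<open>a\<close>, and comparing the counts just before \<open>a\<close> and at \<open>b\<close> forces \<open>a \<in> B\<close> and \<open>b \<notin> B\<close>.
\<close>

lemma dominates_lower_first:
  assumes dom: "dominates n A B" and nb: "neighbours n a b" and al: "A \<subseteq> alphabet n" "B \<subseteq> alphabet n"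
    and ab: "a \<in> A" "b \<notin> A" and no: "\<not> (a \<in> B \<and> b \<notin> B)"
  shows "dominates n (A - {a} \<union> {b}) B"
  unfolding dominates_def
proof
  fix x assume x: "x \<in> alphabet n"
  have fin: "finite A" "finite B"
    using al by (auto intro: finite_subset)
  have lt: "a < b" "b \<in> alphabet n" "a \<in> alphabet n"
    using nb by (auto simp: neighbours_def)
  have dx: "card {u \<in> B. u \<le> y} \<le> card {u \<in> A. u \<le> y}" if "y \<in> alphabet n" for y
    using dom that by (simp add: dominates_def)
  show "card {u \<in> B. u \<le> x} \<le> card {u \<in> A - {a} \<union> {b}. u \<le> x}"
  proof (cases "a \<le> x \<and> x < b")
    case True
    then have [simp]: "x = a"
      using nb x by (force simp: neighbours_def)
    have "card {u \<in> B. u \<le> a} < card {u \<in> A. u \<le> a}"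
    proof (cases "a \<in> B")
      case True
      then show ?thesis
        using dx[OF lt(2)] neighbours_split[OF nb al(1)] neighbours_split[OF nb al(2)] no ab by simp
    next
      case False
      then show ?thesis
        using dominates_strict[OF dom fin(1) al(2), of a] card_below_split[OF fin(1), of a]
          card_below_split[OF fin(2), of a] ab by simp
    qed
    with card_below_move[OF fin(1) ab lt(1), of x] lt show ?thesis
      by simp
  next
    case False
    with card_below_move[OF fin(1) ab lt(1), of x] dx[OF x] show ?thesis
      by simp
  qed
qed

text \<open>Mirror image of \<open>dominates_lower_first\<close>: the only endangered threshold is
  \<open>a\<close>. Equality of counts there for \<open>B\<close> would require \<open>a\<close> to
  be missing from \<open>A\<close> and the extra letter \<open>b\<close> of \<open>B\<close> to be
  matched by \<open>b\<close> in \<open>A\<close>.\<close>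

lemma dominates_raise_second:
  assumes dom: "dominates n A B" and nb: "neighbours n a b" and al: "A \<subseteq> alphabet n" "B \<subseteq> alphabet n"
    and ab: "a \<in> B'" "b \<notin> B'" "B = B' - {a} \<union> {b}" and no: "\<not> (b \<in> A \<and> a \<notin> A)"
  shows "dominates n A B'"
  unfolding dominates_def
proof
  fix x assume x: "x \<in> alphabet n"
  have fin: "finite A" "finite B" "finite B'"
    using al ab by (auto intro: finite_subset dest: finite_subset)
  have lt: "a < b" "b \<in> alphabet n" "a \<in> alphabet n"
    using nb by (auto simp: neighbours_def)
  have dx: "card {u \<in> B. u \<le> y} \<le> card {u \<in> A. u \<le> y}" if "y \<in> alphabet n" for y
    using dom that by (simp add: dominates_def)
  have mv: "card {u \<in> B'. u \<le> x} = card {u \<in> B. u \<le> x} + (if a \<le> x \<and> x < b then 1 else 0)"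
    using card_below_move[OF fin(3) ab(1,2) lt(1), of x] ab(3) by simp
  show "card {u \<in> B'. u \<le> x} \<le> card {u \<in> A. u \<le> x}"
  proof (cases "a \<le> x \<and> x < b")
    case True
    then have [simp]: "x = a"
      using nb x by (force simp: neighbours_def)
    have bB: "b \<in> B" "a \<notin> B"
      using ab lt by auto
    have "card {u \<in> B. u \<le> a} < card {u \<in> A. u \<le> a}"
    proof (cases "a \<in> A")
      case True
      then show ?thesis
        using dominates_strict[OF dom fin(1) al(2), of a] card_below_split[OF fin(1), of a]
          card_below_split[OF fin(2), of a] bB by simp
    next
      case False
      then show ?thesis
        using dx[OF lt(2)] neighbours_split[OF nb al(1)] neighbours_split[OF nb al(2)] no bB by simp
    qed
    with mv lt show ?thesis
      by simp
  next
    case False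
    with mv dx[OF x] show ?thesis
      by auto
  qed
qed

lemma dominates_lower_second:
  assumes dom: "dominates n A B" and ab: "a \<in> B" "b \<notin> B" "a < b" "finite B"
  shows "dominates n A (B - {a} \<union> {b})"
  unfolding dominates_def
proof
  fix x assume "x \<in> alphabet n"
  then have "card {u \<in> B. u \<le> x} \<le> card {u \<in> A. u \<le> x}"
    using dom by (simp add: dominates_def)
  with card_below_move[OF ab(4,1,2,3), of x]
  show "card {u \<in> B - {a} \<union> {b}. u \<le> x} \<le> card {u \<in> A. u \<le> x}"
    by linarith
qed

lemma dominates_raise_first:
  assumes dom: "dominates n (A - {a} \<union> {b}) B" and ab: "a \<in> A" "b \<notin> A" "a < b" "finite A"
  shows "dominates n A B"
  unfolding dominates_def
proof
  fix x assume "x \<in> alphabet n"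
  then have "card {u \<in> B. u \<le> x} \<le> card {u \<in> A - {a} \<union> {b}. u \<le> x}"
    using dom by (simp add: dominates_def)
  with card_below_move[OF ab(4,1,2,3), of x]
  show "card {u \<in> B. u \<le> x} \<le> card {u \<in> A. u \<le> x}"
    by linarith
qed

section \<open>Crystal operators on columns\<close>

abbreviation col :: "letter set \<Rightarrow> letter list" where
  "col \<equiv> sorted_list_of_set"

lemma is_column_col: "A \<subseteq> alphabet n \<Longrightarrow> is_column n (col A)"
  using finite_subset[OF _ finite_alphabet] by (auto simp: is_column_def)

lemma column_eq_col: "is_column n U \<Longrightarrow> U = col (set U)"
  by (simp add: is_column_def sorted_list_of_set.idem_if_sorted_distinct strict_sorted_iff)

lemma neutral_prefix:
  assumes "\<And>x. x \<in> set w \<Longrightarrow> letter_sign n i x = None"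
  shows "eps n i (w @ v) = eps n i v" "phi n i (w @ v) = phi n i v"
    "fop n i (w @ v) = map_option ((@) w) (fop n i v)"
    "eop n i (w @ v) = map_option ((@) w) (eop n i v)"
proof -
  have "eps n i w = 0" "phi n i w = 0" "fop n i w = None" "eop n i w = None"
    using assms by (induction w) auto
  then show "eps n i (w @ v) = eps n i v" "phi n i (w @ v) = phi n i v"
    "fop n i (w @ v) = map_option ((@) w) (fop n i v)"
    "eop n i (w @ v) = map_option ((@) w) (eop n i v)"
    using eop_None_iff[of n i v] fop_None_iff[of n i v]
    by (auto simp: eps_append phi_append fop_append eop_append)
qed

lemma letter_less_iff:
  "x < Unbarred i \<longleftrightarrow> (\<exists>k<i. x = Unbarred k)"
  "Bar i < x \<longleftrightarrow> (\<exists>k<i. x = Bar k)"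
  "Unbarred i < x \<longleftrightarrow> (\<exists>k>i. x = Unbarred k) \<or> (\<exists>k. x = Bar k)"
  "x < Bar i \<longleftrightarrow> (\<exists>k>i. x = Bar k) \<or> (\<exists>k. x = Unbarred k)"
  by (cases x; auto)+

lemma col_split:
  assumes "A \<subseteq> alphabet n" "i < n" "1 \<le> i"
  shows "col A = col {x \<in> A. x < Unbarred i} @
    (if Unbarred i \<in> A then [Unbarred i] else []) @
    (if Unbarred (Suc i) \<in> A then [Unbarred (Suc i)] else []) @
    col {x \<in> A. Unbarred (Suc i) < x \<and> x < Bar (Suc i)} @
    (if Bar (Suc i) \<in> A then [Bar (Suc i)] else []) @
    (if Bar i \<in> A then [Bar i] else []) @
    col {x \<in> A. Bar i < x}" (is "_ = ?r")
proof (rule strict_sorted_equal)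
  have fin: "finite A"
    using finite_subset[OF assms(1)] by simp
  then show "sorted_wrt (<) (col A)"
    by simp
  have fin': "finite {x \<in> A. P x}" for P
    using fin by simp
  show "sorted_wrt (<) ?r"
    by (auto simp: sorted_wrt_append fin' letter_less_iff)
  show "set (col A) = set ?r"
  proof (rule Set.set_eqI)
    fix x
    show "x \<in> set (col A) \<longleftrightarrow> x \<in> set ?r"
    proof (cases x)
      case (Unbarred k)
      consider "k < i" | "k = i" | "k = Suc i" | "Suc i < k" by linarith
      then show ?thesis
        using fin by cases (auto simp: fin' Unbarred)
    next
      case (Bar k)
      consider "k < i" | "k = i" | "k = Suc i" | "Suc i < k" by linarith
      then show ?thesis
        using fin by cases (auto simp: fin' Bar)
    qed
  qed
qed

lemma col_split_top:
  assumes "A \<subseteq> alphabet n" "1 \<le> n"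
  shows "col A = col {x \<in> A. x < Unbarred n} @
    (if Unbarred n \<in> A then [Unbarred n] else []) @
    (if Bar n \<in> A then [Bar n] else []) @
    col {x \<in> A. Bar n < x}" (is "_ = ?r")
proof (rule strict_sorted_equal)
  have fin: "finite A"
    using finite_subset[OF assms(1)] by simp
  then show "sorted_wrt (<) (col A)"
    by simp
  have fin': "finite {x \<in> A. P x}" for P
    using fin by simp
  show "sorted_wrt (<) ?r"
    by (auto simp: sorted_wrt_append fin' letter_less_iff)
  show "set (col A) = set ?r"
  proof (rule Set.set_eqI)
    fix x
    have "x \<in> A \<Longrightarrow> x \<in> alphabet n"
      using assms(1) by blast
    then show "x \<in> set (col A) \<longleftrightarrow> x \<in> set ?r"
      using fin by (cases x) (auto simp: fin' le_less)
  qed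
qed

definition down :: "nat \<Rightarrow> nat \<Rightarrow> letter set \<Rightarrow> letter set \<Rightarrow> bool" where
  "down n i A B \<longleftrightarrow>
     (if i < n then
        Unbarred i \<in> A \<and> Unbarred (Suc i) \<notin> A \<and> (Bar (Suc i) \<in> A \<or> Bar i \<notin> A) \<and>
          B = A - {Unbarred i} \<union> {Unbarred (Suc i)} \<or>
        Bar (Suc i) \<in> A \<and> Bar i \<notin> A \<and> \<not> (Unbarred i \<in> A \<and> Unbarred (Suc i) \<notin> A) \<and>
          B = A - {Bar (Suc i)} \<union> {Bar i}
      else Unbarred n \<in> A \<and> Bar n \<notin> A \<and> B = A - {Unbarred n} \<union> {Bar n})"

definition up :: "nat \<Rightarrow> nat \<Rightarrow> letter set \<Rightarrow> letter set \<Rightarrow> bool" where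
  "up n i A B \<longleftrightarrow>
     (if i < n then
        Bar i \<in> A \<and> Bar (Suc i) \<notin> A \<and> \<not> (Unbarred i \<in> A \<and> Unbarred (Suc i) \<notin> A) \<and>
          B = A - {Bar i} \<union> {Bar (Suc i)} \<or>
        Unbarred (Suc i) \<in> A \<and> Unbarred i \<notin> A \<and>
          \<not> (Bar i \<in> A \<and> Bar (Suc i) \<notin> A \<and> \<not> (Unbarred i \<in> A \<and> Unbarred (Suc i) \<notin> A)) \<and>
          B = A - {Unbarred (Suc i)} \<union> {Unbarred i}
      else Bar n \<in> A \<and> Unbarred n \<notin> A \<and> B = A - {Bar n} \<union> {Unbarred n})"

text \<open>In a column the marked letters occur at most once each and in the order i, i + 1, bar of
  i + 1, bar of i, with marks + - + -. Everything depends on which of the four are present, and the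
  sixteen cases are checked.\<close>

lemma col_ops_below:
  assumes A: "A \<subseteq> alphabet n" and i: "i < n" "1 \<le> i"
  defines "p \<equiv> Unbarred i \<in> A" and "q \<equiv> Unbarred (Suc i) \<in> A"
    and "r \<equiv> Bar (Suc i) \<in> A" and "s \<equiv> Bar i \<in> A"
  shows "eps n i (col A) = of_bool (q \<and> \<not> p) + of_bool (s \<and> \<not> r \<and> \<not> (p \<and> \<not> q))"
    and "phi n i (col A) = of_bool (p \<and> \<not> q \<and> (r \<or> \<not> s)) + of_bool (r \<and> \<not> s)"
    and "fop n i (col A) =
      (if p \<and> \<not> q \<and> (r \<or> \<not> s) then Some (col (A - {Unbarred i} \<union> {Unbarred (Suc i)}))
       else if r \<and> \<not> s then Some (col (A - {Bar (Suc i)} \<union> {Bar i})) else None)"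
    and "eop n i (col A) =
      (if s \<and> \<not> r \<and> \<not> (p \<and> \<not> q) then Some (col (A - {Bar i} \<union> {Bar (Suc i)}))
       else if q \<and> \<not> p then Some (col (A - {Unbarred (Suc i)} \<union> {Unbarred i})) else None)"
proof -
  define lo mid hi where "lo = col {x \<in> A. x < Unbarred i}"
    and "mid = col {x \<in> A. Unbarred (Suc i) < x \<and> x < Bar (Suc i)}"
    and "hi = col {x \<in> A. Bar i < x}"
  have fin: "finite {x \<in> A. P x}" for P
    using A finite_subset[OF A] by simp
  have neut: "letter_sign n i x = None" if "x \<in> set lo \<or> x \<in> set mid \<or> x \<in> set hi" for x
    using that i by (cases x) (auto simp: lo_def mid_def hi_def fin letter_sign_def)
  have neut': "\<And>x. x \<in> set lo \<Longrightarrow> letter_sign n i x = None"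
    "\<And>x. x \<in> set mid \<Longrightarrow> letter_sign n i x = None" "\<And>x. x \<in> set hi \<Longrightarrow> letter_sign n i x = None"
    using neut by auto
  have hi0: "eps n i hi = 0" "phi n i hi = 0" "fop n i hi = None" "eop n i hi = None"
    using neutral_prefix[of hi n i "[]"] neut' by simp_all
  have sgn: "letter_sign n i (Unbarred i) = Some Plus" "letter_sign n i (Unbarred (Suc i)) = Some Minus"
    "letter_sign n i (Bar (Suc i)) = Some Plus" "letter_sign n i (Bar i) = Some Minus"
    "lower_letter n i (Unbarred i) = Unbarred (Suc i)" "lower_letter n i (Bar (Suc i)) = Bar i"
    "raise_letter n i (Unbarred (Suc i)) = Unbarred i" "raise_letter n i (Bar i) = Bar (Suc i)"
    using i by (auto simp: letter_sign_def lower_letter_def raise_letter_def)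
  have split: "col B = lo @ (if Unbarred i \<in> B then [Unbarred i] else []) @
    (if Unbarred (Suc i) \<in> B then [Unbarred (Suc i)] else []) @ mid @
    (if Bar (Suc i) \<in> B then [Bar (Suc i)] else []) @ (if Bar i \<in> B then [Bar i] else []) @ hi"
    if "B \<subseteq> A \<union> {Unbarred i, Unbarred (Suc i), Bar (Suc i), Bar i}"
      "A \<subseteq> B \<union> {Unbarred i, Unbarred (Suc i), Bar (Suc i), Bar i}" for B
  proof -
    have eqs: "{x \<in> B. x < Unbarred i} = {x \<in> A. x < Unbarred i}"
      "{x \<in> B. Unbarred (Suc i) < x \<and> x < Bar (Suc i)} = {x \<in> A. Unbarred (Suc i) < x \<and> x < Bar (Suc i)}"
      "{x \<in> B. Bar i < x} = {x \<in> A. Bar i < x}"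
      using that by auto
    have "B \<subseteq> alphabet n"
      using that(1) A i by auto
    from col_split[OF this i] show ?thesis
      by (simp only: lo_def mid_def hi_def eqs)
  qed
  note S = split[of A] split[of "A - {Unbarred i} \<union> {Unbarred (Suc i)}"]
    split[of "A - {Bar (Suc i)} \<union> {Bar i}"] split[of "A - {Bar i} \<union> {Bar (Suc i)}"]
    split[of "A - {Unbarred (Suc i)} \<union> {Unbarred i}"]
  have sub: "A \<subseteq> A \<union> X" for X :: "letter set" by blast
  note simps = neutral_prefix[OF neut'(1)] neutral_prefix[OF neut'(2)] hi0 sgn
  show "eps n i (col A) = of_bool (q \<and> \<not> p) + of_bool (s \<and> \<not> r \<and> \<not> (p \<and> \<not> q))"
    by (subst S(1)[OF sub sub]; cases p; cases q; cases r; cases s)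
      (simp_all add: simps flip: p_def q_def r_def s_def)
  show "phi n i (col A) = of_bool (p \<and> \<not> q \<and> (r \<or> \<not> s)) + of_bool (r \<and> \<not> s)"
    by (subst S(1)[OF sub sub]; cases p; cases q; cases r; cases s)
      (simp_all add: simps flip: p_def q_def r_def s_def)
  have S': "col (A - {Unbarred i} \<union> {Unbarred (Suc i)}) = lo @ [Unbarred (Suc i)] @ mid @
      (if r then [Bar (Suc i)] else []) @ (if s then [Bar i] else []) @ hi"
    "col (A - {Bar (Suc i)} \<union> {Bar i}) = lo @ (if p then [Unbarred i] else []) @
      (if q then [Unbarred (Suc i)] else []) @ mid @ [Bar i] @ hi"
    "col (A - {Bar i} \<union> {Bar (Suc i)}) = lo @ (if p then [Unbarred i] else []) @
      (if q then [Unbarred (Suc i)] else []) @ mid @ [Bar (Suc i)] @ hi"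
    "col (A - {Unbarred (Suc i)} \<union> {Unbarred i}) = lo @ [Unbarred i] @ mid @
      (if r then [Bar (Suc i)] else []) @ (if s then [Bar i] else []) @ hi"
    by (subst S; force simp: p_def q_def r_def s_def)+
  show "fop n i (col A) =
      (if p \<and> \<not> q \<and> (r \<or> \<not> s) then Some (col (A - {Unbarred i} \<union> {Unbarred (Suc i)}))
       else if r \<and> \<not> s then Some (col (A - {Bar (Suc i)} \<union> {Bar i})) else None)"
    unfolding S'
    by (subst S(1)[OF sub sub]; cases p; cases q; cases r; cases s)
      (simp_all add: simps flip: p_def q_def r_def s_def)
  show "eop n i (col A) =
      (if s \<and> \<not> r \<and> \<not> (p \<and> \<not> q) then Some (col (A - {Bar i} \<union> {Bar (Suc i)}))
       else if q \<and> \<not> p then Some (col (A - {Unbarred (Suc i)} \<union> {Unbarred i})) else None)"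
    unfolding S'
    by (subst S(1)[OF sub sub]; cases p; cases q; cases r; cases s)
      (simp_all add: simps flip: p_def q_def r_def s_def)
qed

lemma col_ops_top:
  assumes A: "A \<subseteq> alphabet n" and n: "1 \<le> n"
  shows "eps n n (col A) = of_bool (Bar n \<in> A \<and> Unbarred n \<notin> A)"
    and "phi n n (col A) = of_bool (Unbarred n \<in> A \<and> Bar n \<notin> A)"
    and "fop n n (col A) = (if Unbarred n \<in> A \<and> Bar n \<notin> A
      then Some (col (A - {Unbarred n} \<union> {Bar n})) else None)"
    and "eop n n (col A) = (if Bar n \<in> A \<and> Unbarred n \<notin> A
      then Some (col (A - {Bar n} \<union> {Unbarred n})) else None)"
proof -
  define lo hi where "lo = col {x \<in> A. x < Unbarred n}" and "hi = col {x \<in> A. Bar n < x}"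
  have fin: "finite {x \<in> A. P x}" for P
    using A finite_subset[OF A] by simp
  have neut': "\<And>x. x \<in> set lo \<Longrightarrow> letter_sign n n x = None"
    "\<And>x. x \<in> set hi \<Longrightarrow> letter_sign n n x = None"
    by (auto simp: lo_def hi_def fin letter_sign_def)
  have hi0: "eps n n hi = 0" "phi n n hi = 0" "fop n n hi = None" "eop n n hi = None"
    using neutral_prefix[of hi n n "[]"] neut' by simp_all
  have sgn: "letter_sign n n (Unbarred n) = Some Plus" "letter_sign n n (Bar n) = Some Minus"
    "lower_letter n n (Unbarred n) = Bar n" "raise_letter n n (Bar n) = Unbarred n"
    by (auto simp: letter_sign_def lower_letter_def raise_letter_def)
  have split: "col B = lo @ (if Unbarred n \<in> B then [Unbarred n] else []) @
    (if Bar n \<in> B then [Bar n] else []) @ hi"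
    if "B \<subseteq> A \<union> {Unbarred n, Bar n}" "A \<subseteq> B \<union> {Unbarred n, Bar n}" for B
  proof -
    have eqs: "{x \<in> B. x < Unbarred n} = {x \<in> A. x < Unbarred n}"
      "{x \<in> B. Bar n < x} = {x \<in> A. Bar n < x}"
      using that by auto
    have "B \<subseteq> alphabet n"
      using that(1) A n by auto
    from col_split_top[OF this n] show ?thesis
      by (simp only: lo_def hi_def eqs)
  qed
  have S: "col A = lo @ (if Unbarred n \<in> A then [Unbarred n] else []) @
      (if Bar n \<in> A then [Bar n] else []) @ hi"
    by (rule split) auto
  have S1: "col (A - {Unbarred n} \<union> {Bar n}) = lo @ [Bar n] @ hi"
    by (subst split) auto
  have S2: "col (A - {Bar n} \<union> {Unbarred n}) = lo @ [Unbarred n] @ hi"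
    by (subst split) auto
  note simps = neutral_prefix[OF neut'(1)] hi0 sgn
  show "eps n n (col A) = of_bool (Bar n \<in> A \<and> Unbarred n \<notin> A)"
    "phi n n (col A) = of_bool (Unbarred n \<in> A \<and> Bar n \<notin> A)"
    unfolding S by (simp_all add: simps)
  show "fop n n (col A) = (if Unbarred n \<in> A \<and> Bar n \<notin> A
      then Some (col (A - {Unbarred n} \<union> {Bar n})) else None)"
    "eop n n (col A) = (if Bar n \<in> A \<and> Unbarred n \<notin> A
      then Some (col (A - {Bar n} \<union> {Unbarred n})) else None)"
    unfolding S1 S2 by (simp_all add: S simps)
qed

lemma fop_col:
  assumes "A \<subseteq> alphabet n" "i \<in> {1..n}" "fop n i (col A) = Some w"
  obtains B where "down n i A B" "w = col B" "B \<subseteq> alphabet n"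
proof (cases "i < n")
  case True
  have i1: "1 \<le> i" using assms(2) by simp
  note f = col_ops_below(3)[OF assms(1) True i1, unfolded assms(3)]
  show thesis
  proof (cases "Unbarred i \<in> A \<and> Unbarred (Suc i) \<notin> A \<and> (Bar (Suc i) \<in> A \<or> Bar i \<notin> A)")
    case c: True
    show thesis
      by (rule that[of "A - {Unbarred i} \<union> {Unbarred (Suc i)}"])
        (use True assms(1) f c in \<open>auto simp: down_def\<close>)
  next
    case c: False
    with f have "Bar (Suc i) \<in> A \<and> Bar i \<notin> A" "w = col (A - {Bar (Suc i)} \<union> {Bar i})"
      by (auto split: if_splits)
    with c show thesis
      by (intro that[of "A - {Bar (Suc i)} \<union> {Bar i}"])
        (use True assms(1) i1 in \<open>auto simp: down_def\<close>)
  qed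
next
  case False
  with assms(2) have n: "i = n" "1 \<le> n" by auto
  then show thesis
    using col_ops_top(3)[OF assms(1) n(2)] assms(1,3)
    by (intro that[of "A - {Unbarred n} \<union> {Bar n}"]) (auto simp: down_def split: if_splits)
qed

text \<open>The raised word is again a column; lowering it returns \<open>A\<close>, so
  \<open>fop_col\<close> supplies the description by \<open>down\<close>.\<close>

lemma eop_col:
  assumes "A \<subseteq> alphabet n" "i \<in> {1..n}" "eop n i (col A) = Some w"
  obtains B where "down n i B A" "w = col B" "B \<subseteq> alphabet n"
proof -
  have "w \<in> {col (A - {Bar i} \<union> {Bar (Suc i)}), col (A - {Unbarred (Suc i)} \<union> {Unbarred i})}"
    if "i < n"
    using col_ops_below(4)[OF assms(1) that] assms(2,3) by (auto split: if_splits)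
  moreover have "w = col (A - {Bar n} \<union> {Unbarred n})" if "\<not> i < n"
    using col_ops_top(4)[OF assms(1)] assms(2,3) that by (auto split: if_splits)
  moreover have "A - {Bar i} \<union> {Bar (Suc i)} \<subseteq> alphabet n" "A - {Unbarred (Suc i)} \<union> {Unbarred i} \<subseteq> alphabet n"
    if "i < n"
    using that assms(1,2) by auto
  moreover have "A - {Bar n} \<union> {Unbarred n} \<subseteq> alphabet n"
    using assms(1,2) by auto
  ultimately have "\<exists>B \<subseteq> alphabet n. w = col B"
    by blast
  then obtain B where B: "B \<subseteq> alphabet n" "w = col B"
    by blast
  have "fop n i (col B) = Some (col A)"
    using assms(2,3) B eop_Some by auto
  then obtain A' where A': "down n i B A'" "col A = col A'" "A' \<subseteq> alphabet n"
    using fop_col[OF B(1) assms(2)] by metis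
  then have "A = A'"
    using assms(1) by (metis finite_alphabet finite_subset sorted_list_of_set.set_sorted_key_list_of_set)
  with A' B that show thesis by blast
qed

section \<open>Effect of an operator on the counter and on lU and rU\<close>

lemma pend_split: "m \<le> k \<Longrightarrow> k \<le> n \<Longrightarrow>
  pend n A m = foldr (pend_step A) [Suc m..<Suc k] (pend n A k)"
proof -
  assume "m \<le> k" "k \<le> n"
  then have "[Suc m..<Suc n] = [Suc m..<Suc k] @ [Suc k..<Suc n]"
    by (metis Suc_le_mono le_add_diff_inverse upt_add_eq_append)
  then show ?thesis
    by (simp add: pend_def del: upt_Suc)
qed

lemma pend_cong:
  assumes "\<And>k. m < k \<Longrightarrow> k \<le> n \<Longrightarrow> (Unbarred k \<in> A \<longleftrightarrow> Unbarred k \<in> B) \<and> (Bar k \<in> A \<longleftrightarrow> Bar k \<in> B)"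
  shows "pend n A m = pend n B m"
  unfolding pend_def
  by (rule foldr_cong) (use assms in \<open>auto simp: pend_step_def paired_at_def free_at_def fun_eq_iff simp del: upt_Suc\<close>)

text \<open>If the two consecutive steps at i + 1 and i have the same joint effect, the counter can
  differ only between them, that is at the index i.\<close>

lemma pend_local:
  assumes i: "1 \<le> i" "i < n"
    and agree: "\<And>k. k \<noteq> i \<Longrightarrow> k \<noteq> Suc i \<Longrightarrow>
      (Unbarred k \<in> A \<longleftrightarrow> Unbarred k \<in> B) \<and> (Bar k \<in> A \<longleftrightarrow> Bar k \<in> B)"
    and step: "\<And>c. c = pend n A (Suc i) \<Longrightarrow>
      pend_step A i (pend_step A (Suc i) c) = pend_step B i (pend_step B (Suc i) c)"
    and m: "m \<noteq> i"
  shows "pend n A m = pend n B m"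
proof -
  have above: "pend n A k = pend n B k" if "Suc i \<le> k" for k
    using that agree by (intro pend_cong) auto
  have "pend n X (i - 1) = pend_step X i (pend_step X (Suc i) (pend n X (Suc i)))" for X
    using i by (cases i) (simp_all add: pend_rec)
  then have at: "pend n A (i - 1) = pend n B (i - 1)"
    using above[of "Suc i"] step by simp
  show ?thesis
  proof (cases "m < i")
    case True
    have "foldr (pend_step A) [Suc m..<Suc (i - 1)] (pend n A (i - 1)) =
      foldr (pend_step B) [Suc m..<Suc (i - 1)] (pend n A (i - 1))"
      by (rule foldr_cong)
        (use agree i in \<open>auto simp: pend_step_def paired_at_def free_at_def fun_eq_iff\<close>)
    then show ?thesis
      using True i at by (simp add: pend_split[of m "i - 1"] del: upt_Suc)
  qed (use above m in auto)
qed

text \<open>For \<open>i < n\<close> there are two possibilities. Either i and i + 1 exchange their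
  status (pair, free, single), one of them being single and thus neutral; or a pair at i + 1 with a
  free i is traded for two single letters. In the latter case the counter goes up before it goes
  down, so truncation never interferes.\<close>

lemma down_pend:
  assumes "down n i A B" "i \<in> {1..n}" "m \<noteq> i"
  shows "pend n A m = pend n B m"
proof (cases "i < n")
  case True
  show ?thesis
    by (rule pend_local[OF _ True _ _ assms(3)])
      (use assms True in \<open>auto simp: down_def pend_step_def paired_at_def free_at_def\<close>)
next
  case False
  have "pend_step A k = pend_step B k" for k
    using assms(1) False
    by (cases "k = n") (auto simp: down_def pend_step_def paired_at_def free_at_def fun_eq_iff)
  then have "pend_step A = pend_step B" ..
  then show ?thesis
    by (simp add: pend_def)
qed

definition moves :: "nat \<Rightarrow> nat \<Rightarrow> (letter \<times> letter) set" where
  "moves n i = (if i < n then {(Unbarred i, Unbarred (Suc i)), (Bar (Suc i), Bar i)}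
     else {(Unbarred n, Bar n)})"

lemma moves_neighbours: "(a, b) \<in> moves n i \<Longrightarrow> i \<in> {1..n} \<Longrightarrow> neighbours n a b"
  by (auto simp: moves_def neighbours_def alphabet_def split: if_splits)

text \<open>Chains of such moves are needed because one operator may move letters of
  \<open>lU\<close> or \<open>rU\<close> zero, one or two times. If only i + 1 and its bar are
  marked letters of the column, f_i turns i, bar of i + 1 in \<open>lU\<close> into i + 1, bar of i,
  and leaves \<open>rU\<close> alone.\<close>

definition lowers1 :: "nat \<Rightarrow> nat \<Rightarrow> letter set \<Rightarrow> letter set \<Rightarrow> bool" where
  "lowers1 n i X Y \<longleftrightarrow> (\<exists>(a, b) \<in> moves n i. a \<in> X \<and> b \<notin> X \<and> Y = X - {a} \<union> {b})"

lemma lowersI: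
  assumes i: "i < n"
    and agree: "\<And>k. k \<noteq> i \<Longrightarrow> k \<noteq> Suc i \<Longrightarrow>
      (Unbarred k \<in> X \<longleftrightarrow> Unbarred k \<in> Y) \<and> (Bar k \<in> X \<longleftrightarrow> Bar k \<in> Y)"
    and unb: "(Unbarred i \<in> X \<longleftrightarrow> Unbarred i \<in> Y) \<and> (Unbarred (Suc i) \<in> X \<longleftrightarrow> Unbarred (Suc i) \<in> Y) \<or>
      Unbarred i \<in> X \<and> Unbarred (Suc i) \<notin> X \<and> Unbarred i \<notin> Y \<and> Unbarred (Suc i) \<in> Y"
    and bar: "(Bar i \<in> X \<longleftrightarrow> Bar i \<in> Y) \<and> (Bar (Suc i) \<in> X \<longleftrightarrow> Bar (Suc i) \<in> Y) \<or>
      Bar (Suc i) \<in> X \<and> Bar i \<notin> X \<and> Bar (Suc i) \<notin> Y \<and> Bar i \<in> Y"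
  shows "(lowers1 n i)\<^sup>*\<^sup>* X Y"
proof -
  \<comment> \<open>\<open>Z\<close> is the result of the unbarred move, if there is one; the barred
    move is done from there.\<close>
  define Z where "Z = (if Unbarred i \<in> X \<longleftrightarrow> Unbarred i \<in> Y then X
    else X - {Unbarred i} \<union> {Unbarred (Suc i)})"
  have 1: "(lowers1 n i)\<^sup>*\<^sup>* X Z"
    using i unb by (auto simp: Z_def lowers1_def moves_def intro!: r_into_rtranclp)
  have *: "Y = (if Bar i \<in> X \<longleftrightarrow> Bar i \<in> Y then Z else Z - {Bar (Suc i)} \<union> {Bar i})"
  proof (rule Set.set_eqI)
    fix x
    show "x \<in> Y \<longleftrightarrow> x \<in> (if Bar i \<in> X \<longleftrightarrow> Bar i \<in> Y then Z else Z - {Bar (Suc i)} \<union> {Bar i})"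
    proof (cases x)
      case (Unbarred k)
      then show ?thesis
        using agree[of k] unb bar by (cases "k = i"; cases "k = Suc i") (auto simp: Z_def)
    next
      case (Bar k)
      then show ?thesis
        using agree[of k] unb bar by (cases "k = i"; cases "k = Suc i") (auto simp: Z_def)
    qed
  qed
  have "(lowers1 n i)\<^sup>*\<^sup>* Z Y"
  proof (cases "Bar i \<in> X \<longleftrightarrow> Bar i \<in> Y")
    case True
    with * show ?thesis by simp
  next
    case False
    then have "lowers1 n i Z Y"
      using i bar * by (auto simp: Z_def lowers1_def moves_def)
    then show ?thesis by blast
  qed
  with 1 show ?thesis by (rule rtranclp_trans)
qed

lemma left_right_set_iff:
  "Unbarred m \<in> left_set n A \<longleftrightarrow> Unbarred m \<in> A \<and> Bar m \<notin> A \<or>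
     1 \<le> m \<and> m \<le> n \<and> Unbarred m \<notin> A \<and> Bar m \<notin> A \<and> 0 < pend n A m"
  "Bar m \<in> left_set n A \<longleftrightarrow> Bar m \<in> A"
  "Unbarred m \<in> right_set n A \<longleftrightarrow> Unbarred m \<in> A"
  "Bar m \<in> right_set n A \<longleftrightarrow> Bar m \<in> A \<and> Unbarred m \<notin> A \<or>
     1 \<le> m \<and> m \<le> n \<and> Unbarred m \<notin> A \<and> Bar m \<notin> A \<and> 0 < pend n A m"
  by (auto simp: left_set_def right_set_def partner_set_def free_at_def)

lemma letter_set_eqI:
  "(\<And>k. (Unbarred k \<in> X \<longleftrightarrow> Unbarred k \<in> Y) \<and> (Bar k \<in> X \<longleftrightarrow> Bar k \<in> Y)) \<Longrightarrow> X = Y"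
  by (rule Set.set_eqI) (metis letter.exhaust)

text \<open>
  For the last two claims: \<open>\<epsilon>\<^sub>i\<close> and \<open>\<phi>\<^sub>i\<close> are both positive only if the column contains exactly
  \<open>Unbarred (Suc i)\<close> and \<open>Bar (Suc i)\<close> among the marked letters, and then the operator changes only one
  of the sets \<open>left_set\<close> and \<open>right_set\<close>.
\<close>

lemma down_left_right:
  assumes d: "down n i A B" and i: "i \<in> {1..n}" and A: "A \<subseteq> alphabet n" "B \<subseteq> alphabet n"
  shows "(lowers1 n i)\<^sup>*\<^sup>* (left_set n A) (left_set n B)"
    and "(lowers1 n i)\<^sup>*\<^sup>* (right_set n A) (right_set n B)"
    and "0 < eps n i (col A) \<Longrightarrow> right_set n B = right_set n A"
    and "0 < phi n i (col B) \<Longrightarrow> left_set n B = left_set n A"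
proof -
  have "(lowers1 n i)\<^sup>*\<^sup>* (left_set n A) (left_set n B) \<and>
    (lowers1 n i)\<^sup>*\<^sup>* (right_set n A) (right_set n B) \<and>
    (0 < eps n i (col A) \<longrightarrow> right_set n B = right_set n A) \<and>
    (0 < phi n i (col B) \<longrightarrow> left_set n B = left_set n A)"
  proof (cases "i < n")
    case True
    have i1: "1 \<le> i" using i by simp
    define c where "c = pend n A (Suc i)"
    have c: "pend n B (Suc i) = c"
      using down_pend[OF d i, of "Suc i"] by (simp add: c_def)
    have pi: "pend n A i = pend_step A (Suc i) c" "pend n B i = pend_step B (Suc i) c"
      using True c by (simp_all add: c_def pend_rec)
    note iff = left_right_set_iff[of i] left_right_set_iff[of "Suc i"] pi c c_def[symmetric]
      pend_step_def paired_at_def free_at_def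
    have out: "(Unbarred k \<in> A \<longleftrightarrow> Unbarred k \<in> B) \<and> (Bar k \<in> A \<longleftrightarrow> Bar k \<in> B)"
      if "k \<noteq> i" "k \<noteq> Suc i" for k
      using d that True by (auto simp: down_def)
    have outL: "(Unbarred k \<in> left_set n A \<longleftrightarrow> Unbarred k \<in> left_set n B) \<and>
      (Bar k \<in> left_set n A \<longleftrightarrow> Bar k \<in> left_set n B)"
      and outR: "(Unbarred k \<in> right_set n A \<longleftrightarrow> Unbarred k \<in> right_set n B) \<and>
      (Bar k \<in> right_set n A \<longleftrightarrow> Bar k \<in> right_set n B)"
      if "k \<noteq> i" "k \<noteq> Suc i" for k
      using out[OF that] down_pend[OF d i that(1)] by (simp_all add: left_right_set_iff)
    have dc: "Unbarred i \<in> A \<and> Unbarred (Suc i) \<notin> A \<and> (Bar (Suc i) \<in> A \<or> Bar i \<notin> A) \<and>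
        Unbarred i \<notin> B \<and> Unbarred (Suc i) \<in> B \<and> (Bar i \<in> B \<longleftrightarrow> Bar i \<in> A) \<and>
        (Bar (Suc i) \<in> B \<longleftrightarrow> Bar (Suc i) \<in> A) \<or>
      Bar (Suc i) \<in> A \<and> Bar i \<notin> A \<and> \<not> (Unbarred i \<in> A \<and> Unbarred (Suc i) \<notin> A) \<and>
        Bar (Suc i) \<notin> B \<and> Bar i \<in> B \<and> (Unbarred i \<in> B \<longleftrightarrow> Unbarred i \<in> A) \<and>
        (Unbarred (Suc i) \<in> B \<longleftrightarrow> Unbarred (Suc i) \<in> A)"
      using d True by (auto simp: down_def)
    have "(lowers1 n i)\<^sup>*\<^sup>* (left_set n A) (left_set n B)"
      by (rule lowersI[OF True outL]) (use dc i1 True in \<open>auto simp: iff\<close>)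
    moreover have "(lowers1 n i)\<^sup>*\<^sup>* (right_set n A) (right_set n B)"
      by (rule lowersI[OF True outR]) (use dc i1 True in \<open>auto simp: iff\<close>)
    moreover have "right_set n B = right_set n A" if "0 < eps n i (col A)"
    proof (rule letter_set_eqI)
      fix k
      show "(Unbarred k \<in> right_set n B \<longleftrightarrow> Unbarred k \<in> right_set n A) \<and>
        (Bar k \<in> right_set n B \<longleftrightarrow> Bar k \<in> right_set n A)"
        using that dc outR[of k] i1 True unfolding col_ops_below(1)[OF A(1) True i1]
        by (cases "k = i"; cases "k = Suc i") (auto simp: iff)
    qed
    moreover have "left_set n B = left_set n A" if "0 < phi n i (col B)"
    proof (rule letter_set_eqI)
      fix k
      show "(Unbarred k \<in> left_set n B \<longleftrightarrow> Unbarred k \<in> left_set n A) \<and>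
        (Bar k \<in> left_set n B \<longleftrightarrow> Bar k \<in> left_set n A)"
        using that dc outL[of k] i1 True unfolding col_ops_below(2)[OF A(2) True i1]
        by (cases "k = i"; cases "k = Suc i") (auto simp: iff)
    qed
    ultimately show ?thesis by blast
  next
    case False
    with i have [simp]: "i = n" and n: "1 \<le> n" by auto
    have dd: "Unbarred n \<in> A" "Bar n \<notin> A" "B = A - {Unbarred n} \<union> {Bar n}"
      using d by (auto simp: down_def)
    have pe: "pend n A k = pend n B k" for k
      using down_pend[OF d i, of k] by (cases "k = n") (auto simp: pend_top)
    have "left_set n B = left_set n A - {Unbarred n} \<union> {Bar n}"
      by (rule letter_set_eqI) (use dd in \<open>auto simp: left_right_set_iff pe\<close>)
    moreover have "right_set n B = right_set n A - {Unbarred n} \<union> {Bar n}"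
      by (rule letter_set_eqI) (use dd in \<open>auto simp: left_right_set_iff pe\<close>)
    moreover have "Unbarred n \<in> left_set n A" "Bar n \<notin> left_set n A"
      "Unbarred n \<in> right_set n A" "Bar n \<notin> right_set n A"
      using dd by (auto simp: left_right_set_iff)
    moreover have "eps n n (col A) = 0" "phi n n (col B) = 0"
      using col_ops_top(1)[OF A(1) n] col_ops_top(2)[OF A(2) n] dd by auto
    ultimately have "lowers1 n i (left_set n A) (left_set n B)"
      "lowers1 n i (right_set n A) (right_set n B)" "eps n i (col A) = 0" "phi n i (col B) = 0"
      by (simp_all add: lowers1_def moves_def)
    then show ?thesis
      by (simp add: r_into_rtranclp)
  qed
  then show "(lowers1 n i)\<^sup>*\<^sup>* (left_set n A) (left_set n B)"
    and "(lowers1 n i)\<^sup>*\<^sup>* (right_set n A) (right_set n B)"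
    and "0 < eps n i (col A) \<Longrightarrow> right_set n B = right_set n A"
    and "0 < phi n i (col B) \<Longrightarrow> left_set n B = left_set n A"
    by blast+
qed

text \<open>This excludes the exceptional situation of \<open>dominates_lower_first\<close>: when
  \<open>phi\<close> vanishes, \<open>lU\<close> has no letter that could be moved down. In the same
  way \<open>right_set_eps\<close> serves \<open>dominates_raise_second\<close>.\<close>

lemma left_set_phi:
  assumes A: "A \<subseteq> alphabet n" and i: "i \<in> {1..n}" and ab: "(a, b) \<in> moves n i"
    and mem: "a \<in> left_set n A" "b \<notin> left_set n A"
  shows "0 < phi n i (col A)"
proof (cases "i < n")
  case True
  have i1: "1 \<le> i" using i by simp
  have "pend n A i = pend_step A (Suc i) (pend n A (Suc i))"
    using True by (rule pend_rec)
  then show ?thesis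
    using ab mem True i1 unfolding col_ops_below(2)[OF A True i1]
    by (auto simp: moves_def left_right_set_iff pend_step_def paired_at_def free_at_def split: if_splits)
next
  case False
  with i have [simp]: "i = n" and n: "1 \<le> n" by auto
  show ?thesis
    using ab mem by (auto simp: moves_def left_right_set_iff col_ops_top(2)[OF A n] pend_top)
qed

lemma right_set_eps:
  assumes A: "A \<subseteq> alphabet n" and i: "i \<in> {1..n}" and ab: "(a, b) \<in> moves n i"
    and mem: "b \<in> right_set n A" "a \<notin> right_set n A"
  shows "0 < eps n i (col A)"
proof (cases "i < n")
  case True
  have i1: "1 \<le> i" using i by simp
  have "pend n A i = pend_step A (Suc i) (pend n A (Suc i))"
    using True by (rule pend_rec)
  then show ?thesis
    using ab mem True i1 unfolding col_ops_below(1)[OF A True i1]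
    by (auto simp: moves_def left_right_set_iff pend_step_def paired_at_def free_at_def split: if_splits)
next
  case False
  with i have [simp]: "i = n" and n: "1 \<le> n" by auto
  show ?thesis
    using ab mem by (auto simp: moves_def left_right_set_iff col_ops_top(1)[OF A n] pend_top)
qed

section \<open>Chains of elementary moves and the column order\<close>

lemma lowers_alphabet:
  assumes "(lowers1 n i)\<^sup>*\<^sup>* X Y" "X \<subseteq> alphabet n" "i \<in> {1..n}"
  shows "Y \<subseteq> alphabet n"
  using assms(1,2)
proof (induction rule: rtranclp_induct)
  case (step Y Z)
  then obtain a b where "(a, b) \<in> moves n i" "Z = Y - {a} \<union> {b}"
    by (auto simp: lowers1_def)
  with step moves_neighbours[OF _ assms(3)] show ?case
    by (auto simp: neighbours_def)
qed simp

lemma dominates_lowers_first: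
  assumes "(lowers1 n i)\<^sup>*\<^sup>* A A'" "i \<in> {1..n}" "A \<subseteq> alphabet n" "B \<subseteq> alphabet n" "dominates n A B"
    and "\<And>a b. (a, b) \<in> moves n i \<Longrightarrow> \<not> (a \<in> B \<and> b \<notin> B)"
  shows "dominates n A' B"
  using assms(1)
proof (induction rule: rtranclp_induct)
  case (step Y Z)
  then obtain a b where ab: "(a, b) \<in> moves n i" "a \<in> Y" "b \<notin> Y" "Z = Y - {a} \<union> {b}"
    by (auto simp: lowers1_def)
  then show ?case
    using dominates_lower_first[OF step.IH moves_neighbours[OF ab(1) assms(2)]
        lowers_alphabet[OF step.hyps(1) assms(3,2)] assms(4) ab(2,3) assms(6)[OF ab(1)]]
    by simp
qed (rule assms(5))

lemma dominates_raises_second: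
  assumes "(lowers1 n i)\<^sup>*\<^sup>* B' B" "i \<in> {1..n}" "A \<subseteq> alphabet n" "B' \<subseteq> alphabet n" "dominates n A B"
    and "\<And>a b. (a, b) \<in> moves n i \<Longrightarrow> \<not> (b \<in> A \<and> a \<notin> A)"
  shows "dominates n A B'"
  using assms(1,5)
proof (induction rule: rtranclp_induct)
  case (step Y Z)
  then obtain a b where ab: "(a, b) \<in> moves n i" "a \<in> Y" "b \<notin> Y" "Z = Y - {a} \<union> {b}"
    by (auto simp: lowers1_def)
  have "(lowers1 n i)\<^sup>*\<^sup>* B' Z"
    using step.hyps by (rule rtranclp.rtrancl_into_rtrancl)
  then have "dominates n A Y"
    using dominates_raise_second[OF step.prems moves_neighbours[OF ab(1) assms(2)] assms(3)
        lowers_alphabet[OF _ assms(4,2)] ab(2,3,4) assms(6)[OF ab(1)]] by simp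
  then show ?case by (rule step.IH)
qed

lemma dominates_lowers_second:
  assumes "(lowers1 n i)\<^sup>*\<^sup>* B B'" "i \<in> {1..n}" "B \<subseteq> alphabet n" "dominates n A B"
  shows "dominates n A B'"
  using assms(1)
proof (induction rule: rtranclp_induct)
  case (step Y Z)
  then obtain a b where ab: "(a, b) \<in> moves n i" "a \<in> Y" "b \<notin> Y" "Z = Y - {a} \<union> {b}"
    by (auto simp: lowers1_def)
  then show ?case
    using dominates_lower_second[OF step.IH ab(2,3)] moves_neighbours[OF ab(1) assms(2)]
      finite_subset[OF lowers_alphabet[OF step.hyps(1) assms(3,2)] finite_alphabet]
    by (simp add: neighbours_def)
qed (rule assms(4))

lemma dominates_raises_first:
  assumes "(lowers1 n i)\<^sup>*\<^sup>* A' A" "i \<in> {1..n}" "A' \<subseteq> alphabet n" "dominates n A B"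
  shows "dominates n A' B"
  using assms(1,4)
proof (induction rule: rtranclp_induct)
  case (step Y Z)
  then obtain a b where ab: "(a, b) \<in> moves n i" "a \<in> Y" "b \<notin> Y" "Z = Y - {a} \<union> {b}"
    by (auto simp: lowers1_def)
  have "dominates n Y B"
    by (rule dominates_raise_first[of n Y a b])
      (use ab step.prems moves_neighbours[OF ab(1) assms(2)]
        finite_subset[OF lowers_alphabet[OF step.hyps(1) assms(3,2)] finite_alphabet]
       in \<open>simp_all add: neighbours_def\<close>)
  then show ?case by (rule step.IH)
qed

section \<open>Symplectic tableaux in word order\<close>

text \<open>The columns are listed as they are read, from right to left.\<close>

definition tableau_word :: "nat \<Rightarrow> letter list list \<Rightarrow> bool" where
  "tableau_word n g \<longleftrightarrow> set g \<subseteq> admissible_columns n \<and> successively (\<lambda>u v. col_prec v u) g"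

lemma successively_nth_iff: "successively P xs \<longleftrightarrow> (\<forall>k. Suc k < length xs \<longrightarrow> P (xs ! k) (xs ! Suc k))"
proof (induction xs)
  case (Cons x xs)
  have "(\<forall>k. Suc k < length (x # xs) \<longrightarrow> P ((x # xs) ! k) ((x # xs) ! Suc k)) \<longleftrightarrow>
    (xs \<noteq> [] \<longrightarrow> P x (xs ! 0)) \<and> (\<forall>k. Suc k < length xs \<longrightarrow> P (xs ! k) (xs ! Suc k))"
    by (auto simp: nth_Cons split: nat.splits)
  then show ?case
    unfolding Cons.IH[symmetric] by (auto simp: successively_Cons hd_conv_nth)
qed simp

lemma symplectic_tableau_iff: "symplectic_tableau n T \<longleftrightarrow> tableau_word n (rev T)"
  by (auto simp: symplectic_tableau_def tableau_word_def successively_nth_iff[symmetric]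
      in_lists_conv_set)

lemma admissible_col_iff: "admissible n (col A) \<longleftrightarrow> pend n A 0 = 0" if "A \<subseteq> alphabet n"
  using that finite_subset[OF that finite_alphabet] by (simp add: admissible_iff is_column_col)

lemma admissibleE:
  assumes "admissible n U"
  obtains A where "U = col A" "A \<subseteq> alphabet n" "set U = A"
  using assms column_eq_col[of n U] that[of "set U"]
  by (auto simp: admissible_def is_column_def)

lemma admissible_fop:
  assumes "admissible n u" "i \<in> {1..n}" "fop n i u = Some u'"
  shows "admissible n u'"
proof -
  obtain A where A: "u = col A" "A \<subseteq> alphabet n"
    using admissibleE[OF assms(1)] by metis
  obtain B where B: "down n i A B" "u' = col B" "B \<subseteq> alphabet n"
    using fop_col A assms(2,3) by metis
  have "pend n A 0 = pend n B 0"
    using down_pend[OF B(1) assms(2), of 0] assms(2) by simp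
  with assms(1) A B show ?thesis
    using admissible_col_iff by metis
qed

lemma admissible_eop:
  assumes "admissible n u" "i \<in> {1..n}" "eop n i u = Some u'"
  shows "admissible n u'"
proof -
  obtain A where A: "u = col A" "A \<subseteq> alphabet n"
    using admissibleE[OF assms(1)] by metis
  obtain B where B: "down n i B A" "u' = col B" "B \<subseteq> alphabet n"
    using eop_col A assms(2,3) by metis
  have "pend n B 0 = pend n A 0"
    using down_pend[OF B(1) assms(2), of 0] assms(2) by simp
  with assms(1) A B show ?thesis
    using admissible_col_iff by metis
qed

lemma col_prec_sets:
  assumes "admissible n U" "admissible n V"
  shows "col_prec U V \<longleftrightarrow> dominates n (right_set n (set U)) (left_set n (set V))"
    "right_set n (set U) \<subseteq> alphabet n" "left_set n (set V) \<subseteq> alphabet n"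
proof -
  have "set U \<subseteq> alphabet n" "set V \<subseteq> alphabet n"
    using assms by (auto simp: admissible_def is_column_def)
  then show "right_set n (set U) \<subseteq> alphabet n" "left_set n (set V) \<subseteq> alphabet n"
    by (simp_all add: right_set_alphabet left_set_alphabet)
qed (rule col_prec_iff[OF assms])

lemma fop_sets:
  assumes "admissible n u" "i \<in> {1..n}" "fop n i u = Some u'"
  shows "(lowers1 n i)\<^sup>*\<^sup>* (left_set n (set u)) (left_set n (set u'))"
    and "(lowers1 n i)\<^sup>*\<^sup>* (right_set n (set u)) (right_set n (set u'))"
    and "0 < eps n i u \<Longrightarrow> right_set n (set u') = right_set n (set u)"
    and "0 < phi n i u' \<Longrightarrow> left_set n (set u') = left_set n (set u)"
proof -
  obtain A where A: "u = col A" "A \<subseteq> alphabet n" "set u = A"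
    using admissibleE[OF assms(1)] by metis
  obtain B where B: "down n i A B" "u' = col B" "B \<subseteq> alphabet n"
    using fop_col A assms(2,3) by metis
  have "set u' = B"
    using B finite_subset[OF B(3)] by simp
  with A B down_left_right[OF B(1) assms(2) A(2) B(3)]
  show "(lowers1 n i)\<^sup>*\<^sup>* (left_set n (set u)) (left_set n (set u'))"
    and "(lowers1 n i)\<^sup>*\<^sup>* (right_set n (set u)) (right_set n (set u'))"
    and "0 < eps n i u \<Longrightarrow> right_set n (set u') = right_set n (set u)"
    and "0 < phi n i u' \<Longrightarrow> left_set n (set u') = left_set n (set u)"
    by simp_all
qed

lemma no_move_left:
  assumes "admissible n u" "i \<in> {1..n}" "phi n i u = 0" "(a, b) \<in> moves n i"
  shows "\<not> (a \<in> left_set n (set u) \<and> b \<notin> left_set n (set u))"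
proof -
  obtain A where A: "u = col A" "A \<subseteq> alphabet n" "set u = A"
    using admissibleE[OF assms(1)] by metis
  with left_set_phi[OF A(2) assms(2,4)] assms(3) show ?thesis by auto
qed

lemma no_move_right:
  assumes "admissible n u" "i \<in> {1..n}" "eps n i u = 0" "(a, b) \<in> moves n i"
  shows "\<not> (b \<in> right_set n (set u) \<and> a \<notin> right_set n (set u))"
proof -
  obtain A where A: "u = col A" "A \<subseteq> alphabet n" "set u = A"
    using admissibleE[OF assms(1)] by metis
  with right_set_eps[OF A(2) assms(2,4)] assms(3) show ?thesis by auto
qed

context
  fixes n i u v
  assumes uv: "admissible n u" "admissible n v" and i: "i \<in> {1..n}" and prec: "col_prec v u"
begin

lemma col_prec_fop_right:
  assumes "fop n i u = Some u'"
  shows "col_prec v u'"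
  using dominates_lowers_second[OF fop_sets(1)[OF uv(1) i assms] i]
    col_prec_sets[OF uv(2,1)] col_prec_sets[OF uv(2) admissible_fop[OF uv(1) i assms]] prec
  by blast

text \<open>The inequality says that in \<open>u @ v\<close> the operator acts on \<open>v\<close>.
  If \<open>eps\<close> of \<open>v\<close> is positive, \<open>rV\<close> does not change at all.
  Otherwise \<open>phi\<close> of \<open>u\<close> is 0, so \<open>lU\<close> has no movable letter
  and domination survives each move of \<open>rV\<close>.\<close>

lemma col_prec_fop_left:
  assumes "fop n i v = Some v'" "phi n i u \<le> eps n i v"
  shows "col_prec v' u"
proof (cases "eps n i v = 0")
  case True
  then show ?thesis
    using dominates_lowers_first[OF fop_sets(2)[OF uv(2) i assms(1)] i]
      col_prec_sets[OF uv(2,1)] col_prec_sets[OF admissible_fop[OF uv(2) i assms(1)] uv(1)] prec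
      no_move_left[OF uv(1) i] assms(2) by simp
next
  case False
  then show ?thesis
    using fop_sets(3)[OF uv(2) i assms(1)] prec
      col_prec_sets[OF uv(2,1)] col_prec_sets[OF admissible_fop[OF uv(2) i assms(1)] uv(1)] by simp
qed

lemma col_prec_eop_left:
  assumes "eop n i v = Some v'"
  shows "col_prec v' u"
proof -
  have v': "admissible n v'" "fop n i v' = Some v"
    using admissible_eop[OF uv(2) i assms] assms eop_Some i by auto
  show ?thesis
    using dominates_raises_first[OF fop_sets(2)[OF v'(1) i v'(2)] i]
      col_prec_sets[OF uv(2,1)] col_prec_sets[OF v'(1) uv(1)] prec by blast
qed

text \<open>Dual dichotomy: either \<open>phi\<close> of \<open>u\<close> is positive and
  \<open>lU\<close> stays, or both string lengths vanish and \<open>rV\<close> offers no letter that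
  could be moved up.\<close>

lemma col_prec_eop_right:
  assumes "eop n i u = Some u'" "eps n i v \<le> phi n i u"
  shows "col_prec v u'"
proof -
  have u': "admissible n u'" "fop n i u' = Some u"
    using admissible_eop[OF uv(1) i assms(1)] assms eop_Some i by auto
  show ?thesis
  proof (cases "phi n i u = 0")
    case True
    then show ?thesis
      using dominates_raises_second[OF fop_sets(1)[OF u'(1) i u'(2)] i]
        col_prec_sets[OF uv(2,1)] col_prec_sets[OF uv(2) u'(1)] prec
        no_move_right[OF uv(2) i] assms(2) by simp
  next
    case False
    then show ?thesis
      using fop_sets(4)[OF u'(1) i u'(2)] prec
        col_prec_sets[OF uv(2,1)] col_prec_sets[OF uv(2) u'(1)] by simp
  qed
qed

end

text \<open>Only the inequality between neighbouring columns is wanted. The last conjunct keeps the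
  induction going: nothing to the right of \<open>u\<close> adds to \<open>eps\<close>, so the
  condition on the whole tail becomes a condition on \<open>u\<close>.\<close>

lemma fop_concat:
  assumes "fop n i (concat g) = Some w"
  shows "\<exists>g1 u u' g2. g = g1 @ u # g2 \<and> fop n i u = Some u' \<and> w = concat (g1 @ u' # g2) \<and>
    (g1 \<noteq> [] \<longrightarrow> phi n i (last g1) \<le> eps n i u) \<and> eps n i (concat g2) < phi n i u"
  using assms
proof (induction g arbitrary: w)
  case (Cons x g)
  show ?case
  proof (cases "phi n i x > eps n i (concat g)")
    case True
    with Cons.prems obtain x' where x': "fop n i x = Some x'" "w = x' @ concat g"
      by (auto simp: fop_append)
    with True show ?thesis
      by (intro exI[of _ "[]"] exI[of _ x] exI[of _ x'] exI[of _ g]) simp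
  next
    case False
    with Cons.prems obtain w' where w': "fop n i (concat g) = Some w'" "w = x @ w'"
      by (auto simp: fop_append)
    from Cons.IH[OF this(1)] obtain g1 u u' g2 where g: "g = g1 @ u # g2" "fop n i u = Some u'"
      "w' = concat (g1 @ u' # g2)" "g1 \<noteq> [] \<longrightarrow> phi n i (last g1) \<le> eps n i u"
      "eps n i (concat g2) < phi n i u"
      by blast
    have "phi n i (last (x # g1)) \<le> eps n i u"
      using g False by (cases g1) (auto simp: eps_append)
    with g w'(2) show ?thesis
      by (intro exI[of _ "x # g1"] exI[of _ u] exI[of _ u'] exI[of _ g2]) simp
  qed
qed simp

lemma eop_concat:
  assumes "eop n i (concat g) = Some w"
  shows "\<exists>g1 u u' g2. g = g1 @ u # g2 \<and> eop n i u = Some u' \<and> w = concat (g1 @ u' # g2) \<and>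
    (g2 \<noteq> [] \<longrightarrow> eps n i (hd g2) \<le> phi n i u)"
  using assms
proof (induction g arbitrary: w)
  case (Cons x g)
  show ?case
  proof (cases "eps n i (concat g) > phi n i x")
    case True
    with Cons.prems obtain w' where w': "eop n i (concat g) = Some w'" "w = x @ w'"
      by (auto simp: eop_append)
    from Cons.IH[OF this(1)] obtain g1 u u' g2 where g: "g = g1 @ u # g2" "eop n i u = Some u'"
      "w' = concat (g1 @ u' # g2)" "g2 \<noteq> [] \<longrightarrow> eps n i (hd g2) \<le> phi n i u"
      by blast
    with w'(2) show ?thesis
      by (intro exI[of _ "x # g1"] exI[of _ u] exI[of _ u'] exI[of _ g2]) simp
  next
    case False
    with Cons.prems obtain x' where x': "eop n i x = Some x'" "w = x' @ concat g"
      by (auto simp: eop_append)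
    have "eps n i (hd g) \<le> phi n i x" if "g \<noteq> []"
      using False that by (cases g) (auto simp: eps_append)
    with x' show ?thesis
      by (intro exI[of _ "[]"] exI[of _ x] exI[of _ x'] exI[of _ g]) simp
  qed
qed simp

lemma admissible_columns_step:
  assumes "u \<in> admissible_columns n" "i \<in> {1..n}" "fop n i u = Some u' \<or> eop n i u = Some u'"
  shows "u' \<in> admissible_columns n" "length u' = length u"
proof -
  have l: "length u' = length u"
    using assms(3) fop_length eop_Some[of n i u u'] assms(2) by (metis atLeastAtMost_iff)
  then show "length u' = length u" .
  then have "u' \<noteq> []"
    using assms(1) by (auto simp: admissible_columns_def)
  moreover have "admissible n u'"
    using assms(1,3) admissible_fop[OF _ assms(2)] admissible_eop[OF _ assms(2)]
    unfolding admissible_columns_def by blast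
  ultimately show "u' \<in> admissible_columns n"
    by (simp add: admissible_columns_def)
qed

lemma tableau_word_replace:
  assumes "tableau_word n (g1 @ u # g2)" "u' \<in> admissible_columns n"
    and "g1 \<noteq> [] \<Longrightarrow> col_prec u (last g1) \<Longrightarrow> col_prec u' (last g1)"
    and "g2 \<noteq> [] \<Longrightarrow> col_prec (hd g2) u \<Longrightarrow> col_prec (hd g2) u'"
  shows "tableau_word n (g1 @ u' # g2)"
  using assms by (auto simp: tableau_word_def successively_append_iff successively_Cons)

lemma tableau_word_fop:
  assumes "tableau_word n g" "i \<in> {1..n}" "fop n i (concat g) = Some w"
  shows "\<exists>g'. w = concat g' \<and> tableau_word n g' \<and> map length g' = map length g"
proof -
  from fop_concat[OF assms(3)] obtain g1 u u' g2 where g: "g = g1 @ u # g2" "fop n i u = Some u'"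
    "w = concat (g1 @ u' # g2)" "g1 \<noteq> [] \<longrightarrow> phi n i (last g1) \<le> eps n i u"
    by blast
  have adm: "x \<in> set g \<Longrightarrow> admissible n x" "u \<in> admissible_columns n" for x
    using assms(1) g(1) by (auto simp: tableau_word_def admissible_columns_def)
  have u: "admissible n u"
    using adm g(1) by auto
  note u' = admissible_columns_step[OF adm(2) assms(2) disjI1[OF g(2)]]
  have "tableau_word n (g1 @ u' # g2)"
  proof (rule tableau_word_replace)
    show "tableau_word n (g1 @ u # g2)"
      using assms(1) g(1) by simp
    show "col_prec u' (last g1)" if "g1 \<noteq> []" "col_prec u (last g1)"
      using col_prec_fop_left[OF _ u assms(2) that(2) g(2)] that(1) g(1,4) adm(1)[of "last g1"] by simp
    show "col_prec (hd g2) u'" if "g2 \<noteq> []" "col_prec (hd g2) u"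
      using col_prec_fop_right[OF u _ assms(2) that(2) g(2)] that(1) g(1) adm(1)[of "hd g2"] by simp
  qed (rule u'(1))
  with g u' show ?thesis
    by (intro exI[of _ "g1 @ u' # g2"]) simp
qed

lemma tableau_word_eop:
  assumes "tableau_word n g" "i \<in> {1..n}" "eop n i (concat g) = Some w"
  shows "\<exists>g'. w = concat g' \<and> tableau_word n g' \<and> map length g' = map length g"
proof -
  from eop_concat[OF assms(3)] obtain g1 u u' g2 where g: "g = g1 @ u # g2" "eop n i u = Some u'"
    "w = concat (g1 @ u' # g2)" "g2 \<noteq> [] \<longrightarrow> eps n i (hd g2) \<le> phi n i u"
    by blast
  have adm: "x \<in> set g \<Longrightarrow> admissible n x" "u \<in> admissible_columns n" for x
    using assms(1) g(1) by (auto simp: tableau_word_def admissible_columns_def)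
  have u: "admissible n u"
    using adm g(1) by auto
  note u' = admissible_columns_step[OF adm(2) assms(2) disjI2[OF g(2)]]
  have "tableau_word n (g1 @ u' # g2)"
  proof (rule tableau_word_replace)
    show "tableau_word n (g1 @ u # g2)"
      using assms(1) g(1) by simp
    show "col_prec u' (last g1)" if "g1 \<noteq> []" "col_prec u (last g1)"
      using col_prec_eop_left[OF _ u assms(2) that(2) g(2)] that(1) g(1) adm(1)[of "last g1"] by simp
    show "col_prec (hd g2) u'" if "g2 \<noteq> []" "col_prec (hd g2) u"
      using col_prec_eop_right[OF u _ assms(2) that(2) g(2)] that(1) g(1,4) adm(1)[of "hd g2"] by simp
  qed (rule u'(1))
  with g u' show ?thesis
    by (intro exI[of _ "g1 @ u' # g2"]) simp
qed

section \<open>Highest weight tableaux\<close>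

definition initial_col :: "nat \<Rightarrow> letter list" where
  "initial_col k = map Unbarred [1..<Suc k]"

text \<open>\<open>ks\<close> lists the column heights in reading order, from the right of the
  tableau to the left; for a tableau it is therefore increasing.\<close>

definition yamanouchi :: "nat list \<Rightarrow> letter list" where
  "yamanouchi ks = concat (map initial_col ks)"

lemma initial_col_simps [simp]:
  "initial_col 0 = []" "initial_col (Suc k) = initial_col k @ [Unbarred (Suc k)]"
  "length (initial_col k) = k" "set (initial_col k) = Unbarred ` {1..k}"
  by (auto simp: initial_col_def)

lemma yamanouchi_simps [simp]:
  "yamanouchi [] = []" "yamanouchi (k # ks) = initial_col k @ yamanouchi ks"
  "yamanouchi (ks @ ks') = yamanouchi ks @ yamanouchi ks'"
  by (simp_all add: yamanouchi_def)

lemma wt_initial_col: "wt j (initial_col k) = (if 1 \<le> j \<and> j \<le> k then 1 else 0)"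
  by (induction k) (auto simp: wt_singleton)

lemma wt_yamanouchi: "1 \<le> j \<Longrightarrow> wt j (yamanouchi ks) = int (length (filter (\<lambda>k. j \<le> k) ks))"
  by (induction ks) (auto simp: wt_initial_col)

lemma pend_unpaired:
  assumes "\<And>m. \<not> paired_at A m"
  shows "pend n A m = 0"
proof -
  have "foldr (pend_step A) xs 0 = 0" for xs
    using assms by (induction xs) (auto simp: pend_step_def)
  then show ?thesis
    by (simp add: pend_def)
qed

lemma unpaired_left_right:
  assumes "\<And>m. \<not> paired_at A m"
  shows "left_set n A = A" "right_set n A = A"
  using assms
  by (auto intro!: letter_set_eqI simp: left_right_set_iff pend_unpaired paired_at_def)

lemma initial_sets:
  "left_set n (Unbarred ` {Suc 0..k}) = Unbarred ` {Suc 0..k}"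
  "right_set n (Unbarred ` {Suc 0..k}) = Unbarred ` {Suc 0..k}"
  "pend n (Unbarred ` {Suc 0..k}) m = 0"
proof -
  have "\<not> paired_at (Unbarred ` {Suc 0..k}) m" for m
    by (auto simp: paired_at_def)
  then show "left_set n (Unbarred ` {Suc 0..k}) = Unbarred ` {Suc 0..k}"
    "right_set n (Unbarred ` {Suc 0..k}) = Unbarred ` {Suc 0..k}"
    "pend n (Unbarred ` {Suc 0..k}) m = 0"
    by (simp_all add: unpaired_left_right pend_unpaired)
qed

lemma sorted_initial_col: "sorted_wrt (<) (initial_col k)"
  by (auto simp: initial_col_def sorted_wrt_map simp del: upt_Suc)

lemma admissible_initial_col: "k \<le> n \<Longrightarrow> admissible n (initial_col k)"
  by (auto simp: admissible_iff is_column_def initial_sets sorted_initial_col)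

lemma col_prec_initial:
  assumes "j \<le> k" "k \<le> n"
  shows "col_prec (initial_col k) (initial_col j)"
proof -
  have "card {b \<in> Unbarred ` {1..j}. b \<le> x} \<le> card {a \<in> Unbarred ` {1..k}. a \<le> x}" for x
    using assms by (intro card_mono) auto
  then show ?thesis
    using assms by (subst col_prec_iff[OF admissible_initial_col admissible_initial_col])
      (auto simp: initial_sets dominates_def)
qed

lemma tableau_word_initial:
  assumes "sorted ks" "set ks \<subseteq> {1..n}"
  shows "tableau_word n (map initial_col ks)"
proof -
  have "initial_col k \<in> admissible_columns n" if "k \<in> {1..n}" for k
  proof -
    have "length (initial_col k) \<noteq> 0" using that by simp
    then show ?thesis
      using that admissible_initial_col by (auto simp: admissible_columns_def simp del: initial_col_simps)
  qed
  moreover have "successively (\<lambda>u v. col_prec v u) (map initial_col ks)"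
    using assms
  proof (induction ks)
    case (Cons k ks)
    then show ?case
      by (cases ks) (auto intro!: col_prec_initial simp: successively_Cons simp del: initial_col_simps)
  qed simp
  ultimately show ?thesis
    using assms(2) by (auto simp: tableau_word_def simp del: initial_col_simps)
qed

text \<open>The j-th weight entry is the number of columns of height at least j (the conjugate
  partition); differences of consecutive entries give the multiplicity of each height.\<close>

lemma yamanouchi_inject:
  assumes "sorted ks" "sorted ks'" "set ks \<subseteq> {1..n}" "set ks' \<subseteq> {1..n}"
    and eq: "weight n (yamanouchi ks) = weight n (yamanouchi ks')"
  shows "ks = ks'"
proof -
  have len: "length (filter (\<lambda>k. j \<le> k) ks) = length (filter (\<lambda>k. j \<le> k) ks')" if "1 \<le> j" for j
  proof (cases "j \<le> n")
    case True
    then have "wt j (yamanouchi ks) = wt j (yamanouchi ks')"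
      using eq that by (simp add: weight_eq_iff)
    then show ?thesis
      using that by (simp add: wt_yamanouchi)
  next
    case False
    then have "filter (\<lambda>k. j \<le> k) ks = []" "filter (\<lambda>k. j \<le> k) ks' = []"
      using assms(3,4) by (auto simp: filter_empty_conv)
    then show ?thesis by simp
  qed
  have split: "length (filter (\<lambda>k. j \<le> k) xs) = count (mset xs) j + length (filter (\<lambda>k. Suc j \<le> k) xs)" for j xs
    by (induction xs) auto
  have "count (mset ks) j = count (mset ks') j" for j
  proof (cases "j = 0")
    case True
    then have "j \<notin> set ks" "j \<notin> set ks'" using assms(3,4) by auto
    then show ?thesis by (simp add: count_eq_zero_iff[THEN iffD2])
  next
    case False
    then show ?thesis
      using len[of j] len[of "Suc j"] split[of j ks] split[of j ks'] by simp
  qed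
  then have "mset ks = mset ks'"
    by (rule multiset_eqI)
  then show ?thesis
    using assms(1,2) properties_for_sort sorted_sort_id by metis
qed

text \<open>The letters 1, ..., m already exhaust the bound N(m) <= m.\<close>

lemma admissible_initial_prefix:
  assumes adm: "admissible n v" and sub: "Unbarred ` {1..m} \<subseteq> set v" and j: "1 \<le> j" "j \<le> m"
  shows "Bar j \<notin> set v"
proof
  assume bar: "Bar j \<in> set v"
  have "v \<in> lists (alphabet n)"
    using adm by (auto simp: admissible_def is_column_def)
  moreover have "Unbarred m \<in> set v"
    using sub j by auto
  ultimately have "m \<in> {1..n}"
    using j by auto
  then have "excess (set v) m \<le> 0"
    using adm by (simp add: admissible_iff pend_0_iff)
  moreover have "1 \<le> excess (set v) m"
  proof -
    let ?f = "\<lambda>j. of_bool (Unbarred j \<in> set v) + of_bool (Bar j \<in> set v) - (1 :: int)"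
    have pos: "0 \<le> ?f k" if "k \<in> {1..m}" for k
      using that sub by auto
    have "1 \<le> ?f j"
      using bar sub j by auto
    also have "?f j \<le> sum ?f {1..m}"
      by (rule member_le_sum) (use pos j in auto)
    finally show ?thesis by (simp only: excess_def)
  qed
  ultimately show False by simp
qed

text \<open>By the prefix property only the last column in reading order is new. It starts with a
  maximal run 1, ..., m, and the weight of the prefix ending with the letter after this run would
  not be a partition, unless admissibility already forbids that letter.\<close>

lemma highest_tableau_word:
  assumes "tableau_word n g" "highest n (concat g)"
  shows "\<exists>ks. g = map initial_col ks \<and> sorted ks \<and> set ks \<subseteq> {1..n}"
  using assms
proof (induction g rule: rev_induct)
  case (snoc v g)
  have "tableau_word n g" and v: "admissible n v" "v \<noteq> []"
    and prec: "g \<noteq> [] \<Longrightarrow> col_prec v (last g)"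
    using snoc.prems(1)
    by (auto simp: tableau_word_def successively_append_iff admissible_columns_def)
  moreover have "highest n (concat g)"
    using snoc.prems(2) highest_append1[of n "concat g" v] by simp
  ultimately obtain ks where ks: "g = map initial_col ks" "sorted ks" "set ks \<subseteq> {1..n}"
    using snoc.IH by blast
  have vc: "v \<in> lists (alphabet n)" "sorted_wrt (<) v"
    using v(1) by (auto simp: admissible_def is_column_def)
  \<comment> \<open>Domination gives \<open>rV\<close> at least as many letters up to
    \<open>last ks\<close> as there are available, hence all of them; and the unbarred letters of
    \<open>rV\<close> are those of \<open>V\<close>.\<close>
  have ks_le: "Unbarred ` {1..k} \<subseteq> set v" if "k \<in> set ks" for k
  proof -
    let ?k = "last ks"
    have ne: "ks \<noteq> []" using that by auto
    have k: "k \<le> ?k" "?k \<in> {1..n}"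
    proof -
      show "?k \<in> {1..n}"
        using last_in_set[OF ne] ks(3) by blast
      have "sorted (butlast ks @ [?k])" "k \<in> set (butlast ks @ [?k])"
        using ks(2) that ne by simp_all
      then show "k \<le> ?k"
        by (auto simp: sorted_append simp del: append_butlast_last_id)
    qed
    have "col_prec v (initial_col ?k)"
      using prec ks(1) ne by (simp add: last_map)
    then have "dominates n (right_set n (set v)) (Unbarred ` {1..?k})"
      using col_prec_iff[OF v(1) admissible_initial_col[of ?k n]] k
      by (simp add: initial_sets)
    then have "card {b \<in> Unbarred ` {1..?k}. b \<le> Unbarred ?k} \<le>
      card {a \<in> right_set n (set v). a \<le> Unbarred ?k}"
      using k by (simp add: dominates_def)
    also have "{b \<in> Unbarred ` {1..?k}. b \<le> Unbarred ?k} = Unbarred ` {1..?k}"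
      by auto
    finally have le: "?k \<le> card {a \<in> right_set n (set v). a \<le> Unbarred ?k}"
      by (simp add: card_image inj_on_def)
    have "right_set n (set v) \<subseteq> alphabet n"
      using vc(1) by (intro right_set_alphabet) auto
    then have sub: "{a \<in> right_set n (set v). a \<le> Unbarred ?k} \<subseteq> Unbarred ` {1..?k}"
      by (auto simp: alphabet_def)
    have "{a \<in> right_set n (set v). a \<le> Unbarred ?k} = Unbarred ` {1..?k}"
      by (rule card_seteq[OF _ sub]) (use le in \<open>simp_all add: card_image inj_on_def\<close>)
    then have "Unbarred ` {1..?k} \<subseteq> right_set n (set v)"
      by blast
    then have "Unbarred j \<in> set v" if "j \<in> {1..?k}" for j
      using that left_right_set_iff(3)[of j n "set v"] by blast
    with k show ?thesis
      by auto
  qed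
  define m where "m = (LEAST m. Unbarred (Suc m) \<notin> set v)"
  have "Unbarred (Suc n) \<notin> set v"
    using vc(1) by auto
  then have m: "Unbarred (Suc m) \<notin> set v"
    unfolding m_def by (rule LeastI)
  have "Unbarred (Suc j) \<in> set v" if "j < m" for j
    using that not_less_Least unfolding m_def by blast
  then have m_sub: "Unbarred ` {1..m} \<subseteq> set v"
    by (force simp: image_subset_iff gr0_conv_Suc Suc_le_eq)
  have ks_m: "k \<le> m" if "k \<in> set ks" for k
  proof (rule ccontr)
    assume "\<not> k \<le> m"
    then have "Unbarred (Suc m) \<in> Unbarred ` {1..k}" by auto
    then show False
      using ks_le[OF that] m by blast
  qed
  define rest where "rest = col (set v - Unbarred ` {1..m})"
  have v_eq: "v = initial_col m @ rest"
  proof (rule strict_sorted_equal)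
    have "Unbarred j < y" if "y \<in> set v" "y \<notin> Unbarred ` {1..m}" "j \<le> m" for y j
    proof -
      have "y \<in> alphabet n" using that(1) vc(1) by blast
      then show ?thesis
        using that(2,3) by (cases y) (auto simp: image_iff)
    qed
    then show "sorted_wrt (<) (initial_col m @ rest)"
      by (auto simp: rest_def sorted_wrt_append sorted_initial_col)
  qed (use vc m_sub in \<open>auto simp: rest_def\<close>)
  have "rest = []"
  proof (rule ccontr)
    assume "rest \<noteq> []"
    then obtain x xs where x: "rest = x # xs"
      by (cases rest) auto
    have xv: "x \<in> set v" "x \<notin> Unbarred ` {1..m}" "x \<in> alphabet n"
    proof -
      have "x \<in> set rest" using x by simp
      then show "x \<in> set v" "x \<notin> Unbarred ` {1..m}"
        by (auto simp: rest_def)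
      with vc(1) show "x \<in> alphabet n" by auto
    qed
    \<comment> \<open>All columns so far have height at most \<open>m\<close>, so weight entries
      beyond \<open>m\<close> come from \<open>x\<close> alone. As \<open>x\<close> is not
      \<open>Suc m\<close>, an unbarred \<open>x\<close> breaks monotonicity; a bar beyond
      \<open>m\<close> gives a negative entry.\<close>
    let ?w = "yamanouchi (ks @ [m]) @ [x]"
    have "concat (g @ [v]) = ?w @ xs"
      by (simp add: v_eq x ks(1) yamanouchi_def)
    then have hw: "highest n ?w"
      using snoc.prems(2) highest_append1 by metis
    have wt0: "wt j (yamanouchi (ks @ [m])) = 0" if "m < j" for j
      using that ks_m by (subst wt_yamanouchi) (fastforce simp: filter_empty_conv)+
    show False
    proof (cases x)
      case (Unbarred j)
      with xv m have j: "Suc m < j" "j \<le> n"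
        by (auto simp: image_iff) (metis not_less_eq_eq le_antisym not_less Suc_leI)+
      then have "wt j ?w = 1" "wt (j - 1) ?w = 0"
        using wt0[of j] wt0[of "j - 1"] Unbarred by (auto simp: wt_singleton)
      moreover have "wt (Suc (j - 1)) ?w \<le> wt (j - 1) ?w"
        by (rule highest_wt(1)[OF hw]) (use j in auto)
      ultimately show False
        using j by simp
    next
      case (Bar j)
      with xv have j: "j \<in> {1..n}" by auto
      show False
      proof (cases "j \<le> m")
        case True
        then show False
          using admissible_initial_prefix[OF v(1) m_sub, of j] Bar xv j by auto
      next
        case False
        then have "wt j ?w = -1"
          using wt0[of j] Bar by (auto simp: wt_singleton)
        then show False
          using highest_wt_nonneg[OF hw j] by simp
      qed
    qed
  qed
  then have "v = initial_col m"
    using v_eq by simp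
  moreover from this v(2) vc(1) have "m \<in> {1..n}"
    by (cases m) auto
  ultimately show ?case
    using ks ks_m by (intro exI[of _ "ks @ [m]"]) (auto simp: sorted_append)
qed simp

section \<open>Contraction\<close>

text \<open>
  Inverting the contraction relation: among the free letters that are not needed as partners,
  the smallest one is inserted together with its bar. This commutes with the crystal operators,
  since \<open>f\<^sub>i\<close> at most exchanges \<open>i\<close> and \<open>i + 1\<close> in the set of such letters.
\<close>

definition unmatched :: "nat \<Rightarrow> letter set \<Rightarrow> nat set" where
  "unmatched n A = {m \<in> {1..n}. free_at A m \<and> pend n A m = 0}"

definition insert_pair :: "nat \<Rightarrow> letter set \<Rightarrow> letter set" where
  "insert_pair n A = A \<union> {Unbarred (Min (unmatched n A)), Bar (Min (unmatched n A))}"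

lemma finite_unmatched: "finite (unmatched n A)"
  by (simp add: unmatched_def)

lemma Min_unmatched: "unmatched n A \<noteq> {} \<Longrightarrow> Min (unmatched n A) \<in> unmatched n A"
  using finite_unmatched by (rule Min_in)

lemma insert_pair_alphabet:
  "A \<subseteq> alphabet n \<Longrightarrow> unmatched n A \<noteq> {} \<Longrightarrow> insert_pair n A \<subseteq> alphabet n"
  using Min_unmatched[of n A] by (auto simp: insert_pair_def unmatched_def)

lemma down_unmatched:
  assumes d: "down n i A B" and i: "i \<in> {1..n}"
  shows "unmatched n B = unmatched n A \<and> i \<notin> unmatched n A \<and> (i < n \<longrightarrow> Suc i \<notin> unmatched n A) \<or>
    i < n \<and> i \<in> unmatched n A \<and> Suc i \<notin> unmatched n A \<and>
      unmatched n B = unmatched n A - {i} \<union> {Suc i} \<or>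
    i < n \<and> i \<notin> unmatched n A \<and> Suc i \<in> unmatched n A \<and>
      unmatched n B = unmatched n A - {Suc i} \<union> {i}"
proof (cases "i < n")
  case True
  have i1: "1 \<le> i" using i by simp
  define c where "c = pend n A (Suc i)"
  have c: "pend n B (Suc i) = c"
    using down_pend[OF d i, of "Suc i"] by (simp add: c_def)
  have pi: "pend n A i = pend_step A (Suc i) c" "pend n B i = pend_step B (Suc i) c"
    using True c by (simp_all add: c_def pend_rec)
  note um = unmatched_def free_at_def paired_at_def pend_step_def
  have out: "k \<in> unmatched n A \<longleftrightarrow> k \<in> unmatched n B" if "k \<noteq> i" "k \<noteq> Suc i" for k
    using d that True down_pend[OF d i that(1)] by (auto simp: down_def um)
  have dc: "Unbarred i \<in> A \<and> Unbarred (Suc i) \<notin> A \<and> (Bar (Suc i) \<in> A \<or> Bar i \<notin> A) \<and>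
      Unbarred i \<notin> B \<and> Unbarred (Suc i) \<in> B \<and> (Bar i \<in> B \<longleftrightarrow> Bar i \<in> A) \<and>
      (Bar (Suc i) \<in> B \<longleftrightarrow> Bar (Suc i) \<in> A) \<or>
    Bar (Suc i) \<in> A \<and> Bar i \<notin> A \<and> \<not> (Unbarred i \<in> A \<and> Unbarred (Suc i) \<notin> A) \<and>
      Bar (Suc i) \<notin> B \<and> Bar i \<in> B \<and> (Unbarred i \<in> B \<longleftrightarrow> Unbarred i \<in> A) \<and>
      (Unbarred (Suc i) \<in> B \<longleftrightarrow> Unbarred (Suc i) \<in> A)"
    using d True by (auto simp: down_def)
  have "i \<in> unmatched n A \<longleftrightarrow> Suc i \<in> unmatched n B" "Suc i \<in> unmatched n A \<longleftrightarrow> i \<in> unmatched n B"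
    "\<not> (i \<in> unmatched n A \<and> Suc i \<in> unmatched n A)"
    using dc i1 True by (auto simp: um pi c c_def[symmetric])
  note e = this
  have V: "k \<in> unmatched n B \<longleftrightarrow>
    (if k = i then Suc i \<in> unmatched n A else if k = Suc i then i \<in> unmatched n A else k \<in> unmatched n A)" for k
    using out[of k] e(1,2) by auto
  consider "i \<notin> unmatched n A" "Suc i \<notin> unmatched n A" | "i \<in> unmatched n A" "Suc i \<notin> unmatched n A"
    | "i \<notin> unmatched n A" "Suc i \<in> unmatched n A"
    using e(3) by blast
  then show ?thesis
  proof cases
    case 1
    then have "unmatched n B = unmatched n A"
      by (intro Set.set_eqI) (simp add: V)
    with 1 show ?thesis by blast
  next
    case 2
    then have "unmatched n B = unmatched n A - {i} \<union> {Suc i}"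
      by (intro Set.set_eqI) (simp add: V)
    with 2 True show ?thesis by blast
  next
    case 3
    then have "unmatched n B = unmatched n A - {Suc i} \<union> {i}"
      by (intro Set.set_eqI) (simp add: V)
    with 3 True show ?thesis by blast
  qed
next
  case False
  with i have [simp]: "i = n" and n: "1 \<le> n" by auto
  have pe: "pend n A k = pend n B k" for k
    using down_pend[OF d i, of k] by (cases "k = n") (auto simp: pend_top)
  have "k \<in> unmatched n B \<longleftrightarrow> k \<in> unmatched n A" for k
    using d by (cases "k = n") (auto simp: down_def unmatched_def free_at_def pe)
  then show ?thesis
    using d by (auto simp: down_def unmatched_def free_at_def)
qed

text \<open>No element lies between \<open>i\<close> and \<open>i'\<close>, so the exchange keeps
  the relative order, and the minimum moves only if it is the exchanged element.\<close>

lemma Min_replace: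
  assumes "finite Z" "i \<in> Z" "i' \<notin> Z" "i' = Suc i \<or> i = Suc i'"
  shows "Min (Z - {i} \<union> {i'}) = (if Min Z = i then i' else Min Z)"
proof (rule Min_eqI)
  have m: "Min Z \<in> Z" "\<And>y. y \<in> Z \<Longrightarrow> Min Z \<le> y"
    using Min_in[OF assms(1)] Min_le[OF assms(1)] assms(2) by blast+
  show "finite (Z - {i} \<union> {i'})"
    using assms(1) by simp
  show "(if Min Z = i then i' else Min Z) \<in> Z - {i} \<union> {i'}"
    using m(1) by auto
  show "(if Min Z = i then i' else Min Z) \<le> y" if "y \<in> Z - {i} \<union> {i'}" for y
  proof (cases "y = i'")
    case True
    have "Min Z \<noteq> i'" using m(1) assms(3) by blast
    then show ?thesis
      using True m(2)[OF assms(2)] assms(4) by auto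
  next
    case False
    with that have y: "y \<in> Z" "y \<noteq> i" by auto
    then have "Min Z \<le> y" "y \<noteq> i'" using m(2) assms(3) by auto
    then show ?thesis using y assms(4) by auto
  qed
qed

lemma fop_insert_pair:
  assumes A: "A \<subseteq> alphabet n" and ne: "unmatched n A \<noteq> {}" and i: "i \<in> {1..n}"
  shows "down n i A B \<Longrightarrow> fop n i (col (insert_pair n A)) = Some (col (insert_pair n B))"
    and "fop n i (col A) = None \<Longrightarrow> fop n i (col (insert_pair n A)) = None"
proof -
  define z where "z = Min (unmatched n A)"
  have z: "z \<in> unmatched n A" "\<And>y. y \<in> unmatched n A \<Longrightarrow> z \<le> y"
    using Min_unmatched[OF ne] finite_unmatched by (auto simp: z_def)
  have zf: "Unbarred z \<notin> A" "Bar z \<notin> A" "pend n A z = 0" "1 \<le> z" "z \<le> n"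
    using z(1) by (auto simp: unmatched_def free_at_def)
  have P: "insert_pair n A = A \<union> {Unbarred z, Bar z}"
    by (simp add: insert_pair_def z_def)
  have Pa: "insert_pair n A \<subseteq> alphabet n"
    by (rule insert_pair_alphabet[OF A ne])
  have zB: "Min (unmatched n B) = (if z = i \<and> i < n then Suc i else if z = Suc i \<and> i < n then i else z)"
    if d: "down n i A B" for B
    using down_unmatched[OF d i]
  proof (elim disjE conjE)
    assume *: "unmatched n B = unmatched n A" "i \<notin> unmatched n A" "i < n \<longrightarrow> Suc i \<notin> unmatched n A"
    have "Min (unmatched n B) = z"
      by (simp only: *(1) z_def)
    moreover have "z \<noteq> i" "i < n \<Longrightarrow> z \<noteq> Suc i"
      using z(1) *(2,3) by blast+
    ultimately show ?thesis by auto
  next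
    assume *: "i < n" "i \<in> unmatched n A" "Suc i \<notin> unmatched n A"
      "unmatched n B = unmatched n A - {i} \<union> {Suc i}"
    then have "z \<noteq> Suc i" using z(1) by blast
    moreover have "Min (unmatched n B) = (if z = i then Suc i else z)"
      unfolding *(4) z_def by (rule Min_replace[OF finite_unmatched *(2,3)]) simp
    ultimately show ?thesis
      using *(1) by simp
  next
    assume *: "i < n" "i \<notin> unmatched n A" "Suc i \<in> unmatched n A"
      "unmatched n B = unmatched n A - {Suc i} \<union> {i}"
    then have "z \<noteq> i" using z(1) by blast
    moreover have "Min (unmatched n B) = (if z = Suc i then i else z)"
      unfolding *(4) z_def by (rule Min_replace[OF finite_unmatched *(3,2)]) simp
    ultimately show ?thesis
      using *(1) by simp
  qed
  have i1: "1 \<le> i" using i by simp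
  have pi: "pend n A i = pend_step A (Suc i) (pend n A (Suc i))" if "i < n"
    using that by (rule pend_rec)
  \<comment> \<open>Otherwise i would be free with counter 0, hence unmatched and smaller than the
    minimum \<open>z\<close>.\<close>
  have zi: "Bar i \<in> A \<or> Unbarred i \<in> A" if "z = Suc i" "i < n"
    using z(2)[of i] zf that i1 pi
    by (auto simp: unmatched_def free_at_def pend_step_def paired_at_def)
  \<comment> \<open>A pair at i + 1 would still be waiting at i, contrary to the counter being 0 at
    \<open>z\<close>.\<close>
  have zi': "\<not> (Unbarred (Suc i) \<in> A \<and> Bar (Suc i) \<in> A)" if "z = i" "i < n"
    using zf that pi by (auto simp: pend_step_def paired_at_def)
  show "fop n i (col (insert_pair n A)) = Some (col (insert_pair n B))" if d: "down n i A B"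
  proof (cases "i < n")
    case True
    have PB: "insert_pair n B =
      B \<union> (if z = i then {Unbarred (Suc i), Bar (Suc i)} else if z = Suc i then {Unbarred i, Bar i}
        else {Unbarred z, Bar z})"
      using zB[OF d] True by (auto simp: insert_pair_def)
    consider "z = i" | "z = Suc i" | "z \<noteq> i" "z \<noteq> Suc i" by blast
    then show ?thesis
    proof cases
      \<comment> \<open>Different letters move in the two columns: the bar of i + 1 in
        \<open>A\<close>, but the inserted letter i in the larger column. The results agree because
        the inserted pair has shifted from i to i + 1.\<close>
      case 1
      then have m: "Bar (Suc i) \<in> A" "Unbarred (Suc i) \<notin> A" "Bar i \<notin> A" "Unbarred i \<notin> A"
        and B: "B = A - {Bar (Suc i)} \<union> {Bar i}"
        using d zf zi' True by (auto simp: down_def)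
      have "insert_pair n B = B \<union> {Unbarred (Suc i), Bar (Suc i)}"
        using PB 1 by simp
      also have "\<dots> = insert_pair n A - {Unbarred i} \<union> {Unbarred (Suc i)}"
        unfolding B P 1 using m by auto
      finally have "insert_pair n A - {Unbarred i} \<union> {Unbarred (Suc i)} = insert_pair n B" ..
      moreover have "Unbarred i \<in> insert_pair n A \<and> Unbarred (Suc i) \<notin> insert_pair n A \<and>
        Bar (Suc i) \<in> insert_pair n A"
        unfolding P 1 using m by auto
      ultimately show ?thesis
        using col_ops_below(3)[OF Pa True i1] by simp
    next
      case 2
      then have m: "Bar (Suc i) \<notin> A" "Unbarred (Suc i) \<notin> A" "Bar i \<notin> A" "Unbarred i \<in> A"
        and B: "B = A - {Unbarred i} \<union> {Unbarred (Suc i)}"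
        using d zf zi True by (auto simp: down_def)
      have "insert_pair n B = B \<union> {Unbarred i, Bar i}"
        using PB 2 by simp
      also have "\<dots> = insert_pair n A - {Bar (Suc i)} \<union> {Bar i}"
        unfolding B P 2 using m by auto
      finally have "insert_pair n A - {Bar (Suc i)} \<union> {Bar i} = insert_pair n B" ..
      moreover have "Unbarred (Suc i) \<in> insert_pair n A" "Bar (Suc i) \<in> insert_pair n A"
        "Bar i \<notin> insert_pair n A"
        unfolding P 2 using m by auto
      ultimately show ?thesis
        using col_ops_below(3)[OF Pa True i1] by simp
    next
      case 3
      have m: "Unbarred i \<in> insert_pair n A \<longleftrightarrow> Unbarred i \<in> A" "Unbarred (Suc i) \<in> insert_pair n A \<longleftrightarrow> Unbarred (Suc i) \<in> A"
        "Bar i \<in> insert_pair n A \<longleftrightarrow> Bar i \<in> A" "Bar (Suc i) \<in> insert_pair n A \<longleftrightarrow> Bar (Suc i) \<in> A"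
        using 3 by (auto simp: P)
      have e: "insert_pair n A - {Unbarred i} \<union> {Unbarred (Suc i)} = A - {Unbarred i} \<union> {Unbarred (Suc i)} \<union> {Unbarred z, Bar z}"
        "insert_pair n A - {Bar (Suc i)} \<union> {Bar i} = A - {Bar (Suc i)} \<union> {Bar i} \<union> {Unbarred z, Bar z}"
        using 3 by (auto simp: P)
      have "insert_pair n B = B \<union> {Unbarred z, Bar z}"
        using 3 by (simp add: PB)
      then show ?thesis
        using d True unfolding col_ops_below(3)[OF Pa True i1] m e by (auto simp: down_def)
    qed
  next
    case False
    with i have [simp]: "i = n" and n: "1 \<le> n" by auto
    have "z \<noteq> n"
      using d zf by (auto simp: down_def)
    moreover have "insert_pair n B = B \<union> {Unbarred z, Bar z}"
      using zB[OF d] by (simp add: insert_pair_def)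
    moreover have "Unbarred n \<in> A" "Bar n \<notin> A" "B = A - {Unbarred n} \<union> {Bar n}"
      using d by (auto simp: down_def)
    ultimately have "insert_pair n A - {Unbarred n} \<union> {Bar n} = insert_pair n B"
      "Unbarred n \<in> insert_pair n A \<and> Bar n \<notin> insert_pair n A"
      by (auto simp: P)
    then show ?thesis
      using col_ops_top(3)[OF Pa n] by simp
  qed
  show "fop n i (col (insert_pair n A)) = None" if none: "fop n i (col A) = None"
  proof (cases "i < n")
    case True
    show ?thesis
      using none zf zi zi' True unfolding col_ops_below(3)[OF Pa True i1] col_ops_below(3)[OF A True i1]
      by (cases "z = i"; cases "z = Suc i") (auto simp: P split: if_splits)
  next
    case False
    with i have [simp]: "i = n" and n: "1 \<le> n" by auto
    show ?thesis
      using none unfolding \<open>i = n\<close> col_ops_top(3)[OF Pa n] col_ops_top(3)[OF A n]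
      by (auto simp: P split: if_splits)
  qed
qed

lemma wt_col:
  assumes "finite A"
  shows "wt j (col A) = of_bool (Unbarred j \<in> A) - of_bool (Bar j \<in> A)"
proof -
  have "count_list xs x = of_bool (x \<in> set xs)" if "distinct xs" for xs and x :: letter
    using that by (induction xs) auto
  then show ?thesis
    using assms by (simp add: wt_def)
qed

text \<open>The domain consists of admissible columns, whose highest weight words are initial
  columns, separated by their weights. The enlarged columns need not be admissible.\<close>

lemma insert_pair_plactic:
  assumes A: "A \<subseteq> alphabet n" "pend n A 0 = 0" "unmatched n A \<noteq> {}"
  shows "(col A, col (insert_pair n A)) \<in> plactic_rel n"
proof -
  define S where "S = {col A | A. A \<subseteq> alphabet n \<and> pend n A 0 = 0 \<and> unmatched n A \<noteq> {}}"
  define h where "h w = col (insert_pair n (set w))" for w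
  have fin: "finite A" if "A \<subseteq> alphabet n" for A
    using finite_subset[OF that finite_alphabet] .
  have h: "h (col A) = col (insert_pair n A)" if "A \<subseteq> alphabet n" for A
    using fin[OF that] by (simp add: h_def)
  have nonempty: "unmatched n A \<noteq> {} \<longleftrightarrow> unmatched n B \<noteq> {}" if "down n i A B" "i \<in> {1..n}" for i A B
    using down_unmatched[OF that] by auto
  have pend: "pend n A 0 = pend n B 0" if "down n i A B" "i \<in> {1..n}" for i A B
    using down_pend[OF that, of 0] that(2) by simp
  have "(col A, h (col A)) \<in> plactic_rel n"
  proof (rule plactic_by_map[where S = S])
    show "S \<subseteq> lists (alphabet n)"
      using fin by (auto simp: S_def)
    show "col A \<in> S"
      using A by (auto simp: S_def)
    show "a = b" if "a \<in> S" "b \<in> S" "highest n a" "highest n b" "weight n a = weight n b" for a b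
    proof -
      have *: "\<exists>ks. a = yamanouchi ks \<and> sorted ks \<and> set ks \<subseteq> {1..n}"
        if aS: "a \<in> S" and ha: "highest n a" for a
      \<comment> \<open>Tableau columns are nonempty, so the empty word is treated apart; it occurs
        when the contracted word is the letter 1 followed by its bar.\<close>
      proof (cases "a = []")
        case True
        then show ?thesis by (intro exI[of _ "[]"]) simp
      next
        case False
        have "admissible n a"
          using aS admissible_col_iff by (auto simp: S_def)
        with False have "tableau_word n [a]"
          by (simp add: tableau_word_def admissible_columns_def)
        moreover have "highest n (concat [a])"
          using ha by simp
        ultimately have "\<exists>ks. [a] = map initial_col ks \<and> sorted ks \<and> set ks \<subseteq> {1..n}"
          by (rule highest_tableau_word)
        then obtain ks where ks: "[a] = map initial_col ks" "sorted ks" "set ks \<subseteq> {1..n}"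
          by metis
        then have "a = yamanouchi ks"
          unfolding yamanouchi_def by (metis append_Nil2 concat.simps)
        with ks show ?thesis by blast
      qed
      show ?thesis
        using *[OF that(1,3)] *[OF that(2,4)] that(5) yamanouchi_inject by metis
    qed
  next
    fix a assume "a \<in> S"
    then obtain X where X: "a = col X" "X \<subseteq> alphabet n" "pend n X 0 = 0" "unmatched n X \<noteq> {}"
      by (auto simp: S_def)
    have Pa: "insert_pair n X \<subseteq> alphabet n"
      by (rule insert_pair_alphabet[OF X(2,4)])
    show "h a \<in> lists (alphabet n)"
      using Pa fin[OF Pa] X(1) h[OF X(2)] by auto
    have "Unbarred (Min (unmatched n X)) \<notin> X" "Bar (Min (unmatched n X)) \<notin> X"
      using Min_unmatched[OF X(4)] by (auto simp: unmatched_def free_at_def)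
    then show "weight n (h a) = weight n a"
      unfolding X(1) h[OF X(2)] weight_eq_iff wt_col[OF fin[OF Pa]] wt_col[OF fin[OF X(2)]]
      by (auto simp: insert_pair_def)
    fix i assume i: "i \<in> {1..n}"
    show "fop n i (h a) = map_option h (fop n i a)"
    proof (cases "fop n i a")
      case None
      then show ?thesis
        using fop_insert_pair(2)[OF X(2,4) i] X(1) h[OF X(2)] by simp
    next
      case (Some w)
      then obtain B where B: "down n i X B" "w = col B" "B \<subseteq> alphabet n"
        using fop_col[OF X(2) i] X(1) by metis
      then show ?thesis
        using fop_insert_pair(1)[OF X(2,4) i B(1)] X(1) h[OF X(2)] h[OF B(3)] Some by simp
    qed
    show "b \<in> S" if fa: "fop n i a = Some b" for b
    proof -
      obtain B where B: "down n i X B" "b = col B" "B \<subseteq> alphabet n"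
        using fop_col[OF X(2) i fa[unfolded X(1)]] by metis
      have "pend n B 0 = 0" "unmatched n B \<noteq> {}"
        using X(3,4) nonempty[OF B(1) i] pend[OF B(1) i] by metis+
      with B(2,3) show ?thesis
        unfolding S_def by blast
    qed
    show "b \<in> S" if ea: "eop n i a = Some b" for b
    proof -
      obtain B where B: "down n i B X" "b = col B" "B \<subseteq> alphabet n"
        using eop_col[OF X(2) i ea[unfolded X(1)]] by metis
      have "pend n B 0 = 0" "unmatched n B \<noteq> {}"
        using X(3,4) nonempty[OF B(1) i] pend[OF B(1) i] by metis+
      with B(2,3) show ?thesis
        unfolding S_def by blast
    qed
  qed
  then show ?thesis
    using h[OF A(1)] by simp
qed

text \<open>Removing \<open>k\<close> from 1, ..., p leaves a column without pairs, so every free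
  index is unmatched. The free ones are \<open>k\<close> and those above \<open>p\<close>, and the
  smallest is \<open>k\<close>.\<close>

lemma contract_initial:
  assumes "1 \<le> k" "k \<le> p" "p \<le> n"
  shows "(initial_col p @ [Bar k], col (Unbarred ` ({1..p} - {k}))) \<in> plactic_rel n"
proof -
  let ?A = "Unbarred ` ({1..p} - {k})" and ?B = "Unbarred ` {1..p} \<union> {Bar k}"
  note [simp del] = One_nat_def
  have "\<not> paired_at ?A m" for m
    by (auto simp: paired_at_def)
  then have pend0: "pend n ?A m = 0" for m
    by (rule pend_unpaired)
  have um: "unmatched n ?A = insert k {p<..n}"
    using assms by (auto simp: unmatched_def free_at_def pend0)
  have "Min (unmatched n ?A) = k"
    unfolding um by (rule Min_eqI) (use assms in auto)
  then have "insert_pair n ?A = ?B"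
    using assms by (auto simp: insert_pair_def)
  moreover have "col ?B = initial_col p @ [Bar k]"
  proof (rule strict_sorted_equal)
    show "sorted_wrt (<) (initial_col p @ [Bar k])"
      by (auto simp: sorted_wrt_append sorted_initial_col)
    show "sorted_wrt (<) (col ?B)"
      by (rule strict_sorted_list_of_set)
    have "finite ?B" by simp
    then show "set (col ?B) = set (initial_col p @ [Bar k])"
      by (simp only: set_sorted_list_of_set set_append initial_col_simps list.set)
  qed
  moreover have "(col ?A, col (insert_pair n ?A)) \<in> plactic_rel n"
    by (rule insert_pair_plactic) (use assms in \<open>auto simp: um pend0\<close>)
  ultimately show ?thesis
    using plactic_sym by metis
qed

section \<open>The Knuth relations on words of length three\<close>

text \<open>
  Lecouvey's plactic relations of length three, as one map from the readings of tableaux with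
  columns of heights \<open>2\<close> and \<open>1\<close> (a letter followed by a column) to words consisting of a column
  followed by a letter. The branches producing the letters \<open>j - 1\<close> and \<open>Suc j\<close> are the relations
  without a counterpart in type A.
\<close>

fun knuth :: "letter list \<Rightarrow> letter list" where
  "knuth [a, Unbarred j, c] =
     (if c = Bar j then
        (if a \<le> c then [a, Bar (j - 1), Unbarred (j - 1)] else [Unbarred j, a, c])
      else if a < c then [a, c, Unbarred j]
      else if a = Bar j then [Unbarred (Suc j), Bar (Suc j), c]
      else [Unbarred j, a, c])"
| "knuth [a, Bar j, c] = (if a < c then [a, c, Bar j] else [Bar j, a, c])"
| "knuth w = w"

text \<open>Inequalities satisfied by the reading of a tableau with column heights 1 and 2, in the
  form needed for the case analysis. The excluded pair is the inadmissible column of height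
  2.\<close>

definition knuth_domain :: "nat \<Rightarrow> letter list \<Rightarrow> bool" where
  "knuth_domain n w \<longleftrightarrow> (\<exists>a b c. w = [a, b, c] \<and> {a, b, c} \<subseteq> alphabet n \<and> b \<le> a \<and> b < c \<and>
     \<not> (b = Unbarred 1 \<and> c = Bar 1))"

lemma fop_three:
  "fop n i [a, b, c] =
     (if letter_sign n i a = Some Plus \<and> (letter_sign n i b = Some Plus \<or>
        letter_sign n i b = None \<and> letter_sign n i c \<noteq> Some Minus)
      then Some [lower_letter n i a, b, c]
      else if letter_sign n i b = Some Plus \<and> letter_sign n i c \<noteq> Some Minus
      then Some [a, lower_letter n i b, c]
      else if letter_sign n i c = Some Plus then Some [a, b, lower_letter n i c] else None)"
  by (auto split: option.split sign.split)

lemma letter_sign_below: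
  assumes "i < n"
  shows "letter_sign n i (Unbarred i) = Some Plus" "letter_sign n i (Unbarred (Suc i)) = Some Minus"
    "letter_sign n i (Bar (Suc i)) = Some Plus" "letter_sign n i (Bar i) = Some Minus"
    "x < i \<Longrightarrow> letter_sign n i (Unbarred x) = None" "x < i \<Longrightarrow> letter_sign n i (Bar x) = None"
    "Suc i < x \<Longrightarrow> letter_sign n i (Unbarred x) = None" "Suc i < x \<Longrightarrow> letter_sign n i (Bar x) = None"
    "lower_letter n i (Unbarred i) = Unbarred (Suc i)" "lower_letter n i (Bar (Suc i)) = Bar i"
  using assms by (auto simp: letter_sign_def lower_letter_def)

lemma letter_sign_top:
  "letter_sign n n (Unbarred n) = Some Plus" "letter_sign n n (Bar n) = Some Minus"
  "x \<noteq> n \<Longrightarrow> letter_sign n n (Unbarred x) = None" "x \<noteq> n \<Longrightarrow> letter_sign n n (Bar x) = None"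
  "lower_letter n n a = Bar n"
  by (auto simp: letter_sign_def lower_letter_def)

lemma index_cases:
  fixes x i :: nat
  obtains "x = i" | "x = Suc i" | "x < i" | "Suc i < x"
  by linarith

text \<open>\<open>knuth\<close> may turn the middle index \<open>Suc y\<close> into
  \<open>y\<close> or \<open>Suc (Suc y)\<close>, so all three positions relative to i and i + 1
  have to be distinguished.\<close>

lemma middle_index_cases:
  fixes i y :: nat
  obtains "i = Suc y" | "y = i" | "i = Suc (Suc y)" | "y = Suc i" | "Suc (Suc y) < i" | "Suc i < y"
  by linarith

text \<open>The middle letter has index \<open>Suc y\<close>, which avoids the truncated subtraction in \<open>knuth\<close>.\<close>

lemma knuth_fop_UUU:
  assumes "Suc y \<le> x" "Suc y < z" "1 \<le> i" "i < n"
  shows "fop n i (knuth [Unbarred x, Unbarred (Suc y), Unbarred z]) = map_option knuth (fop n i [Unbarred x, Unbarred (Suc y), Unbarred z])"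
  using assms
  by (cases i y rule: middle_index_cases; cases x i rule: index_cases; cases z i rule: index_cases;
    simp add: fop_three letter_sign_below del: fop.simps)

lemma knuth_fop_top_UUU:
  assumes "Suc y \<le> x" "Suc y < z" "x \<le> n" "Suc y \<le> n" "z \<le> n"
  shows "fop n n (knuth [Unbarred x, Unbarred (Suc y), Unbarred z]) = map_option knuth (fop n n [Unbarred x, Unbarred (Suc y), Unbarred z])"
  using assms
  by (cases "n = Suc y"; cases "n = Suc (Suc y)"; cases "x = n"; cases "z = n";
    simp add: fop_three letter_sign_top del: fop.simps)

lemma knuth_fop_UUB:
  assumes "Suc y \<le> x" "\<not> (y = 0 \<and> z = 1)" "1 \<le> i" "i < n"
  shows "fop n i (knuth [Unbarred x, Unbarred (Suc y), Bar z]) = map_option knuth (fop n i [Unbarred x, Unbarred (Suc y), Bar z])"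
  using assms
  by (cases i y rule: middle_index_cases; cases x i rule: index_cases; cases z i rule: index_cases;
    simp add: fop_three letter_sign_below del: fop.simps)

lemma knuth_fop_top_UUB:
  assumes "Suc y \<le> x" "\<not> (y = 0 \<and> z = 1)" "x \<le> n" "Suc y \<le> n" "z \<le> n"
  shows "fop n n (knuth [Unbarred x, Unbarred (Suc y), Bar z]) = map_option knuth (fop n n [Unbarred x, Unbarred (Suc y), Bar z])"
  using assms
  by (cases "n = Suc y"; cases "n = Suc (Suc y)"; cases "x = n"; cases "z = n";
    simp add: fop_three letter_sign_top del: fop.simps)

lemma knuth_fop_BUU:
  assumes "Suc y < z" "1 \<le> i" "i < n"
  shows "fop n i (knuth [Bar x, Unbarred (Suc y), Unbarred z]) = map_option knuth (fop n i [Bar x, Unbarred (Suc y), Unbarred z])"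
  using assms
  by (cases i y rule: middle_index_cases; cases x i rule: index_cases; cases z i rule: index_cases;
    simp add: fop_three letter_sign_below del: fop.simps)

lemma knuth_fop_top_BUU:
  assumes "Suc y < z" "x \<le> n" "Suc y \<le> n" "z \<le> n"
  shows "fop n n (knuth [Bar x, Unbarred (Suc y), Unbarred z]) = map_option knuth (fop n n [Bar x, Unbarred (Suc y), Unbarred z])"
  using assms
  by (cases "n = Suc y"; cases "n = Suc (Suc y)"; cases "x = n"; cases "z = n";
    simp add: fop_three letter_sign_top del: fop.simps)

lemma knuth_fop_BUB:
  assumes "\<not> (y = 0 \<and> z = 1)" "1 \<le> i" "i < n"
  shows "fop n i (knuth [Bar x, Unbarred (Suc y), Bar z]) = map_option knuth (fop n i [Bar x, Unbarred (Suc y), Bar z])"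
  using assms
  by (cases i y rule: middle_index_cases; cases x i rule: index_cases; cases z i rule: index_cases;
    simp add: fop_three letter_sign_below del: fop.simps)

lemma knuth_fop_top_BUB:
  assumes "\<not> (y = 0 \<and> z = 1)" "x \<le> n" "Suc y \<le> n" "z \<le> n"
  shows "fop n n (knuth [Bar x, Unbarred (Suc y), Bar z]) = map_option knuth (fop n n [Bar x, Unbarred (Suc y), Bar z])"
  using assms
  by (cases "n = Suc y"; cases "n = Suc (Suc y)"; cases "x = n"; cases "z = n";
    simp add: fop_three letter_sign_top del: fop.simps)

lemma knuth_fop_BBB:
  assumes "x \<le> Suc y" "z < Suc y" "1 \<le> i" "i < n"
  shows "fop n i (knuth [Bar x, Bar (Suc y), Bar z]) = map_option knuth (fop n i [Bar x, Bar (Suc y), Bar z])"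
  using assms
  by (cases i y rule: middle_index_cases; cases x i rule: index_cases; cases z i rule: index_cases;
    simp add: fop_three letter_sign_below del: fop.simps)

lemma knuth_fop_top_BBB:
  assumes "x \<le> Suc y" "z < Suc y" "x \<le> n" "Suc y \<le> n" "z \<le> n"
  shows "fop n n (knuth [Bar x, Bar (Suc y), Bar z]) = map_option knuth (fop n n [Bar x, Bar (Suc y), Bar z])"
  using assms
  by (cases "n = Suc y"; cases "n = Suc (Suc y)"; cases "x = n"; cases "z = n";
    simp add: fop_three letter_sign_top del: fop.simps)

lemma knuth_domain_cases:
  assumes "knuth_domain n w"
  obtains (UUU) x y z where "w = [Unbarred x, Unbarred (Suc y), Unbarred z]" "Suc y \<le> x" "Suc y < z"
      "x \<le> n" "Suc y \<le> n" "z \<le> n" "1 \<le> x" "1 \<le> z"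
    | (UUB) x y z where "w = [Unbarred x, Unbarred (Suc y), Bar z]" "Suc y \<le> x" "\<not> (y = 0 \<and> z = 1)"
      "x \<le> n" "Suc y \<le> n" "z \<le> n" "1 \<le> x" "1 \<le> z"
    | (BUU) x y z where "w = [Bar x, Unbarred (Suc y), Unbarred z]" "Suc y < z"
      "x \<le> n" "Suc y \<le> n" "z \<le> n" "1 \<le> x" "1 \<le> z"
    | (BUB) x y z where "w = [Bar x, Unbarred (Suc y), Bar z]" "\<not> (y = 0 \<and> z = 1)"
      "x \<le> n" "Suc y \<le> n" "z \<le> n" "1 \<le> x" "1 \<le> z"
    | (BBB) x y z where "w = [Bar x, Bar (Suc y), Bar z]" "x \<le> Suc y" "z < Suc y"
      "x \<le> n" "Suc y \<le> n" "z \<le> n" "1 \<le> x" "1 \<le> z"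
proof -
  obtain a b c where w: "w = [a, b, c]" "{a, b, c} \<subseteq> alphabet n" "b \<le> a" "b < c"
    "\<not> (b = Unbarred 1 \<and> c = Bar 1)"
    using assms by (auto simp: knuth_domain_def)
  obtain x z where x: "a = Unbarred x \<or> a = Bar x" and z: "c = Unbarred z \<or> c = Bar z"
    by (metis letter.exhaust)
  obtain y where y: "b = Unbarred (Suc y) \<or> b = Bar (Suc y)"
  proof -
    obtain k where k: "b = Unbarred k \<or> b = Bar k"
      by (metis letter.exhaust)
    then have "1 \<le> k"
      using w(2) by auto
    then show thesis
      using k that[of "k - 1"] by simp
  qed
  have r: "x \<le> n" "Suc y \<le> n" "z \<le> n" "1 \<le> x" "1 \<le> z"
    using w(2) x y z by auto
  show thesis
    using x y z
  proof (elim disjE)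
    assume "a = Unbarred x" "b = Unbarred (Suc y)" "c = Unbarred z"
    then show thesis using UUU w r by simp
  next
    assume "a = Unbarred x" "b = Unbarred (Suc y)" "c = Bar z"
    then show thesis using UUB w r by simp
  next
    assume "a = Bar x" "b = Unbarred (Suc y)" "c = Unbarred z"
    then show thesis using BUU w r by simp
  next
    assume "a = Bar x" "b = Unbarred (Suc y)" "c = Bar z"
    then show thesis using BUB w r by simp
  next
    assume "a = Bar x" "b = Bar (Suc y)" "c = Bar z"
    then show thesis using BBB w r by simp
  next
    assume "a = Unbarred x" "b = Bar (Suc y)" "c = Unbarred z"
    then show thesis using w(3) by simp
  next
    assume "a = Unbarred x" "b = Bar (Suc y)" "c = Bar z"
    then show thesis using w(3) by simp
  next
    assume "a = Bar x" "b = Bar (Suc y)" "c = Unbarred z"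
    then show thesis using w(4) by simp
  qed
qed

lemma knuth_fop:
  assumes "knuth_domain n w" "i \<in> {1..n}"
  shows "fop n i (knuth w) = map_option knuth (fop n i w)"
proof (cases "i < n")
  case True
  have "1 \<le> i" using assms(2) by simp
  note i = this True
  from assms(1) show ?thesis
  proof (cases rule: knuth_domain_cases)
    case (UUU x y z)
    then show ?thesis using knuth_fop_UUU[OF UUU(2,3) i] by simp
  next
    case (UUB x y z)
    then show ?thesis using knuth_fop_UUB[OF UUB(2,3) i] by simp
  next
    case (BUU x y z)
    then show ?thesis using knuth_fop_BUU[OF BUU(2) i] by simp
  next
    case (BUB x y z)
    then show ?thesis using knuth_fop_BUB[OF BUB(2) i] by simp
  next
    case (BBB x y z)
    then show ?thesis using knuth_fop_BBB[OF BBB(2,3) i] by simp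
  qed
next
  case False
  with assms(2) have [simp]: "i = n" by auto
  from assms(1) show ?thesis
  proof (cases rule: knuth_domain_cases)
    case (UUU x y z)
    then show ?thesis using knuth_fop_top_UUU[OF UUU(2-6)] by simp
  next
    case (UUB x y z)
    then show ?thesis using knuth_fop_top_UUB[OF UUB(2-6)] by simp
  next
    case (BUU x y z)
    then show ?thesis using knuth_fop_top_BUU[OF BUU(2-5)] by simp
  next
    case (BUB x y z)
    then show ?thesis using knuth_fop_top_BUB[OF BUB(2-5)] by simp
  next
    case (BBB x y z)
    then show ?thesis using knuth_fop_top_BBB[OF BBB(2-6)] by simp
  qed
qed

lemma knuth_alphabet:
  assumes "knuth_domain n w"
  shows "knuth w \<in> lists (alphabet n)"
  using assms by (cases rule: knuth_domain_cases) auto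

lemma knuth_weight:
  assumes "knuth_domain n w"
  shows "weight n (knuth w) = weight n w"
  using assms by (cases rule: knuth_domain_cases) (auto simp: weight_eq_iff wt_def)

section \<open>From tableau readings of heights 1 and 2 to plactic relations\<close>

lemma right_set_pair_ge:
  assumes "b < c" "r \<in> right_set n {b, c}"
  shows "b \<le> r"
proof (cases r)
  case (Unbarred m)
  then show ?thesis
    using assms by (auto simp: left_right_set_iff)
next
  case (Bar m)
  show ?thesis
  proof (cases b)
    case (Bar k)
    with assms(1) have "\<not> paired_at {b, c} j" for j
      by (cases c) (auto simp: paired_at_def)
    then have "right_set n {b, c} = {b, c}"
      by (rule unpaired_left_right)
    with assms show ?thesis by auto
  qed (simp add: Bar)
qed

lemma tableau_word_knuth_domain:
  assumes "tableau_word n g" "map length g = [1, 2]"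
  shows "knuth_domain n (concat g)"
proof -
  from assms(2) obtain u v where uv: "g = [u, v]" "length u = 1" "length v = 2"
    by (auto simp: map_eq_Cons_conv)
  obtain a where a: "u = [a]"
    using uv(2) by (auto simp: length_Suc_conv)
  obtain b c where bc: "v = [b, c]"
    using uv(3) by (auto simp: length_Suc_conv numeral_2_eq_2)
  have adm: "admissible n [a]" "admissible n [b, c]" and prec: "col_prec [b, c] [a]"
    using assms(1) uv a bc by (auto simp: tableau_word_def admissible_columns_def)
  have lt: "b < c" and al: "{a, b, c} \<subseteq> alphabet n"
    using adm by (auto simp: admissible_def is_column_def)
  have "\<not> (b = Unbarred 1 \<and> c = Bar 1)"
  proof
    assume "b = Unbarred 1 \<and> c = Bar 1"
    then have "1 \<le> n" "b = Unbarred 1" "c = Bar 1"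
      using al by auto
    then show False
      using adm(2) unfolding admissible_def by (auto dest!: bspec[where x = 1])
  qed
  moreover have "b \<le> a"
  proof -
    have "dominates n (right_set n {b, c}) (left_set n {a})"
      using prec col_prec_iff[OF adm(2,1)] by simp
    then have le: "card {l \<in> left_set n {a}. l \<le> a} \<le> card {r \<in> right_set n {b, c}. r \<le> a}"
      using al by (simp add: dominates_def)
    have "a \<in> left_set n {a}"
      by (cases a) (auto simp: left_right_set_iff)
    moreover have "left_set n {a} \<subseteq> alphabet n"
      using al by (intro left_set_alphabet) simp
    then have "finite {l \<in> left_set n {a}. l \<le> a}"
      using finite_subset by fastforce
    ultimately have "card {l \<in> left_set n {a}. l \<le> a} \<noteq> 0"
      by auto
    with le have "{r \<in> right_set n {b, c}. r \<le> a} \<noteq> {}"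
      by (metis card.empty le_zero_eq)
    then show ?thesis
      using right_set_pair_ge[OF lt] by (blast intro: order_trans)
  qed
  ultimately show ?thesis
    using lt al by (auto simp: knuth_domain_def uv(1) a bc)
qed

text \<open>Operators keep tableau readings and their heights, so the domain is stable; heights 1
  and 2 leave 1 1 2 as its only highest weight word.\<close>

lemma knuth_plactic:
  assumes g: "tableau_word n g" "map length g = [1, 2]"
  shows "(concat g, knuth (concat g)) \<in> plactic_rel n"
proof -
  define S where "S = {a. \<exists>g. a = concat g \<and> tableau_word n g \<and> map length g = [1, 2]}"
  have SI: "concat g \<in> S" if "tableau_word n g" "map length g = [1, 2]" for g
    unfolding S_def mem_Collect_eq using that by (intro exI[of _ g]) simp
  have SE: "\<exists>g. a = concat g \<and> tableau_word n g \<and> map length g = [1, 2]" if "a \<in> S" for a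
    using that unfolding S_def mem_Collect_eq .
  have dom: "knuth_domain n a" if "a \<in> S" for a
    using SE[OF that] tableau_word_knuth_domain by metis
  show ?thesis
  proof (rule plactic_by_map[where S = S])
    show "S \<subseteq> lists (alphabet n)"
    proof
      fix a assume "a \<in> S"
      from dom[OF this] show "a \<in> lists (alphabet n)"
        unfolding knuth_domain_def by (elim exE conjE) simp
    qed
    show "concat g \<in> S"
      by (rule SI[OF g])
    show "b \<in> S" if a: "a \<in> S" and i: "i \<in> {1..n}" and f: "fop n i a = Some b" for a i b
    proof -
      obtain g where g: "a = concat g" "tableau_word n g" "map length g = [1, 2]"
        using SE[OF a] by metis
      obtain g' where "b = concat g'" "tableau_word n g'" "map length g' = [1, 2]"
        using tableau_word_fop[OF g(2) i f[unfolded g(1)]] g(3) by metis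
      then show ?thesis
        using SI by simp
    qed
    show "b \<in> S" if a: "a \<in> S" and i: "i \<in> {1..n}" and f: "eop n i a = Some b" for a i b
    proof -
      obtain g where g: "a = concat g" "tableau_word n g" "map length g = [1, 2]"
        using SE[OF a] by metis
      obtain g' where "b = concat g'" "tableau_word n g'" "map length g' = [1, 2]"
        using tableau_word_eop[OF g(2) i f[unfolded g(1)]] g(3) by metis
      then show ?thesis
        using SI by simp
    qed
    have yam: "a = yamanouchi [1, 2]" if a: "a \<in> S" and h: "highest n a" for a
    proof -
      obtain g where g: "a = concat g" "tableau_word n g" "map length g = [1, 2]"
        using SE[OF a] by metis
      obtain ks where ks: "g = map initial_col ks"
        using highest_tableau_word[OF g(2) h[unfolded g(1)]] by metis
      then have "map length (map initial_col ks) = [1, 2]"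
        using g(3) by simp
      then have "ks = [1, 2]"
        by (simp add: o_def)
      with g(1) ks show ?thesis
        by (simp add: yamanouchi_def)
    qed
    show "a = b" if "a \<in> S" "b \<in> S" "highest n a" "highest n b" for a b
      using yam[OF that(1,3)] yam[OF that(2,4)] by simp
    show "fop n i (knuth a) = map_option knuth (fop n i a)" if "a \<in> S" "i \<in> {1..n}" for a i
      by (rule knuth_fop[OF dom[OF that(1)] that(2)])
    show "weight n (knuth a) = weight n a" if "a \<in> S" for a
      by (rule knuth_weight[OF dom[OF that]])
    show "knuth a \<in> lists (alphabet n)" if "a \<in> S" for a
      by (rule knuth_alphabet[OF dom[OF that]])
  qed
qed

text \<open>On unbarred letters the map yields the two Knuth relations of type A, which are all that
  sliding through initial columns requires.\<close>

lemma knuth_unbarred: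
  assumes "1 \<le> y" "y \<le> x" "y < z" "x \<le> n" "z \<le> n"
  shows "([Unbarred x, Unbarred y, Unbarred z],
    if x < z then [Unbarred x, Unbarred z, Unbarred y] else [Unbarred y, Unbarred x, Unbarred z])
    \<in> plactic_rel n"
proof -
  have np: "\<not> paired_at {Unbarred x} m" "\<not> paired_at {Unbarred y, Unbarred z} m" for m
    by (auto simp: paired_at_def)
  have adm: "admissible n [Unbarred x]" "admissible n [Unbarred y, Unbarred z]"
    using assms pend_unpaired[OF np(1)] pend_unpaired[OF np(2)]
    by (auto simp: admissible_iff is_column_def)
  have "card {b \<in> {Unbarred x}. b \<le> v} \<le> card {a \<in> {Unbarred y, Unbarred z}. a \<le> v}" for v
  proof (cases "Unbarred x \<le> v")
    case True
    have "Unbarred y \<le> Unbarred x" using assms by simp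
    then have "Unbarred y \<le> v"
      using True by (rule order_trans)
    then have "{Unbarred y} \<subseteq> {a \<in> {Unbarred y, Unbarred z}. a \<le> v}"
      by simp
    then have "card {Unbarred y} \<le> card {a \<in> {Unbarred y, Unbarred z}. a \<le> v}"
      by (intro card_mono) auto
    moreover have "card {b \<in> {Unbarred x}. b \<le> v} \<le> card {Unbarred x}"
      by (intro card_mono) auto
    ultimately show ?thesis by simp
  next
    case False
    then have "{b \<in> {Unbarred x}. b \<le> v} = {}" by auto
    then show ?thesis by (metis card.empty le0)
  qed
  then have "col_prec [Unbarred y, Unbarred z] [Unbarred x]"
    using unpaired_left_right[OF np(1)] unpaired_left_right[OF np(2)]
    by (simp add: col_prec_iff[OF adm(2,1)] dominates_def)
  then have "tableau_word n [[Unbarred x], [Unbarred y, Unbarred z]]"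
    using adm by (simp add: tableau_word_def admissible_columns_def)
  from knuth_plactic[OF this] show ?thesis
    by (simp split: if_splits)
qed

section \<open>Sliding a letter through initial columns\<close>

lemma plactic_context:
  assumes "(u, v) \<in> plactic_rel n" "p \<in> lists (alphabet n)" "q \<in> lists (alphabet n)"
  shows "(p @ u @ q, p @ v @ q) \<in> plactic_rel n"
  using assms by (intro plactic_append plactic_refl)

lemma initial_col_alphabet: "k \<le> n \<Longrightarrow> initial_col k \<in> lists (alphabet n)"
  by auto

text \<open>The larger letter \<open>j\<close> moves left past one letter of the column at a time,
  each exchange being witnessed by the next letter of the column.\<close>

lemma slide_into_prefix:
  assumes "q < j" "j \<le> n"
  shows "(initial_col q @ [Unbarred j, Unbarred (Suc q)], Unbarred j # initial_col (Suc q))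
    \<in> plactic_rel n"
  using assms
proof (induction q)
  case 0
  then show ?case by (simp add: plactic_refl)
next
  case (Suc q)
  have "([Unbarred j, Unbarred (Suc q), Unbarred (Suc (Suc q))],
    [Unbarred (Suc q), Unbarred j, Unbarred (Suc (Suc q))]) \<in> plactic_rel n"
    using knuth_unbarred[of "Suc q" j "Suc (Suc q)" n] Suc.prems by simp
  from plactic_sym[OF this] have 1: "(initial_col q @ [Unbarred (Suc q), Unbarred j, Unbarred (Suc (Suc q))] @ [],
    initial_col q @ [Unbarred j, Unbarred (Suc q), Unbarred (Suc (Suc q))] @ []) \<in> plactic_rel n"
    by (rule plactic_context) (use Suc.prems in auto)
  have 2: "([] @ (initial_col q @ [Unbarred j, Unbarred (Suc q)]) @ [Unbarred (Suc (Suc q))],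
    [] @ (Unbarred j # initial_col (Suc q)) @ [Unbarred (Suc (Suc q))]) \<in> plactic_rel n"
    by (rule plactic_context[OF Suc.IH]) (use Suc.prems in auto)
  let ?m = "initial_col q @ [Unbarred j, Unbarred (Suc q), Unbarred (Suc (Suc q))]"
  have "(initial_col (Suc q) @ [Unbarred j, Unbarred (Suc (Suc q))], ?m) \<in> plactic_rel n"
    using 1 by simp
  moreover have "(?m, Unbarred j # initial_col (Suc (Suc q))) \<in> plactic_rel n"
    using 2 by simp
  ultimately show ?case by (rule plactic_trans)
qed

text \<open>First \<open>j\<close> moves left past the letters of the column above it, with the
  preceding letter as witness; what remains is the case \<open>p = j\<close>, where
  \<open>slide_into_prefix\<close> takes over.\<close>

lemma slide_column:
  assumes "1 \<le> j" "j \<le> p" "p \<le> n"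
  shows "(initial_col p @ [Unbarred j], Unbarred j # initial_col p) \<in> plactic_rel n"
  using assms(2,3)
proof (induction p rule: dec_induct)
  case base
  then show ?case
    using slide_into_prefix[of "j - 1" j n] assms(1) by (cases j) simp_all
next
  case (step p)
  then obtain p' where p': "p = Suc p'"
    using assms(1) by (cases p) auto
  have "([Unbarred p, Unbarred j, Unbarred (Suc p)], [Unbarred p, Unbarred (Suc p), Unbarred j])
    \<in> plactic_rel n"
    using knuth_unbarred[of j p "Suc p" n] step assms(1) by simp
  from plactic_sym[OF this] have 1: "(initial_col p' @ [Unbarred p, Unbarred (Suc p), Unbarred j] @ [],
    initial_col p' @ [Unbarred p, Unbarred j, Unbarred (Suc p)] @ []) \<in> plactic_rel n"
    by (rule plactic_context) (use step.prems p' in auto)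
  have 2: "([] @ (initial_col p @ [Unbarred j]) @ [Unbarred (Suc p)],
    [] @ (Unbarred j # initial_col p) @ [Unbarred (Suc p)]) \<in> plactic_rel n"
    by (rule plactic_context[OF step.IH]) (use step.prems in auto)
  let ?m = "initial_col p' @ [Unbarred p, Unbarred j, Unbarred (Suc p)]"
  have "(initial_col (Suc p) @ [Unbarred j], ?m) \<in> plactic_rel n"
    using 1 by (simp add: p')
  moreover have "(?m, Unbarred j # initial_col (Suc p)) \<in> plactic_rel n"
    using 2 by (simp add: p')
  ultimately show ?case by (rule plactic_trans)
qed

lemma yamanouchi_alphabet: "set ks \<subseteq> {1..n} \<Longrightarrow> yamanouchi ks \<in> lists (alphabet n)"
  by (induction ks) auto

lemma slide_yamanouchi:
  assumes "1 \<le> j" "\<And>k. k \<in> set ks \<Longrightarrow> j \<le> k \<and> k \<le> n" "j \<le> n"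
  shows "(yamanouchi ks @ [Unbarred j], Unbarred j # yamanouchi ks) \<in> plactic_rel n"
  using assms(2)
proof (induction ks)
  case Nil
  then show ?case using assms by (auto intro: plactic_refl)
next
  case (Cons k ks)
  have k: "j \<le> k" "k \<le> n" using Cons.prems by auto
  have al: "yamanouchi ks \<in> lists (alphabet n)"
    using Cons.prems assms(1) by (intro yamanouchi_alphabet) fastforce
  have 1: "(initial_col k @ (yamanouchi ks @ [Unbarred j]) @ [],
    initial_col k @ (Unbarred j # yamanouchi ks) @ []) \<in> plactic_rel n"
    by (rule plactic_context[OF Cons.IH initial_col_alphabet[OF k(2)]]) (use Cons.prems in auto)
  have 2: "([] @ (initial_col k @ [Unbarred j]) @ yamanouchi ks,
    [] @ (Unbarred j # initial_col k) @ yamanouchi ks) \<in> plactic_rel n"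
    by (rule plactic_context[OF slide_column[OF assms(1) k]]) (use al in auto)
  let ?m = "initial_col k @ Unbarred j # yamanouchi ks"
  have "(yamanouchi (k # ks) @ [Unbarred j], ?m) \<in> plactic_rel n"
    using 1 by simp
  moreover have "(?m, Unbarred j # yamanouchi (k # ks)) \<in> plactic_rel n"
    using 2 by simp
  ultimately show ?case by (rule plactic_trans)
qed

lemma length_yamanouchi: "length (yamanouchi ks) = sum_list ks"
  by (induction ks) auto

text \<open>The induction is on the length and not on prefixes: contraction produces a word that is
  highest but not of the required form, and it is reprocessed because it is shorter.\<close>

lemma highest_plactic_yamanouchi:
  assumes "w \<in> lists (alphabet n)" "highest n w"
  shows "\<exists>ks. sorted ks \<and> set ks \<subseteq> {1..n} \<and> (w, yamanouchi ks) \<in> plactic_rel n \<and>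
    sum_list ks \<le> length w"
  using assms
proof (induction "length w" arbitrary: w rule: less_induct)
  case less
  show ?case
  proof (cases w rule: rev_cases)
    case Nil
    then show ?thesis
      by (intro exI[of _ "[]"]) (auto intro: plactic_refl)
  next
    case (snoc w' x)
    have w': "w' \<in> lists (alphabet n)" "highest n w'" "length w' < length w" and x: "x \<in> alphabet n"
      using less.prems highest_append1 by (auto simp: snoc)
    obtain ks where ks: "sorted ks" "set ks \<subseteq> {1..n}" "(w', yamanouchi ks) \<in> plactic_rel n"
      "sum_list ks \<le> length w'"
      using less.hyps[OF w'(3,1,2)] by blast
    have yx: "(w, yamanouchi ks @ [x]) \<in> plactic_rel n"
      using plactic_append[OF ks(3) plactic_refl, of "[x]"] x by (simp add: snoc)
    then have hx: "highest n (yamanouchi ks @ [x])"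
      using plactic_highest less.prems(2) by blast
    show ?thesis
    proof (cases x)
      case (Unbarred j)
      then have j: "1 \<le> j" "j \<le> n" using x by auto
      \<comment> \<open>The heights increase, so the columns containing \<open>j\<close> come last,
        and \<open>j\<close> slides through exactly these.\<close>
      define ks1 ks2 where "ks1 = takeWhile (\<lambda>k. k < j) ks" and "ks2 = dropWhile (\<lambda>k. k < j) ks"
      have ks12: "ks = ks1 @ ks2"
        by (simp add: ks1_def ks2_def)
      have k2: "j \<le> k \<and> k \<le> n" if "k \<in> set ks2" for k
      proof -
        have "ks2 \<noteq> []" using that by auto
        then have "\<not> hd ks2 < j"
          unfolding ks2_def by (rule hd_dropWhile)
        moreover have "sorted ks2"
          using ks(1) by (simp add: ks12 sorted_append)
        then have "hd ks2 \<le> k"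
          using that by (cases ks2) auto
        ultimately show ?thesis
          using that ks(2) by (auto simp: ks12)
      qed
      have k1: "k < j" if "k \<in> set ks1" for k
        using that set_takeWhileD unfolding ks1_def by fastforce
      have al1: "yamanouchi ks1 \<in> lists (alphabet n)" and al2: "yamanouchi ks2 \<in> lists (alphabet n)"
        using ks(2) by (auto simp: ks12 intro!: yamanouchi_alphabet)
      have "(yamanouchi ks1 @ (yamanouchi ks2 @ [x]) @ [],
        yamanouchi ks1 @ (x # yamanouchi ks2) @ []) \<in> plactic_rel n"
        unfolding Unbarred
        by (rule plactic_context[OF slide_yamanouchi[OF j(1) k2 j(2)]]) (use al1 in auto)
      then have "(yamanouchi ks @ [x], yamanouchi ks1 @ x # yamanouchi ks2) \<in> plactic_rel n"
        by (simp add: ks12)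
      with yx have 1: "(w, yamanouchi ks1 @ x # yamanouchi ks2) \<in> plactic_rel n"
        by (rule plactic_trans)
      show ?thesis
      proof (cases "j = 1")
        case True
        then have "ks1 = []"
          using k1 ks(2) by (cases ks1) (auto simp: ks12)
        then have "yamanouchi ks1 @ x # yamanouchi ks2 = yamanouchi (1 # ks2)"
          by (simp add: Unbarred True)
        then show ?thesis
          using 1 ks k2 j \<open>ks1 = []\<close> snoc
          by (intro exI[of _ "1 # ks2"]) (auto simp: ks12 intro: order_trans)
      next
        case False
        then obtain k where k: "j = Suc k" "1 \<le> k" using j by (cases j) auto
        \<comment> \<open>Adding \<open>j\<close> keeps the weight a partition, so some column has
          height exactly \<open>j - 1\<close>. It is the last of \<open>ks1\<close>, and
          \<open>j\<close> extends it.\<close>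
        have "wt (Suc k) (yamanouchi ks @ [x]) \<le> wt k (yamanouchi ks @ [x])"
          using highest_wt(1)[OF hx, of k] k j by simp
        then have "length (filter (\<lambda>m. Suc k \<le> m) ks) < length (filter (\<lambda>m. k \<le> m) ks)"
          using k by (simp add: wt_yamanouchi wt_singleton Unbarred)
        then have "k \<in> set ks"
          by (metis (mono_tags, lifting) filter_cong le_less less_irrefl not_less_eq_eq not_less)
        then have kin: "k \<in> set ks1"
          using k2 k(1) by (fastforce simp: ks12)
        then obtain ks0 l where ks0: "ks1 = ks0 @ [l]"
          by (metis empty_iff empty_set rev_exhaust)
        have "l = k"
        proof -
          have "l < j" using k1 ks0 by simp
          moreover have "k \<le> l"
            using kin ks(1) by (auto simp: ks12 ks0 sorted_append)
          ultimately show ?thesis using k(1) by simp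
        qed
        then have "yamanouchi ks1 @ x # yamanouchi ks2 = yamanouchi (ks0 @ j # ks2)"
          by (simp add: ks0 Unbarred k(1))
        moreover have "sorted (ks0 @ j # ks2)"
          using ks(1) k2 k(1) \<open>l = k\<close> by (auto simp: ks12 ks0 sorted_append)
        ultimately show ?thesis
          using 1 ks(2,4) j k(1) \<open>l = k\<close> snoc
          by (intro exI[of _ "ks0 @ j # ks2"]) (auto simp: ks12 ks0)
      qed
    next
      case (Bar k)
      then have k: "1 \<le> k" "k \<le> n" using x by auto
      \<comment> \<open>Nonnegativity forces a column containing \<open>k\<close>; the last column
        is the highest, so it contains \<open>k\<close> as well and can be contracted with the
        bar.\<close>
      have "0 \<le> wt k (yamanouchi ks @ [x])"
        using highest_wt_nonneg[OF hx] k by simp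
      then have "filter (\<lambda>m. k \<le> m) ks \<noteq> []"
        using k by (auto simp: wt_yamanouchi wt_singleton Bar)
      then obtain m where m: "m \<in> set ks" "k \<le> m"
        by (auto simp: filter_empty_conv)
      then obtain ks0 p where p: "ks = ks0 @ [p]"
        by (metis empty_iff empty_set rev_exhaust)
      have kp: "k \<le> p" "p \<le> n"
        using m ks(1,2) by (auto simp: p sorted_append)
      let ?c = "col (Unbarred ` ({1..p} - {k}))"
      have "(yamanouchi ks0 @ (initial_col p @ [Bar k]) @ [], yamanouchi ks0 @ ?c @ []) \<in> plactic_rel n"
        by (rule plactic_context[OF contract_initial[OF k(1) kp] yamanouchi_alphabet])
          (use ks(2) in \<open>auto simp: p\<close>)
      then have "(yamanouchi ks @ [x], yamanouchi ks0 @ ?c) \<in> plactic_rel n"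
        by (simp add: p Bar)
      with yx have 2: "(w, yamanouchi ks0 @ ?c) \<in> plactic_rel n"
        by (rule plactic_trans)
      have "length ?c = p - 1"
        using k kp by (simp add: card_image inj_on_def)
      then have len: "length (yamanouchi ks0 @ ?c) < length w"
        using ks(4) k kp by (simp add: p snoc length_yamanouchi)
      have "yamanouchi ks0 @ ?c \<in> lists (alphabet n)" "highest n (yamanouchi ks0 @ ?c)"
        using 2 plactic_alphabet plactic_highest less.prems(2) by blast+
      from less.hyps[OF len this] obtain ks' where ks': "sorted ks'" "set ks' \<subseteq> {1..n}"
        "(yamanouchi ks0 @ ?c, yamanouchi ks') \<in> plactic_rel n"
        "sum_list ks' \<le> length (yamanouchi ks0 @ ?c)"
        by metis
      moreover have "sum_list ks' \<le> length w"
        using ks'(4) len by linarith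
      ultimately show ?thesis
        using plactic_trans[OF 2 ks'(3)] by blast
    qed
  qed
qed

section \<open>Existence and uniqueness of the tableau of a word\<close>

text \<open>\<open>Q\<close> transports a property of \<open>w\<close> to the highest weight word
  \<open>h\<close> of its component. The last conjunct records that if \<open>h\<close> is literally
  a tableau reading, lowering along the same path returns to \<open>w\<close> itself.\<close>

lemma tableau_word_exists:
  assumes "w \<in> lists (alphabet n)" "Q w"
    and closed: "\<And>a b i. Q a \<Longrightarrow> i \<in> {1..n} \<Longrightarrow> eop n i a = Some b \<Longrightarrow> Q b"
  shows "\<exists>g h. tableau_word n g \<and> (w, concat g) \<in> plactic_rel n \<and> sorted (map length g) \<and>
    set (map length g) \<subseteq> {1..n} \<and> Q h \<and> highest n h \<and>
    (h, yamanouchi (map length g)) \<in> plactic_rel n \<and>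
    (h = yamanouchi (map length g) \<longrightarrow> w = concat g)"
  using assms(1,2)
proof (induction "level n w" arbitrary: w rule: less_induct)
  case less
  show ?case
  proof (cases "highest n w")
    case True
    then obtain ks where ks: "sorted ks" "set ks \<subseteq> {1..n}" "(w, yamanouchi ks) \<in> plactic_rel n"
      using highest_plactic_yamanouchi less.prems(1) by metis
    have len: "map length (map initial_col ks) = ks"
      by (simp add: o_def)
    show ?thesis
      by (rule exI[of _ "map initial_col ks"], rule exI[of _ w], unfold len)
        (use ks True less.prems tableau_word_initial[OF ks(1,2)] in \<open>simp add: yamanouchi_def\<close>)
  next
    case False
    then obtain i w1 where i: "i \<in> {1..n}" and w1: "eop n i w = Some w1"
      by (auto simp: highest_eop)
    have f: "fop n i w1 = Some w"
      using eop_Some[OF w1] i by simp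
    have lev: "level n w1 < level n w"
      using level_fop[OF f i] by simp
    have "w1 \<in> lists (alphabet n)" "Q w1"
      using eop_alphabet[OF w1 i] closed[OF _ i w1] less.prems by blast+
    from less.hyps[OF lev this] obtain g1 h where g1: "tableau_word n g1"
      "(w1, concat g1) \<in> plactic_rel n" "sorted (map length g1)" "set (map length g1) \<subseteq> {1..n}"
      "Q h" "highest n h" "(h, yamanouchi (map length g1)) \<in> plactic_rel n"
      "h = yamanouchi (map length g1) \<longrightarrow> w1 = concat g1"
      by metis
    obtain v' where v': "fop n i (concat g1) = Some v'" "(w, v') \<in> plactic_rel n"
      using plactic_step(1)[OF g1(2) i f] by metis
    obtain g where g: "v' = concat g" "tableau_word n g" "map length g = map length g1"
      using tableau_word_fop[OF g1(1) i v'(1)] by metis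
    have "w = concat g" if "h = yamanouchi (map length g1)"
      using g1(8) that f v'(1) g(1) by simp
    then show ?thesis
      using g g1(3-7) v'(2) by (intro exI[of _ g] exI[of _ h]) simp
  qed
qed

text \<open>Heights are compared along with the words, since a word alone does not show where its
  columns are cut. Raising preserves both readings and heights.\<close>

lemma tableau_word_unique_word:
  assumes "tableau_word n g" "tableau_word n g'" "(concat g, concat g') \<in> plactic_rel n"
  shows "concat g = concat g' \<and> map length g = map length g'"
  using assms
proof (induction "level n (concat g)" arbitrary: g g' rule: less_induct)
  case less
  show ?case
  proof (cases "highest n (concat g)")
    case True
    then have "highest n (concat g')"
      using plactic_highest less.prems(3) by blast
    with True obtain ks ks' where ks: "g = map initial_col ks" "sorted ks" "set ks \<subseteq> {1..n}"
      "g' = map initial_col ks'" "sorted ks'" "set ks' \<subseteq> {1..n}"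
      using highest_tableau_word less.prems(1,2) by metis
    have "weight n (concat g) = weight n (concat g')"
      by (rule plactic_weight[OF less.prems(3)])
    then have "ks = ks'"
      using yamanouchi_inject[OF ks(2,5,3,6)] ks(1,4) by (simp add: yamanouchi_def)
    with ks show ?thesis by simp
  next
    case False
    then obtain i w1 where i: "i \<in> {1..n}" and w1: "eop n i (concat g) = Some w1"
      by (auto simp: highest_eop)
    obtain w1' where w1': "eop n i (concat g') = Some w1'" "(w1, w1') \<in> plactic_rel n"
      using plactic_step(2)[OF less.prems(3) i w1] by metis
    obtain g1 where g1: "w1 = concat g1" "tableau_word n g1" "map length g1 = map length g"
      using tableau_word_eop[OF less.prems(1) i w1] by metis
    obtain g1' where g1': "w1' = concat g1'" "tableau_word n g1'" "map length g1' = map length g'"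
      using tableau_word_eop[OF less.prems(2) i w1'(1)] by metis
    have f: "fop n i w1 = Some (concat g)" "fop n i w1' = Some (concat g')"
      using eop_Some[OF w1] eop_Some[OF w1'(1)] i by auto
    have "level n (concat g1) < level n (concat g)"
      using level_fop[OF f(1) i] g1(1) by simp
    from less.hyps[OF this g1(2) g1'(2)] w1'(2) g1(1) g1'(1)
    have "w1 = w1'" "map length g1 = map length g1'"
      by simp_all
    with f g1(3) g1'(3) show ?thesis by simp
  qed
qed

lemma concat_length_inject:
  "concat g = concat g' \<Longrightarrow> map length g = map length g' \<Longrightarrow> g = g'"
proof (induction g arbitrary: g')
  case (Cons u g)
  then obtain u' g'' where "g' = u' # g''" "length u = length u'"
    by (cases g') auto
  with Cons show ?case by auto
qed simp

lemma tableau_word_unique: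
  assumes "tableau_word n g" "tableau_word n g'" "(concat g, concat g') \<in> plactic_rel n"
  shows "g = g'"
  using tableau_word_unique_word[OF assms] concat_length_inject by blast

section \<open>The tableau of a word as a normal form\<close>

definition normal_columns :: "nat \<Rightarrow> letter list \<Rightarrow> letter list list" where
  "normal_columns n w = rev (P_tableau n w)"

lemma normal_columns_eqI:
  assumes "tableau_word n g" "(w, concat g) \<in> plactic_rel n"
  shows "normal_columns n w = g"
proof -
  have "P_tableau n w = rev g"
    unfolding P_tableau_def
  proof (rule the_equality)
    show "symplectic_tableau n (rev g) \<and> (w, tableau_reading (rev g)) \<in> plactic_rel n"
      using assms by (simp add: symplectic_tableau_iff tableau_reading_def)
  next
    fix T assume T: "symplectic_tableau n T \<and> (w, tableau_reading T) \<in> plactic_rel n"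
    then have "tableau_word n (rev T)" "(w, concat (rev T)) \<in> plactic_rel n"
      by (simp_all add: symplectic_tableau_iff tableau_reading_def)
    then have "rev T = g"
      using tableau_word_unique assms plactic_trans plactic_sym by metis
    then show "T = rev g" by auto
  qed
  then show ?thesis
    by (simp add: normal_columns_def)
qed

lemma normal_columns_props:
  assumes "w \<in> lists (alphabet n)"
  shows "tableau_word n (normal_columns n w)" "(w, concat (normal_columns n w)) \<in> plactic_rel n"
proof -
  obtain g where "tableau_word n g" "(w, concat g) \<in> plactic_rel n"
    using tableau_word_exists[OF assms, of "\<lambda>_. True"] by metis
  with normal_columns_eqI
  show "tableau_word n (normal_columns n w)" "(w, concat (normal_columns n w)) \<in> plactic_rel n"
    by metis+
qed

section \<open>Products of two columns\<close>

text \<open>Each letter contributes 1 or -1. Applied to a highest weight word, this shows that the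
  letters lost in passing to its tableau are twice its barred letters.\<close>

lemma sum_wt:
  assumes "w \<in> lists (alphabet n)"
  shows "(\<Sum>j\<in>{1..n}. wt j w) = int (length w) - 2 * int (length (filter (\<lambda>x. x \<notin> range Unbarred) w))"
  using assms
proof (induction w)
  case (Cons x w)
  have "(\<Sum>j\<in>{1..n}. wt j (x # w)) = (\<Sum>j\<in>{1..n}. wt j [x]) + (\<Sum>j\<in>{1..n}. wt j w)"
    by (subst wt_Cons) (rule sum.distrib)
  moreover have "(\<Sum>j\<in>{1..n}. wt j [x]) = (if x \<in> range Unbarred then 1 else - 1)"
  proof (cases x)
    case (Unbarred k)
    then have "(\<Sum>j\<in>{1..n}. wt j [x]) = (\<Sum>j\<in>{1..n}. if k = j then 1 else 0)"
      by (intro sum.cong) (auto simp: wt_singleton)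
    also have "\<dots> = 1"
    proof -
      have "k \<in> {1..n}" using Cons.hyps Unbarred by auto
      then show ?thesis by (simp only: sum.delta' finite_atLeastAtMost if_True)
    qed
    finally show ?thesis using Unbarred by simp
  next
    case (Bar k)
    then have "(\<Sum>j\<in>{1..n}. wt j [x]) = (\<Sum>j\<in>{1..n}. if k = j then - 1 else 0)"
      by (intro sum.cong) (auto simp: wt_singleton)
    also have "\<dots> = - 1"
    proof -
      have "k \<in> {1..n}" using Cons.hyps Bar by auto
      then show ?thesis by (simp only: sum.delta' finite_atLeastAtMost if_True)
    qed
    finally show ?thesis using Bar by auto
  qed
  ultimately show ?case
    using Cons by auto
qed simp

lemma wt_column_le:
  assumes "admissible n v"
  shows "wt j v \<le> 1"
  using wt_col[of "set v" j] column_eq_col[of n v] assms by (simp add: admissible_def)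

text \<open>The number of letters comes first because contraction may enlarge nothing else in a
  controlled way; \<open>lenlex\<close> then compares the number of columns and, if equal, the
  heights lexicographically.\<close>

definition column_order :: "(letter list list \<times> letter list list) set" where
  "column_order = inv_image (less_than <*lex*> lenlex less_than)
     (\<lambda>g. (length (concat g), map length g))"

lemma wf_column_order: "wf column_order"
  unfolding column_order_def by (intro wf_inv_image wf_lex_prod wf_less_than wf_lenlex)

text \<open>Rules are applied inside longer words: the number of letters is additive, and
  \<open>lenlex\<close> is stable under a common prefix and a common suffix.\<close>

lemma column_order_context:
  assumes "(g', g) \<in> column_order"
  shows "(p @ g' @ q, p @ g @ q) \<in> column_order"
proof -
  have "(p @ g' @ q, p @ g @ q) \<in> column_order"
    if "(map length g', map length g) \<in> lenlex less_than" "length (concat g') = length (concat g)"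
  proof -
    have "(map length g' @ map length q, map length g @ map length q) \<in> lenlex less_than"
      by (rule lenlex_append1[OF that(1)]) simp
    then have "(map length p @ map length g' @ map length q, map length p @ map length g @ map length q)
      \<in> lenlex less_than"
      by (simp add: lenlex_append2 irrefl_on_def)
    then show ?thesis
      using that(2) by (simp add: column_order_def)
  qed
  moreover have "(p @ g' @ q, p @ g @ q) \<in> column_order" if "length (concat g') < length (concat g)"
    using that by (simp add: column_order_def)
  ultimately show ?thesis
    using assms unfolding column_order_def by auto
qed

text \<open>
  Raising \<open>u @ v\<close> to a highest weight word keeps it a product of two columns of the same heights.
  The number of columns of the tableau is the first entry of the weight of that word, to which each
  column contributes at most \<open>1\<close>. If no letters are lost, the highest weight word has no barred
  letters, and its first column would be as high as before only if \<open>[u, v]\<close> were a tableau already.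
\<close>

lemma normal_columns_two:
  assumes u: "u \<in> admissible_columns n" and v: "v \<in> admissible_columns n" and not: "\<not> col_prec v u"
  shows "length (normal_columns n (u @ v)) \<le> 2"
    and "(normal_columns n (u @ v), [u, v]) \<in> column_order"
proof -
  have uv: "admissible n u" "admissible n v" "u \<noteq> []" "v \<noteq> []"
    using u v by (auto simp: admissible_columns_def)
  have al: "u @ v \<in> lists (alphabet n)"
    using uv by (auto simp: admissible_def is_column_def)
  have n: "1 \<le> n"
    using al uv(3) by (cases u) (auto simp: alphabet_def)
  define Q where "Q a \<longleftrightarrow> (\<exists>u' v'. a = u' @ v' \<and> admissible n u' \<and> admissible n v' \<and>
    length u' = length u \<and> length v' = length v)" for a
  have Q0: "Q (u @ v)"
    unfolding Q_def using uv by blast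
  have Qe: "Q b" if Qa: "Q a" and i: "i \<in> {1..n}" and e: "eop n i a = Some b" for a b i
  proof -
    obtain u' v' where a: "a = u' @ v'" "admissible n u'" "admissible n v'"
      "length u' = length u" "length v' = length v"
      using Qa unfolding Q_def by metis
    have len: "length y = length x" if "eop n i x = Some y" for x y
      using fop_length[OF eop_Some[OF that]] i by simp
    consider y where "eop n i v' = Some y" "b = u' @ y" | y where "eop n i u' = Some y" "b = y @ v'"
      using e by (auto simp: a(1) eop_append split: if_splits)
    then show ?thesis
    proof cases
      case 1
      then show ?thesis
        unfolding Q_def using a len admissible_eop[OF a(3) i] by metis
    next
      case 2
      then show ?thesis
        unfolding Q_def using a len admissible_eop[OF a(2) i] by metis
    qed
  qed
  obtain g h where g: "tableau_word n g" "(u @ v, concat g) \<in> plactic_rel n"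
    "sorted (map length g)" "set (map length g) \<subseteq> {1..n}" "Q h" "highest n h"
    "(h, yamanouchi (map length g)) \<in> plactic_rel n"
    "h = yamanouchi (map length g) \<longrightarrow> u @ v = concat g"
    using tableau_word_exists[OF al, of Q] Q0 Qe by metis
  have ng: "normal_columns n (u @ v) = g"
    by (rule normal_columns_eqI[OF g(1,2)])
  define ks where "ks = map length g"
  obtain u0 v0 where h: "h = u0 @ v0" "admissible n u0" "admissible n v0"
    "length u0 = length u" "length v0 = length v"
    using g(5) unfolding Q_def by metis
  have hal: "h \<in> lists (alphabet n)"
    by (rule plactic_alphabet(1)[OF g(7)])
  have wt_h: "wt j h = int (length (filter (\<lambda>k. j \<le> k) ks))" if "j \<in> {1..n}" for j
    using plactic_weight[OF g(7)] that by (simp add: weight_eq_iff wt_yamanouchi ks_def)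
  have wt_v0: "wt j v0 \<le> 1" and wt_u0: "wt j u0 \<le> 1" for j
    by (rule wt_column_le[OF h(3)], rule wt_column_le[OF h(2)])
  \<comment> \<open>All heights are at least 1, so the first weight entry counts every
    column.\<close>
  have "filter (\<lambda>k. 1 \<le> k) ks = ks"
    using g(4) by (auto simp: ks_def filter_id_conv)
  then have "int (length ks) = wt 1 u0 + wt 1 v0"
    using wt_h[of 1] n by (simp add: h(1))
  then have len2: "length ks \<le> 2"
    using wt_u0[of 1] wt_v0[of 1] by simp
  then show "length (normal_columns n (u @ v)) \<le> 2"
    by (simp add: ng ks_def)
  have k_eq: "u0 = initial_col (length u)"
  proof -
    have "u0 \<noteq> []" using h(4) uv(3) by auto
    then have "tableau_word n [u0]"
      using h(2) by (simp add: tableau_word_def admissible_columns_def)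
    moreover have "highest n (concat [u0])"
      using g(6) highest_append1 by (simp add: h(1))
    ultimately have "\<exists>ks. [u0] = map initial_col ks \<and> sorted ks \<and> set ks \<subseteq> {1..n}"
      by (rule highest_tableau_word)
    then obtain ks where "[u0] = map initial_col ks"
      by metis
    then have "\<exists>k. u0 = initial_col k"
      by (metis list.inject list.map_disc_iff list.simps(9) map_eq_Cons_D)
    then show ?thesis
      using h(4) by auto
  qed
  have "int (sum_list ks) = (\<Sum>j\<in>{1..n}. wt j (yamanouchi ks))"
  proof -
    have "yamanouchi ks \<in> lists (alphabet n)"
      using g(4) by (intro yamanouchi_alphabet) (simp add: ks_def)
    moreover have "filter (\<lambda>x. x \<notin> range Unbarred) (yamanouchi ks) = []"
      by (auto simp: filter_empty_conv yamanouchi_def)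
    ultimately show ?thesis
      using sum_wt[of "yamanouchi ks" n] by (simp add: length_yamanouchi)
  qed
  also have "\<dots> = (\<Sum>j\<in>{1..n}. wt j h)"
    using wt_h by (intro sum.cong) (auto simp: wt_yamanouchi)
  also have "\<dots> = int (length h) - 2 * int (length (filter (\<lambda>x. x \<notin> range Unbarred) h))"
    by (rule sum_wt[OF hal])
  finally have tot: "int (sum_list ks) =
    int (length h) - 2 * int (length (filter (\<lambda>x. x \<notin> range Unbarred) h))" .
  have len_h: "length h = length u + length v"
    by (simp add: h)
  have len_g: "length (concat g) = sum_list ks"
    by (simp add: ks_def length_concat)
  show "(normal_columns n (u @ v), [u, v]) \<in> column_order"
  proof (cases "sum_list ks = length h")
    case False
    then have "sum_list ks < length u + length v"
      using tot len_h by linarith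
    then show ?thesis
      by (simp add: ng column_order_def len_g)
  next
    case True
    then have nobar: "\<forall>x \<in> set h. x \<in> range Unbarred"
      using tot by (simp add: filter_empty_conv)
    have "(ks, [length u, length v]) \<in> lenlex less_than"
    proof (cases "length ks = 2")
      case False
      with len2 have "length ks < length [length u, length v]" by simp
      then show ?thesis
        by (simp add: lenlex_conv)
    next
      case 2: True
      then obtain q p where ks: "ks = [q, p]"
        by (auto simp: numeral_2_eq_2 length_Suc_conv)
      have qp: "q \<le> p" "q \<in> {1..n}" "p \<in> {1..n}"
        using g(3,4) by (simp_all add: ks_def[symmetric] ks)
      \<comment> \<open>Both columns contain \<open>q\<close> since \<open>q \<le> p\<close>, while
        \<open>v0\<close> contributes at most 1; so \<open>q\<close> occurs in the initial column
        \<open>u0\<close>.\<close>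
      have "wt q u0 + wt q v0 = 2"
        using wt_h[OF qp(2)] qp(1) by (simp add: ks h(1))
      then have "wt q u0 \<noteq> 0"
        using wt_v0[of q] by auto
      then have le: "q \<le> length u"
        by (simp add: k_eq wt_initial_col split: if_splits)
      \<comment> \<open>With equal heights the weight would force \<open>v0\<close> to be an initial
        column too. Then \<open>h\<close> is itself the tableau reading, and retracing the path
        makes \<open>[u, v]\<close> the tableau of \<open>u @ v\<close>.\<close>
      moreover have "q \<noteq> length u"
      proof
        assume q: "q = length u"
        with True have p: "p = length v"
          by (simp add: ks len_h)
        have mem: "Unbarred j \<in> set v0 \<longleftrightarrow> j \<le> p" if "j \<in> {1..n}" for j
        proof -
          have "wt j u0 + wt j v0 = (if j \<le> q then 1 else 0) + (if j \<le> p then 1 else 0)"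
            using wt_h[OF that] by (simp add: ks h(1))
          then have "wt j v0 = (if j \<le> p then 1 else 0)"
            using that by (simp add: k_eq wt_initial_col q)
          moreover have "wt j v0 = of_bool (Unbarred j \<in> set v0) - of_bool (Bar j \<in> set v0)"
            using wt_col[of "set v0" j] column_eq_col[of n v0] h(3) by (simp add: admissible_def)
          moreover have "Bar j \<notin> set v0"
            using nobar by (auto simp: h(1))
          ultimately show ?thesis by (auto split: if_splits)
        qed
        have "set v0 = Unbarred ` {1..p}"
        proof (rule Set.set_eqI)
          fix x
          show "x \<in> set v0 \<longleftrightarrow> x \<in> Unbarred ` {1..p}"
          proof
            assume x: "x \<in> set v0"
            then have "x \<in> range Unbarred" "x \<in> alphabet n"
              using nobar hal by (auto simp: h(1))
            then obtain j where j: "x = Unbarred j" "j \<in> {1..n}"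
              by auto
            then have "j \<le> p"
              using mem[OF j(2)] x by simp
            with j show "x \<in> Unbarred ` {1..p}" by simp
          next
            assume "x \<in> Unbarred ` {1..p}"
            then obtain j where j: "x = Unbarred j" "j \<in> {1..p}"
              by blast
            then have "j \<in> {1..n}" using qp(3) by simp
            then show "x \<in> set v0"
              using mem j by simp
          qed
        qed
        then have "v0 = initial_col p"
          using h(3) by (intro strict_sorted_equal[OF sorted_initial_col])
            (auto simp: admissible_def is_column_def)
        then have "h = yamanouchi (map length g)"
          using k_eq by (simp add: h(1) ks_def[symmetric] ks q)
        then have "u @ v = concat g"
          using g(8) by blast
        moreover have "map length g = map length [u, v]"
          using ks q p by (simp add: ks_def)
        ultimately have "g = [u, v]"
          by (intro concat_length_inject) simp_all
        then show False
          using g(1) not by (simp add: tableau_word_def)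
      qed
      ultimately show ?thesis
        by (simp add: ks lenlex_conv)
    qed
    moreover have "length (concat g) = length (concat [u, v])"
      using True by (simp add: len_g len_h)
    ultimately show ?thesis
      by (simp add: ng column_order_def ks_def)
  qed
qed

section \<open>The rewriting system\<close>

lemma finite_admissible_columns: "finite (admissible_columns n)"
proof (rule finite_subset)
  show "admissible_columns n \<subseteq> col ` Pow (alphabet n)"
  proof
    fix U assume "U \<in> admissible_columns n"
    then obtain A where "U = col A" "A \<subseteq> alphabet n"
      using admissibleE[of n U] by (auto simp: admissible_columns_def)
    then show "U \<in> col ` Pow (alphabet n)" by blast
  qed
qed simp

text \<open>Rules exist only for products whose tableau has zero, one or two columns; the bound on
  columns shows that no failing pair is left without a rule.\<close>

lemma col_rules_eq:
  "col_rules n = {([Gen u, Gen v], map Gen (normal_columns n (u @ v))) | u v.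
     u \<in> admissible_columns n \<and> v \<in> admissible_columns n \<and> \<not> col_prec v u}"
proof -
  have rev: "P_tableau n w = rev (normal_columns n w)" for w
    by (simp add: normal_columns_def)
  have "(s, t) \<in> col_rules n \<longleftrightarrow> (\<exists>u v. s = [Gen u, Gen v] \<and> t = map Gen (normal_columns n (u @ v)) \<and>
     u \<in> admissible_columns n \<and> v \<in> admissible_columns n \<and> \<not> col_prec v u)" for s t
  proof
    assume "(s, t) \<in> col_rules n"
    then show "\<exists>u v. s = [Gen u, Gen v] \<and> t = map Gen (normal_columns n (u @ v)) \<and>
     u \<in> admissible_columns n \<and> v \<in> admissible_columns n \<and> \<not> col_prec v u"
      by cases (auto simp: normal_columns_def)
  next
    assume "\<exists>u v. s = [Gen u, Gen v] \<and> t = map Gen (normal_columns n (u @ v)) \<and>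
     u \<in> admissible_columns n \<and> v \<in> admissible_columns n \<and> \<not> col_prec v u"
    then obtain u v where uv: "s = [Gen u, Gen v]" "t = map Gen (normal_columns n (u @ v))"
      "u \<in> admissible_columns n" "v \<in> admissible_columns n" "\<not> col_prec v u"
      by metis
    let ?g = "normal_columns n (u @ v)"
    have "length ?g \<le> 2"
      by (rule normal_columns_two(1)[OF uv(3-5)])
    then consider "?g = []" | w where "?g = [w]" | w w' where "?g = [w, w']"
      by (cases ?g rule: list.exhaust[case_product list.exhaust[of "tl ?g"]])
        (auto simp: numeral_2_eq_2 le_Suc_eq length_Suc_conv)
    then show "(s, t) \<in> col_rules n"
    proof cases
      case 1
      then show ?thesis
        using col_rules.zero[OF uv(3-5)] uv(1,2) rev[of "u @ v"] by simp
    next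
      case (2 w)
      then show ?thesis
        using col_rules.one[OF uv(3-5), of w] uv(1,2) rev[of "u @ v"] by simp
    next
      case (3 w w')
      then show ?thesis
        using col_rules.two[OF uv(3-5), of w' w] uv(1,2) rev[of "u @ v"] by simp
    qed
  qed
  then show ?thesis by auto
qed

lemma finite_col_rules: "finite (col_rules n)"
proof (rule finite_subset)
  show "col_rules n \<subseteq> (\<lambda>(u, v). ([Gen u, Gen v], map Gen (normal_columns n (u @ v)))) `
    (admissible_columns n \<times> admissible_columns n)"
    unfolding col_rules_eq by auto
qed (simp add: finite_admissible_columns)

fun columns_of :: "generator list \<Rightarrow> letter list list" where
  "columns_of [] = []"
| "columns_of (Gen u # x) = u # columns_of x"

lemma columns_of_map [simp]: "columns_of (map Gen g) = g"
  by (induction g) auto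

lemma columns_of_append [simp]: "columns_of (x @ y) = columns_of x @ columns_of y"
  by (induction x rule: columns_of.induct) auto

lemma map_Gen_columns_of [simp]: "map Gen (columns_of x) = x"
  by (induction x rule: columns_of.induct) auto

lemma lists_col_generators:
  "x \<in> lists (col_generators n) \<longleftrightarrow> set (columns_of x) \<subseteq> admissible_columns n"
  by (induction x rule: columns_of.induct) (auto simp: col_generators_def)

definition col_word :: "generator list \<Rightarrow> letter list" where
  "col_word x = concat (columns_of x)"

lemma col_word_append [simp]: "col_word (x @ y) = col_word x @ col_word y"
  by (simp add: col_word_def)

lemma admissible_columns_alphabet: "u \<in> admissible_columns n \<Longrightarrow> u \<in> lists (alphabet n)"
  by (simp add: admissible_columns_def admissible_def is_column_def)

lemma col_word_alphabet:
  assumes "x \<in> lists (col_generators n)"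
  shows "col_word x \<in> lists (alphabet n)"
proof -
  have "y \<in> alphabet n" if y: "y \<in> set (col_word x)" for y
  proof -
    from y obtain u where u: "u \<in> set (columns_of x)" "y \<in> set u"
      by (auto simp: col_word_def)
    then have "u \<in> admissible_columns n"
      using assms by (auto simp only: lists_col_generators)
    then have "u \<in> lists (alphabet n)"
      by (rule admissible_columns_alphabet)
    with u(2) show ?thesis by auto
  qed
  then show ?thesis by auto
qed

lemma col_ruleE:
  assumes "(s, t) \<in> col_rules n"
  shows "s \<in> lists (col_generators n)" "t \<in> lists (col_generators n)"
    "(col_word s, col_word t) \<in> plactic_rel n" "(columns_of t, columns_of s) \<in> column_order"
proof -
  obtain u v where uv: "s = [Gen u, Gen v]" "t = map Gen (normal_columns n (u @ v))"
    "u \<in> admissible_columns n" "v \<in> admissible_columns n" "\<not> col_prec v u"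
    using assms unfolding col_rules_eq by auto
  have al: "u @ v \<in> lists (alphabet n)"
    using uv(3,4) admissible_columns_alphabet by auto
  show "s \<in> lists (col_generators n)"
    using uv by (simp add: lists_col_generators)
  show "t \<in> lists (col_generators n)"
    using normal_columns_props(1)[OF al] uv(2) by (simp add: lists_col_generators tableau_word_def)
  show "(col_word s, col_word t) \<in> plactic_rel n"
    using normal_columns_props(2)[OF al] uv(1,2) by (simp add: col_word_def)
  show "(columns_of t, columns_of s) \<in> column_order"
    using normal_columns_two(2)[OF uv(3-5)] uv(1,2) by simp
qed

section \<open>Termination, normal forms and confluence\<close>

abbreviation col_cong :: "nat \<Rightarrow> (generator list \<times> generator list) set" where
  "col_cong n \<equiv> generated_congruence (col_generators n) (col_rules n)"

abbreviation col_step :: "nat \<Rightarrow> generator list \<Rightarrow> generator list \<Rightarrow> bool" where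
  "col_step n \<equiv> rewrite_step (col_generators n) (col_rules n)"

lemma col_step_props:
  assumes "col_step n x y"
  shows "x \<in> lists (col_generators n)" "y \<in> lists (col_generators n)"
    "(col_word x, col_word y) \<in> plactic_rel n" "(columns_of y, columns_of x) \<in> column_order"
    "(x, y) \<in> col_cong n"
proof -
  obtain s t p q where st: "(s, t) \<in> col_rules n" and pq: "p \<in> lists (col_generators n)"
    "q \<in> lists (col_generators n)" and xy: "x = p @ s @ q" "y = p @ t @ q"
    using assms by (cases rule: rewrite_step.cases) auto
  note st' = col_ruleE[OF st]
  show "x \<in> lists (col_generators n)" "y \<in> lists (col_generators n)"
    using st'(1,2) pq by (simp_all add: xy)
  show "(col_word x, col_word y) \<in> plactic_rel n"
    using plactic_context[OF st'(3) col_word_alphabet[OF pq(1)] col_word_alphabet[OF pq(2)]]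
    by (simp add: xy)
  show "(columns_of y, columns_of x) \<in> column_order"
    using column_order_context[OF st'(4)] by (simp add: xy)
  show "(x, y) \<in> col_cong n"
    unfolding xy using st pq by (intro generated_congruence.mult generated_congruence.refl generated_congruence.base)
qed

lemma terminating_col_step: "terminating (col_step n)"
  unfolding terminating_def
proof
  assume "\<exists>h. \<forall>k. col_step n (h k) (h (Suc k))"
  then obtain h where "\<forall>k. col_step n (h k) (h (Suc k))"
    by blast
  then have "\<forall>k. (columns_of (h (Suc k)), columns_of (h k)) \<in> column_order"
    using col_step_props(4) by blast
  then have "\<exists>f. \<forall>k. (f (Suc k), f k) \<in> column_order"
    by (rule exI[of _ "\<lambda>k. columns_of (h k)"])
  then show False
    using wf_column_order unfolding wf_iff_no_infinite_down_chain by blast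
qed

text \<open>The tableau condition concerns adjacent columns only, and a pair that violates it is the
  source of a rule.\<close>

lemma irreducible_tableau_word:
  assumes "x \<in> lists (col_generators n)" "\<And>y. \<not> col_step n x y"
  shows "tableau_word n (columns_of x)"
proof -
  have adm: "set (columns_of x) \<subseteq> admissible_columns n"
    using assms(1) by (simp add: lists_col_generators)
  have "successively (\<lambda>u v. col_prec v u) (columns_of x)"
    unfolding successively_nth_iff
  proof (intro allI impI)
    fix k assume k: "Suc k < length (columns_of x)"
    let ?g = "columns_of x"
    let ?u = "?g ! k" and ?v = "?g ! Suc k"
    have split: "?g = take k ?g @ [?u, ?v] @ drop (Suc (Suc k)) ?g"
      using k by (metis Cons_nth_drop_Suc Suc_lessD append_Cons append_Nil id_take_nth_drop)
    show "col_prec ?v ?u"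
    proof (rule ccontr)
      assume not: "\<not> col_prec ?v ?u"
      have uv: "?u \<in> admissible_columns n" "?v \<in> admissible_columns n"
        using adm k by (meson Suc_lessD nth_mem subsetD)+
      have rule: "([Gen ?u, Gen ?v], map Gen (normal_columns n (?u @ ?v))) \<in> col_rules n"
        unfolding col_rules_eq using uv not by blast
      let ?p = "map Gen (take k ?g)" and ?q = "map Gen (drop (Suc (Suc k)) ?g)"
      have "?p \<in> lists (col_generators n)" "?q \<in> lists (col_generators n)"
        using adm set_take_subset[of k ?g] set_drop_subset[of "Suc (Suc k)" ?g]
        by (auto simp: lists_col_generators)
      from rewrite_step.intros[OF rule this]
      have "col_step n (?p @ [Gen ?u, Gen ?v] @ ?q) (?p @ map Gen (normal_columns n (?u @ ?v)) @ ?q)" .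
      moreover have "?p @ [Gen ?u, Gen ?v] @ ?q = x"
        using arg_cong[OF split, of "map Gen"] by simp
      ultimately show False
        using assms(2) by metis
    qed
  qed
  with adm show ?thesis
    by (simp add: tableau_word_def)
qed

lemma col_steps_props:
  assumes "(col_step n)\<^sup>*\<^sup>* x y" "x \<in> lists (col_generators n)"
  shows "y \<in> lists (col_generators n)" "(col_word x, col_word y) \<in> plactic_rel n"
    "(x, y) \<in> col_cong n"
proof -
  have "y \<in> lists (col_generators n) \<and> (col_word x, col_word y) \<in> plactic_rel n \<and>
    (x, y) \<in> col_cong n"
    using assms(1)
  proof (induction rule: rtranclp_induct)
    case base
    then show ?case
      by (intro conjI assms(2) plactic_refl col_word_alphabet generated_congruence.refl)
  next
    case (step y z)
    then show ?case
      using col_step_props[OF step.hyps(2)] plactic_trans generated_congruence.trans by metis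
  qed
  then show "y \<in> lists (col_generators n)" "(col_word x, col_word y) \<in> plactic_rel n"
    "(x, y) \<in> col_cong n"
    by blast+
qed

text \<open>Any irreducible descendant is a tableau reading in the plactic class of the original
  word, and uniqueness leaves only one.\<close>

lemma normal_form:
  assumes "x \<in> lists (col_generators n)"
  shows "(col_step n)\<^sup>*\<^sup>* x (map Gen (normal_columns n (col_word x)))"
proof -
  have "\<exists>y. (col_step n)\<^sup>*\<^sup>* x y \<and> (\<forall>z. \<not> col_step n y z)"
    using wf_inv_image[OF wf_column_order, of columns_of]
  proof (induction x rule: wf_induct_rule)
    case (less x)
    show ?case
    proof (cases "\<exists>z. col_step n x z")
      case True
      then obtain z where z: "col_step n x z" by blast
      then have "(z, x) \<in> inv_image column_order columns_of"
        using col_step_props(4) by simp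
      from less.IH[OF this] z show ?thesis
        by (meson converse_rtranclp_into_rtranclp)
    qed blast
  qed
  then obtain y where y: "(col_step n)\<^sup>*\<^sup>* x y" "\<And>z. \<not> col_step n y z"
    by blast
  note props = col_steps_props[OF y(1) assms]
  have "tableau_word n (columns_of y)"
    by (rule irreducible_tableau_word[OF props(1) y(2)])
  then have "normal_columns n (col_word x) = columns_of y"
    using props(2) by (intro normal_columns_eqI) (simp_all add: col_word_def)
  with y(1) show ?thesis by simp
qed

lemma normal_columns_cong:
  assumes "(u, v) \<in> plactic_rel n"
  shows "normal_columns n u = normal_columns n v"
  using normal_columns_props[OF plactic_alphabet(2)[OF assms]] plactic_trans[OF assms]
  by (intro normal_columns_eqI) auto

lemma confluent_col_step: "confluentp (col_step n)"
proof (rule confluentpI)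
  fix x y z assume xy: "(col_step n)\<^sup>*\<^sup>* x y" and xz: "(col_step n)\<^sup>*\<^sup>* x z"
  show "\<exists>u. (col_step n)\<^sup>*\<^sup>* y u \<and> (col_step n)\<^sup>*\<^sup>* z u"
  proof (cases "x \<in> lists (col_generators n)")
    case True
    then show ?thesis
      using normal_form[OF col_steps_props(1)[OF xy True]] normal_form[OF col_steps_props(1)[OF xz True]]
        normal_columns_cong[OF col_steps_props(2)[OF xy True]]
        normal_columns_cong[OF col_steps_props(2)[OF xz True]] by metis
  next
    \<comment> \<open>Sources and contexts of steps lie in the free monoid, so a list outside it
      admits no step.\<close>
    case False
    then have "y = x" "z = x"
      using xy xz col_step_props(1) by (metis converse_rtranclpE)+
    then show ?thesis by blast
  qed
qed

text \<open>Words with equivalent readings rewrite to the same normal form, which links them inside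
  the congruence.\<close>

lemma generated_congruence_iff:
  "(x, y) \<in> col_cong n \<longleftrightarrow>
     x \<in> lists (col_generators n) \<and> y \<in> lists (col_generators n) \<and>
     (col_word x, col_word y) \<in> plactic_rel n"
proof
  assume "(x, y) \<in> col_cong n"
  then show "x \<in> lists (col_generators n) \<and> y \<in> lists (col_generators n) \<and>
    (col_word x, col_word y) \<in> plactic_rel n"
  proof (induction rule: generated_congruence.induct)
    case (base s t)
    then show ?case using col_ruleE by blast
  next
    case (refl u)
    then show ?case using plactic_refl col_word_alphabet by blast
  next
    case (sym u v)
    then show ?case using plactic_sym by blast
  next
    case (trans u v w)
    then show ?case using plactic_trans by blast
  next
    case (mult u v u' v')
    then show ?case using plactic_append by simp
  qed
next
  assume xy: "x \<in> lists (col_generators n) \<and> y \<in> lists (col_generators n) \<and>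
    (col_word x, col_word y) \<in> plactic_rel n"
  then have eq: "normal_columns n (col_word x) = normal_columns n (col_word y)"
    using normal_columns_cong by blast
  have "(x, map Gen (normal_columns n (col_word x))) \<in> col_cong n"
    "(y, map Gen (normal_columns n (col_word y))) \<in> col_cong n"
    using xy col_steps_props(3) normal_form by blast+
  then show "(x, y) \<in> col_cong n"
    unfolding eq by (blast intro: generated_congruence.trans generated_congruence.sym)
qed

section \<open>The isomorphism with the plactic monoid\<close>

lemma quotient_monoid_mult:
  assumes r: "equiv (lists A) r"
    and cong: "\<And>u v u' v'. (u, v) \<in> r \<Longrightarrow> (u', v') \<in> r \<Longrightarrow> (u @ u', v @ v') \<in> r"
    and u: "u \<in> lists A" and v: "v \<in> lists A"
  shows "(r `` {u}) \<otimes>\<^bsub>quotient_monoid A r\<^esub> (r `` {v}) = r `` {u @ v}"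
proof -
  have *: "r `` {a @ b} = r `` {u @ v}" if a: "a \<in> r `` {u}" and b: "b \<in> r `` {v}" for a b
  proof -
    have "(u @ v, a @ b) \<in> r"
      by (rule cong) (use a b in blast)+
    then show ?thesis
      by (rule equiv_class_eq[OF r, symmetric])
  qed
  have self: "u \<in> r `` {u}" "v \<in> r `` {v}"
    by (rule equiv_class_self[OF r u], rule equiv_class_self[OF r v])
  have "(\<Union>a\<in>r `` {u}. \<Union>b\<in>r `` {v}. r `` {a @ b}) = (\<Union>a\<in>r `` {u}. \<Union>b\<in>r `` {v}. r `` {u @ v})"
    by (simp add: * cong: SUP_cong_simp)
  also have "\<dots> = r `` {u @ v}"
    using self by blast
  finally show ?thesis
    by (simp add: quotient_monoid_def)
qed

lemma equiv_plactic: "equiv (lists (alphabet n)) (plactic_rel n)"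
proof (rule equivI)
  show "plactic_rel n \<subseteq> lists (alphabet n) \<times> lists (alphabet n)"
    by (auto simp only: plactic_rel_def)
  show "refl_on (lists (alphabet n)) (plactic_rel n)"
    by (rule refl_onI) (rule plactic_refl)
  show "sym (plactic_rel n)"
    by (rule symI) (rule plactic_sym)
  show "trans (plactic_rel n)"
    by (rule transI) (rule plactic_trans)
qed

lemma equiv_generated_congruence:
  "equiv (lists (col_generators n)) (col_cong n)"
proof (rule equivI)
  let ?r = "col_cong n"
  show "?r \<subseteq> lists (col_generators n) \<times> lists (col_generators n)"
    using generated_congruence_iff by auto
  show "refl_on (lists (col_generators n)) ?r"
    by (rule refl_onI) (rule generated_congruence.refl)
  show "sym ?r"
    by (rule symI) (rule generated_congruence.sym)
  show "trans ?r"
    by (rule transI) (rule generated_congruence.trans)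
qed

text \<open>A single letter is an admissible column, as N(m) <= 1 <= m. Hence every word is the
  reading of a word in the generators, which makes the map onto the plactic monoid
  surjective.\<close>

lemma letter_columns:
  assumes "w \<in> lists (alphabet n)"
  shows "map (\<lambda>x. Gen [x]) w \<in> lists (col_generators n)" "col_word (map (\<lambda>x. Gen [x]) w) = w"
proof -
  have "[x] \<in> admissible_columns n" if "x \<in> alphabet n" for x
    using that by (auto simp: admissible_columns_def admissible_def is_column_def)
  then show "map (\<lambda>x. Gen [x]) w \<in> lists (col_generators n)"
    using assms by (auto simp: col_generators_def)
  have "columns_of (map (\<lambda>x. Gen [x]) w) = map (\<lambda>x. [x]) w"
    by (induction w) auto
  then show "col_word (map (\<lambda>x. Gen [x]) w) = w"
    by (simp add: col_word_def)
qed

lemma presented_iso_plactic: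
  "presented_monoid (col_generators n) (col_rules n) \<cong> plactic_monoid n"
proof -
  let ?A = "col_generators n" and ?r = "col_cong n"
  let ?B = "alphabet n" and ?s = "plactic_rel n"
  let ?G = "presented_monoid ?A (col_rules n)" and ?H = "plactic_monoid n"
  \<comment> \<open>Saturating the image by the plactic relation gives a definition without a choice
    of representatives; on the class of \<open>x\<close> it is the plactic class of
    \<open>col_word x\<close>.\<close>
  define \<Phi> where "\<Phi> X = ?s `` (col_word ` X)" for X
  have \<Phi>: "\<Phi> (?r `` {x}) = ?s `` {col_word x}" if x: "x \<in> lists ?A" for x
  proof
    show "\<Phi> (?r `` {x}) \<subseteq> ?s `` {col_word x}"
      unfolding \<Phi>_def using generated_congruence_iff plactic_trans by blast
    show "?s `` {col_word x} \<subseteq> \<Phi> (?r `` {x})"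
      unfolding \<Phi>_def using equiv_class_self[OF equiv_generated_congruence x] by blast
  qed
  have carG: "carrier ?G = lists ?A // ?r" and carH: "carrier ?H = lists ?B // ?s"
    by (simp_all add: presented_monoid_def plactic_monoid_def quotient_monoid_def)
  have multG: "(?r `` {x}) \<otimes>\<^bsub>?G\<^esub> (?r `` {y}) = ?r `` {x @ y}" if "x \<in> lists ?A" "y \<in> lists ?A" for x y
    unfolding presented_monoid_def
    by (rule quotient_monoid_mult[OF equiv_generated_congruence generated_congruence.mult that])
  have multH: "(?s `` {u}) \<otimes>\<^bsub>?H\<^esub> (?s `` {v}) = ?s `` {u @ v}" if "u \<in> lists ?B" "v \<in> lists ?B" for u v
    unfolding plactic_monoid_def
    by (rule quotient_monoid_mult[OF equiv_plactic plactic_append that])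
  have GE: "\<exists>x \<in> lists ?A. X = ?r `` {x}" if "X \<in> carrier ?G" for X
    using that unfolding carG by (auto elim!: quotientE)
  have "\<Phi> \<in> hom ?G ?H"
  proof (rule homI)
    fix X assume "X \<in> carrier ?G"
    then obtain x where x: "x \<in> lists ?A" "X = ?r `` {x}"
      using GE by blast
    show "\<Phi> X \<in> carrier ?H"
      unfolding x(2) \<Phi>[OF x(1)] carH by (rule quotientI[OF col_word_alphabet[OF x(1)]])
    fix Y assume "Y \<in> carrier ?G"
    then obtain y where y: "y \<in> lists ?A" "Y = ?r `` {y}"
      using GE by blast
    have xy: "x @ y \<in> lists ?A"
      using x y by simp
    show "\<Phi> (X \<otimes>\<^bsub>?G\<^esub> Y) = \<Phi> X \<otimes>\<^bsub>?H\<^esub> \<Phi> Y"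
      unfolding x(2) y(2) multG[OF x(1) y(1)] \<Phi>[OF xy] \<Phi>[OF x(1)] \<Phi>[OF y(1)]
        multH[OF col_word_alphabet[OF x(1)] col_word_alphabet[OF y(1)]] by simp
  qed
  moreover have "bij_betw \<Phi> (carrier ?G) (carrier ?H)"
    unfolding bij_betw_def
  proof
    show "inj_on \<Phi> (carrier ?G)"
    proof (rule inj_onI)
      fix X Y assume "X \<in> carrier ?G" "Y \<in> carrier ?G" and eq: "\<Phi> X = \<Phi> Y"
      then obtain x y where x: "x \<in> lists ?A" "X = ?r `` {x}" and y: "y \<in> lists ?A" "Y = ?r `` {y}"
        using GE by meson
      have "(col_word x, col_word y) \<in> ?s"
        using eq_equiv_class[OF _ equiv_plactic col_word_alphabet[OF y(1)]] eq
        by (simp add: x(2) y(2) \<Phi>[OF x(1)] \<Phi>[OF y(1)])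
      then have "(x, y) \<in> ?r"
        using x y by (simp only: generated_congruence_iff)
      then show "X = Y"
        unfolding x(2) y(2) by (rule equiv_class_eq[OF equiv_generated_congruence])
    qed
    show "\<Phi> ` carrier ?G = carrier ?H"
    proof
      show "\<Phi> ` carrier ?G \<subseteq> carrier ?H"
        using \<open>\<Phi> \<in> hom ?G ?H\<close> by (auto simp: hom_def)
      show "carrier ?H \<subseteq> \<Phi> ` carrier ?G"
      proof
        fix Y assume "Y \<in> carrier ?H"
        then obtain w where w: "w \<in> lists ?B" "Y = ?s `` {w}"
          unfolding carH by (auto elim!: quotientE)
        let ?x = "map (\<lambda>x. Gen [x]) w"
        have "\<Phi> (?r `` {?x}) = Y"
          unfolding \<Phi>[OF letter_columns(1)[OF w(1)]] letter_columns(2)[OF w(1)] w(2) ..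
        moreover have "?r `` {?x} \<in> carrier ?G"
          unfolding carG by (rule quotientI[OF letter_columns(1)[OF w(1)]])
        ultimately show "Y \<in> \<Phi> ` carrier ?G"
          by blast
      qed
    qed
  qed
  ultimately have "\<Phi> \<in> iso ?G ?H"
    by (simp add: iso_def)
  then show ?thesis
    by (auto simp: is_iso_def)
qed

theorem theorem4p2p4:
  fixes n :: nat
  assumes "n \<ge> 1"
  shows "finite (col_generators n) \<and> finite (col_rules n) \<and>
    convergent_system (col_generators n) (col_rules n) \<and>
    presented_monoid (col_generators n) (col_rules n) \<cong> plactic_monoid n"
  using finite_admissible_columns finite_col_rules terminating_col_step confluent_col_step
    presented_iso_plactic
  by (simp add: col_generators_def convergent_system_def)

end
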